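(* Let $p\geq 2$ and let $G$ be a finite simple $\{pK_2, \mathrm{HVN}\}$-free graph. Then $\chi(G)\leq f_p(\omega(G))$, where $f_p:\mathbb{N}\to\mathbb{N}$ ($p\geq2$) is defined by: $f_t(1)=1$ for $t\geq 2$; $f_2(2)=3$; $f_2(3)=4$; $f_2(s)=s$ for $s\geq 4$; $f_p(2)=2p-2$ and $f_p(3)=2p^2-3p+4$ for $p\geq 3$; and $f_p(m)=f_{p-1}(m)+2f_{p-1}(m-1)$ for $p\geq 3$, $m\geq 4$.
   Context: $\chi(G)$ is the chromatic number and $\omega(G)$ the clique number of $G$. $pK_2$ is the disjoint union of $p$ edges. HVN is the graph on five vertices consisting of a $K_4$ together with a fifth vertex adjacent to exactly two vertices of the $K_4$ (equivalently the join $(K_1\cup K_2)+K_2$). A graph is $\mathcal{F}$-free if it has no induced subgraph isomorphic to a member of $\mathcal{F}$. *)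

theory Defs
  imports "Graph_Theory.Graph_Theory"
begin

text \<open>
  A finite simple graph is a \<open>pair_graph\<close>: a finite vertex set with a symmetric, irreflexive set
  of arcs, so that every undirected edge appears as two opposite arcs.
\<close>

definition is_clique :: "'a pair_pre_digraph \<Rightarrow> 'a set \<Rightarrow> bool" where
  "is_clique G S \<longleftrightarrow>
     S \<subseteq> pverts G \<and> (\<forall>u\<in>S. \<forall>v\<in>S. u \<noteq> v \<longrightarrow> (u, v) \<in> parcs G)"

definition clique_number :: "'a pair_pre_digraph \<Rightarrow> nat" where
  "clique_number G = Max (card ` {S. is_clique G S})"

definition proper_coloring :: "'a pair_pre_digraph \<Rightarrow> nat \<Rightarrow> ('a \<Rightarrow> nat) \<Rightarrow> bool" where
  "proper_coloring G k c \<longleftrightarrow>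
     (\<forall>v\<in>pverts G. c v < k) \<and> (\<forall>(u, v)\<in>parcs G. c u \<noteq> c v)"

definition chromatic_number :: "'a pair_pre_digraph \<Rightarrow> nat" where
  "chromatic_number G = (LEAST k. \<exists>c. proper_coloring G k c)"

definition free_of :: "nat pair_pre_digraph set \<Rightarrow> 'a pair_pre_digraph \<Rightarrow> bool" where
  "free_of F G \<longleftrightarrow>
     \<not> (\<exists>H. induced_subgraph H (with_proj G) \<and> (\<exists>K\<in>F. digraph_iso H (with_proj K)))"

text \<open>The \<open>p\<close> edges of \<open>pK\<^sub>2\<close> are \<open>{2i, 2i + 1}\<close> for \<open>i < p\<close>.\<close>

definition matching_graph :: "nat \<Rightarrow> nat pair_pre_digraph" where
  "matching_graph p =
     \<lparr> pverts = {..<2 * p},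
       parcs = (\<Union>i<p. {(2 * i, 2 * i + 1), (2 * i + 1, 2 * i)}) \<rparr>"

text \<open>A \<open>K\<^sub>4\<close> on \<open>{0, 1, 2, 3}\<close> and a fifth vertex \<open>4\<close> adjacent to exactly \<open>0\<close> and \<open>1\<close>.\<close>

definition HVN :: "nat pair_pre_digraph" where
  "HVN =
     \<lparr> pverts = {..<5},
       parcs = {(u, v). u < 4 \<and> v < 4 \<and> u \<noteq> v} \<union> {(4, 0), (0, 4), (4, 1), (1, 4)} \<rparr>"

text \<open>
  The bounding function is only meaningful for \<open>p \<ge> 2\<close> and \<open>m \<ge> 1\<close>; elsewhere it is set to \<open>0\<close>.
  For \<open>p \<ge> 2\<close> none of the subtractions below is truncated.
\<close>

fun f_bound :: "nat \<Rightarrow> nat \<Rightarrow> nat" where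
  "f_bound p m =
     (if p < 2 \<or> m = 0 then 0
      else if m = 1 then 1
      else if p = 2 then (if m = 2 then 3 else if m = 3 then 4 else m)
      else if m = 2 then 2 * p - 2
      else if m = 3 then 2 * p ^ 2 - 3 * p + 4
      else f_bound (p - 1) m + 2 * f_bound (p - 1) (m - 1))"

declare f_bound.simps [simp del]

lemma f_bound_equations:
  "t \<ge> 2 \<Longrightarrow> f_bound t 1 = 1"
  "f_bound 2 2 = 3"
  "f_bound 2 3 = 4"
  "s \<ge> 4 \<Longrightarrow> f_bound 2 s = s"
  "p \<ge> 3 \<Longrightarrow> f_bound p 2 = 2 * p - 2"
  "p \<ge> 3 \<Longrightarrow> int (f_bound p 3) = 2 * int p ^ 2 - 3 * int p + 4"
  "p \<ge> 3 \<Longrightarrow> m \<ge> 4 \<Longrightarrow> f_bound p m = f_bound (p - 1) m + 2 * f_bound (p - 1) (m - 1)"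
proof -
  assume p: "p \<ge> 3"
  then have "3 * p \<le> p * p" by (rule mult_right_mono) simp
  then have "3 * p \<le> 2 * p ^ 2" unfolding power2_eq_square by linarith
  with p show "int (f_bound p 3) = 2 * int p ^ 2 - 3 * int p + 4"
    by (simp add: f_bound.simps[of p 3] of_nat_diff)
qed (simp_all add: f_bound.simps[of t "Suc 0"] f_bound.simps[of 2] f_bound.simps[of p 2]
       f_bound.simps[of p m])

lemma pair_graph_matching_graph: "pair_graph (matching_graph p)"
  by unfold_locales (auto simp: matching_graph_def symmetric_def intro!: symI)

lemma pair_graph_HVN: "pair_graph HVN"
proof -
  have "finite (parcs HVN)"
    by (rule finite_subset[of _ "{..<5} \<times> {..<5}"]) (auto simp: HVN_def)
  then show ?thesis
    by unfold_locales (auto simp: HVN_def symmetric_def intro!: symI)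
qed

end

theory Submission
  imports Defs
begin

text \<open>
  Induction on \<open>p\<close>. The vertices adjacent to neither end of an edge induce a \<open>(p - 1)K\<^sub>2\<close>-free
  graph. If \<open>\<omega> \<ge> 4\<close>, excluding HVN forces every vertex to have exactly one non-neighbour or at most
  one neighbour in a maximum clique \<open>K\<close>. The vertices of the first kind form a complete multipartite
  graph, a vertex whose neighbour in \<open>K\<close> is \<open>k\<close> is adjacent to no part other than that of \<open>k\<close>, and the
  remaining vertices split into three sets to which the induction hypothesis applies; their colours
  can be reused on the parts. If \<open>\<omega> = 3\<close>, a triangle is used in the same way.

  The induction rests on two theorems: \<open>(2K\<^sub>2, K\<^sub>4)\<close>-free graphs (Gaspers and Huang) and
  \<open>(3K\<^sub>2, K\<^sub>3)\<close>-free graphs (Brandt) are 4-colourable. Both are proved by excluding, one after the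
  other, a list of induced subgraphs from a smallest counterexample \<open>G\<close>. A subgraph \<open>H\<close> is excluded
  for one of two reasons. Either it has non-adjacent vertices \<open>u\<close>, \<open>v\<close> such that all neighbours of \<open>u\<close>
  in \<open>H\<close> are neighbours of \<open>v\<close>: by minimality some vertex of \<open>G\<close> is adjacent to \<open>u\<close> but not to \<open>v\<close>,
  and every extension of \<open>H\<close> by such a vertex contains a graph excluded before. Or colouring each
  vertex of \<open>G\<close> according to its neighbours in \<open>H\<close> gives a proper 4-colouring. The lists, and the
  case distinctions that verify these claims, were found by computer and are checked here by a
  verified procedure.
\<close>

section \<open>Colourings and induced matchings\<close>

text \<open>Origin of the recurrence: choose \<open>k1\<close>, \<open>k2\<close>, \<open>k3\<close>
  in \<open>K\<close>. Among the vertices with at most one neighbour in \<open>K\<close>, those that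
  miss \<open>k1\<close> and \<open>k2\<close> are far from the edge \<open>k1 k2\<close> and may
  still have clique number m. Those adjacent to \<open>k1\<close> are far from the edge
  \<open>k2 k3\<close>, and their clique number is at most m - 1, since \<open>k1\<close> sees all
  of them; likewise for \<open>k2\<close>. This costs f_{p-1}(m) + 2 f_{p-1}(m-1). The parts are
  free of charge: all but that of \<open>k1\<close> reuse the colours of the second set, and that of
  \<open>k1\<close> reuses those of the third. For this, f_{p-1}(m-1) must be at least m - 1. The
  values for m = 2 come from splitting along an edge \<open>uv\<close> into the neighbours of
  \<open>u\<close>, those of \<open>v\<close>, and the vertices far from \<open>uv\<close>, at two
  new colours per step. Started at p = 2 this gives 5 for p = 3; Brandt's theorem supplies the
  required 4. Adjacency is a predicate \<open>E\<close> used on a vertex set, so that passing to an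
  induced subgraph changes the set only. Graphs as objects return when the hypothesis on G is
  translated.\<close>

definition colorable :: "('a \<Rightarrow> 'a \<Rightarrow> bool) \<Rightarrow> 'a set \<Rightarrow> nat \<Rightarrow> bool" where
  "colorable E W k \<longleftrightarrow>
     (\<exists>c. (\<forall>v\<in>W. c v < k) \<and> (\<forall>u\<in>W. \<forall>v\<in>W. E u v \<longrightarrow> c u \<noteq> c v))"

text \<open>\<open>u\<close> and \<open>v\<close> are excluded implicitly: if \<open>E\<close> is
  symmetric and \<open>E u v\<close> holds, neither of them satisfies the condition.\<close>

definition far :: "('a \<Rightarrow> 'a \<Rightarrow> bool) \<Rightarrow> 'a set \<Rightarrow> 'a \<Rightarrow> 'a \<Rightarrow> 'a set" where
  "far E W u v = {w \<in> W. \<not> E u w \<and> \<not> E v w}"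

text \<open>An induced \<open>pK2\<close>, peeled off edge by edge: whatever remains must lie in
  \<open>far\<close> of the chosen edge. In this form the hypothesis passes from
  \<open>Suc p\<close> to \<open>p\<close> in the induction.\<close>

primrec has_matching :: "('a \<Rightarrow> 'a \<Rightarrow> bool) \<Rightarrow> nat \<Rightarrow> 'a set \<Rightarrow> bool" where
  "has_matching E 0 W \<longleftrightarrow> True"
| "has_matching E (Suc p) W \<longleftrightarrow> (\<exists>u\<in>W. \<exists>v\<in>W. E u v \<and> has_matching E p (far E W u v))"

lemma has_matching_SucI:
  "u \<in> W \<Longrightarrow> v \<in> W \<Longrightarrow> E u v \<Longrightarrow> has_matching E p (far E W u v) \<Longrightarrow> has_matching E (Suc p) W"
  by auto

lemma has_matching_1I: "u \<in> W \<Longrightarrow> v \<in> W \<Longrightarrow> E u v \<Longrightarrow> has_matching E (Suc 0) W"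
  by auto

lemma has_matching_mono: "has_matching E p A \<Longrightarrow> A \<subseteq> W \<Longrightarrow> has_matching E p W"
proof (induction p arbitrary: A W)
  case (Suc p)
  then obtain u v where uv: "u \<in> A" "v \<in> A" "E u v" "has_matching E p (far E A u v)"
    by fastforce
  then have "has_matching E p (far E W u v)"
    using Suc.prems(2) by (intro Suc.IH[OF uv(4)]) (auto simp: far_def)
  then show ?case
    using uv(1-3) Suc.prems(2) by auto
qed simp

declare has_matching.simps [simp del]

lemma colorableI:
  assumes "\<And>v. v \<in> W \<Longrightarrow> c v < k"
    and "\<And>u v. u \<in> W \<Longrightarrow> v \<in> W \<Longrightarrow> E u v \<Longrightarrow> c u \<noteq> c v"
  shows "colorable E W k"
  unfolding colorable_def using assms by (intro exI[of _ c]) auto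

lemma colorableE:
  assumes "colorable E W k"
  obtains c where "\<And>v. v \<in> W \<Longrightarrow> c v < k"
    and "\<And>u v. u \<in> W \<Longrightarrow> v \<in> W \<Longrightarrow> E u v \<Longrightarrow> c u \<noteq> c v"
proof -
  from assms obtain c where "\<forall>v\<in>W. c v < k" "\<forall>u\<in>W. \<forall>v\<in>W. E u v \<longrightarrow> c u \<noteq> c v"
    unfolding colorable_def by auto
  then show thesis
    by (intro that[of c]) auto
qed

lemma colorable_mono: "colorable E W k \<Longrightarrow> k \<le> l \<Longrightarrow> colorable E W l"
  unfolding colorable_def by (fast intro: less_le_trans)

lemma colorable_subset: "colorable E W k \<Longrightarrow> A \<subseteq> W \<Longrightarrow> colorable E A k"
  unfolding colorable_def by blast

lemma colorable_independent: "(\<And>u v. u \<in> W \<Longrightarrow> v \<in> W \<Longrightarrow> \<not> E u v) \<Longrightarrow> colorable E W 1"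
  by (rule colorableI[of _ "\<lambda>_. 0"]) auto

lemma colorable_Un:
  assumes "colorable E A k" "colorable E B l"
  shows "colorable E (A \<union> B) (k + l)"
proof -
  obtain c where c: "\<And>v. v \<in> A \<Longrightarrow> c v < k" "\<And>u v. u \<in> A \<Longrightarrow> v \<in> A \<Longrightarrow> E u v \<Longrightarrow> c u \<noteq> c v"
    using colorableE[OF assms(1)] by metis
  obtain d where d: "\<And>v. v \<in> B \<Longrightarrow> d v < l" "\<And>u v. u \<in> B \<Longrightarrow> v \<in> B \<Longrightarrow> E u v \<Longrightarrow> d u \<noteq> d v"
    using colorableE[OF assms(2)] by metis
  let ?c = "\<lambda>v. if v \<in> A then c v else k + d v"
  have "?c v < k + l" if "v \<in> A \<union> B" for v
    using that c(1)[of v] d(1)[of v] by auto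
  moreover have "?c u \<noteq> ?c v" if "u \<in> A \<union> B" "v \<in> A \<union> B" "E u v" for u v
    using that c(1)[of u] c(1)[of v] c(2)[of u v] d(2)[of u v] by auto
  ultimately show ?thesis
    by (rule colorableI)
qed

lemma colorable_Un_anticomplete:
  assumes "colorable E A k" "colorable E B k"
    and anti: "\<And>u v. u \<in> A \<Longrightarrow> v \<in> B \<Longrightarrow> \<not> E u v \<and> \<not> E v u"
  shows "colorable E (A \<union> B) k"
proof -
  obtain c where c: "\<And>v. v \<in> A \<Longrightarrow> c v < k" "\<And>u v. u \<in> A \<Longrightarrow> v \<in> A \<Longrightarrow> E u v \<Longrightarrow> c u \<noteq> c v"
    using colorableE[OF assms(1)] by metis
  obtain d where d: "\<And>v. v \<in> B \<Longrightarrow> d v < k" "\<And>u v. u \<in> B \<Longrightarrow> v \<in> B \<Longrightarrow> E u v \<Longrightarrow> d u \<noteq> d v"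
    using colorableE[OF assms(2)] by metis
  let ?c = "\<lambda>v. if v \<in> A then c v else d v"
  have "?c v < k" if "v \<in> A \<union> B" for v
    using that c(1)[of v] d(1)[of v] by auto
  moreover have "?c u \<noteq> ?c v" if "u \<in> A \<union> B" "v \<in> A \<union> B" "E u v" for u v
    using that anti[of u v] anti[of v u] c(2)[of u v] d(2)[of u v] by auto
  ultimately show ?thesis
    by (rule colorableI)
qed

section \<open>Symmetric adjacency, and graphs that are critical for 4-colourability\<close>

locale simple_graph =
  fixes V :: "'a set" and E :: "'a \<Rightarrow> 'a \<Rightarrow> bool"
  assumes sym: "E u v \<Longrightarrow> E v u"
    and irrefl: "\<not> E v v"
begin

lemma adj_commute: "E u v \<longleftrightarrow> E v u"
  by (blast intro: sym)

text \<open>A 2-colouring is propagated from an edge \<open>ab\<close>. If it fails, the failure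
  exhibits a vertex \<open>r\<close> far from \<open>ab\<close> that has a neighbour
  \<open>p\<close> next to \<open>a\<close> and a neighbour \<open>q\<close> next to
  \<open>b\<close>. Then \<open>p\<close>, \<open>a\<close>, \<open>b\<close>, \<open>q\<close>,
  \<open>r\<close> is a 5-cycle, and it has no chord because there are no triangles.\<close>

lemma bipartite_or_C5:
  assumes tri: "\<And>a b c. a \<in> W \<Longrightarrow> b \<in> W \<Longrightarrow> c \<in> W \<Longrightarrow> E a b \<Longrightarrow> E b c \<Longrightarrow> \<not> E a c"
    and far: "\<And>a b x y. a \<in> W \<Longrightarrow> b \<in> W \<Longrightarrow> E a b \<Longrightarrow> x \<in> far E W a b \<Longrightarrow> y \<in> far E W a b \<Longrightarrow> \<not> E x y"
    and not2: "\<not> colorable E W 2"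
  obtains a b c d e where "{a, b, c, d, e} \<subseteq> W" "E a b" "E b c" "E c d" "E d e" "E e a"
    "\<not> E a c" "\<not> E a d" "\<not> E b d" "\<not> E b e" "\<not> E c e"
proof -
  have "\<exists>a\<in>W. \<exists>b\<in>W. E a b"
    using not2 colorable_independent[of W E] colorable_mono[of E W 1 2] by auto
  then obtain a b where ab: "a \<in> W" "b \<in> W" "E a b"
    by blast
  \<comment> \<open>Neighbours of \<open>a\<close> get 0 and neighbours of \<open>b\<close> get 1,
    so \<open>a\<close> and \<open>b\<close> themselves get 1 and 0. A vertex far from
    \<open>ab\<close> gets 1 exactly if some neighbour of \<open>a\<close> forbids 0.\<close>
  define c where "c x = (if E a x then 0 else if E b x then 1
      else if \<exists>p\<in>W. E a p \<and> E x p then 1 else 0 :: nat)" for x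
  have "\<exists>x\<in>W. \<exists>y\<in>W. E x y \<and> c x = c y"
  proof (rule ccontr)
    assume "\<not> ?thesis"
    moreover have "c x < 2" for x
      by (simp add: c_def)
    ultimately show False
      using not2 colorableI[of W c 2 E] by blast
  qed
  then obtain x y where xy: "x \<in> W" "y \<in> W" "E x y" "c x = c y"
    by blast
  have no: "\<not> (E a w \<and> E b w)" if "w \<in> W" for w
    using tri[OF ab(1,2) that] ab by auto
  \<comment> \<open>A monochromatic edge has an end next to \<open>a\<close> or \<open>b\<close>, as
    the far vertices are independent. An end next to \<open>a\<close> has colour 0 and forces 1 on a
    far neighbour, so the end is next to \<open>b\<close>, and the other end is a far vertex
    coloured 1.\<close>
  have key: "\<exists>r p q. r \<in> W \<and> p \<in> W \<and> q \<in> W \<and> \<not> E a r \<and> \<not> E b r \<and> E a p \<and> E r p \<and> E b q \<and> E r q"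
    if xy: "x \<in> W" "y \<in> W" "E x y" "c x = c y" and x: "E a x \<or> E b x" for x y
  proof (cases "E a x")
    case True
    then have "\<not> E a y"
      using tri[OF ab(1) xy(1,2)] xy by auto
    then show ?thesis
      using True xy sym[OF xy(3)] by (auto simp: c_def split: if_splits)
  next
    case False
    then have "E b x" "\<not> E b y"
      using x tri[OF ab(2) xy(1,2)] xy by auto
    moreover from this False have "\<not> E a y" "\<exists>p\<in>W. E a p \<and> E y p"
      using xy(4) by (auto simp: c_def split: if_splits)
    ultimately show ?thesis
      using xy(1,2) sym[OF xy(3)] by blast
  qed
  have "E a x \<or> E b x \<or> E a y \<or> E b y"
    using far[OF ab, of x y] xy by (auto simp: far_def)
  then have "\<exists>r p q. r \<in> W \<and> p \<in> W \<and> q \<in> W \<and> \<not> E a r \<and> \<not> E b r \<and> E a p \<and> E r p \<and> E b q \<and> E r q"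
    using key[OF xy] key[OF xy(2,1) sym[OF xy(3)] xy(4)[symmetric]] by blast
  then obtain r p q where "r \<in> W" "p \<in> W" "q \<in> W" "\<not> E a r" "\<not> E b r" "E a p" "E r p" "E b q" "E r q"
    by blast
  note w = this
  have "\<not> E p q" "\<not> E p b" "\<not> E a q"
    using tri[of p r q] no[of p] no[of q] w sym by blast+
  then show thesis
    using ab w sym[OF w(6)] sym[OF w(7)] sym[of r a] sym[of r b]
    by (intro that[of p a b q r]) (auto intro: sym)
qed

end

locale critical_graph = simple_graph +
  assumes not_colorable: "\<not> colorable E V 4"
    and incomparable: "u \<in> V \<Longrightarrow> v \<in> V \<Longrightarrow> u \<noteq> v \<Longrightarrow> \<not> E u v \<Longrightarrow> \<exists>w\<in>V. E u w \<and> \<not> E v w"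

context simple_graph
begin

text \<open>A smallest non-4-colourable subset works: if every neighbour of \<open>u\<close> in it
  were a neighbour of \<open>v\<close>, a 4-colouring without \<open>u\<close> would extend by
  giving \<open>u\<close> the colour of \<open>v\<close>.\<close>

lemma exists_critical_subgraph:
  assumes "finite W" "\<not> colorable E W 4"
  obtains A where "A \<subseteq> W" "critical_graph A E"
proof -
  obtain A where A: "A \<subseteq> W" "\<not> colorable E A 4"
    and least: "\<And>B. B \<subseteq> W \<Longrightarrow> \<not> colorable E B 4 \<Longrightarrow> card A \<le> card B"
    using assms arg_min_nat_lemma[of "\<lambda>A. A \<subseteq> W \<and> \<not> colorable E A 4" W card] by blast
  have "\<exists>w\<in>A. E u w \<and> \<not> E v w" if uv: "u \<in> A" "v \<in> A" "u \<noteq> v" "\<not> E u v" for u v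
  proof (rule ccontr)
    assume dom: "\<not> ?thesis"
    have "card (A - {u}) < card A"
      using A assms uv by (intro card_Diff1_less) (auto dest: finite_subset)
    then have "colorable E (A - {u}) 4"
      using least[of "A - {u}"] A by fastforce
    then obtain c :: "'a \<Rightarrow> nat" where c: "\<forall>v\<in>A - {u}. c v < 4" "\<forall>x\<in>A - {u}. \<forall>y\<in>A - {u}. E x y \<longrightarrow> c x \<noteq> c y"
      unfolding colorable_def by auto
    have new: "c v \<noteq> c y" if "y \<in> A" "E u y" for y
    proof -
      have "y \<noteq> u" "E v y"
        using that dom irrefl by auto
      then show ?thesis
        using c(2) that uv by auto
    qed
    let ?c = "c(u := c v)"
    have "?c x < 4" if "x \<in> A" for x
      using c(1) uv that by auto
    moreover have "?c x \<noteq> ?c y" if "x \<in> A" "y \<in> A" "E x y" for x y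
      using c(2) that new[of x] new[of y] sym[of x y] irrefl[of u] by (cases "x = u"; cases "y = u") auto
    ultimately have "colorable E A 4"
      by (rule colorableI)
    then show False
      using A by simp
  qed
  then have "critical_graph A E"
    using A by unfold_locales auto
  then show thesis
    using A that by blast
qed

end

section \<open>Certificates for excluded subgraphs\<close>

text \<open>One type serves as names of vertices, as labels of excluded patterns in a list
  \<open>D\<close>, and as colours. Twelve values suffice: the largest patterns have ten vertices,
  and a colouring certificate names two more.\<close>

datatype ix = X0 | X1 | X2 | X3 | X4 | X5 | X6 | X7 | X8 | X9 | XA | XB

text \<open>
  What is known about a pair of named vertices: nothing (\<open>U\<close>), that they are distinct (\<open>Q\<close>), adjacent
  (\<open>Y\<close>), or distinct and non-adjacent (\<open>N\<close>).
\<close>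

datatype kn = U | Q | Y | N

text \<open>Tuples with one entry per index make every lookup a single rewrite step.\<close>

datatype 'a row = Row 'a 'a 'a 'a 'a 'a 'a 'a 'a 'a 'a 'a

fun entry :: "'a row \<Rightarrow> ix \<Rightarrow> 'a" where
  "entry (Row a b c d e f g h i j k l) X0 = a"
| "entry (Row a b c d e f g h i j k l) X1 = b"
| "entry (Row a b c d e f g h i j k l) X2 = c"
| "entry (Row a b c d e f g h i j k l) X3 = d"
| "entry (Row a b c d e f g h i j k l) X4 = e"
| "entry (Row a b c d e f g h i j k l) X5 = f"
| "entry (Row a b c d e f g h i j k l) X6 = g"
| "entry (Row a b c d e f g h i j k l) X7 = h"
| "entry (Row a b c d e f g h i j k l) X8 = i"
| "entry (Row a b c d e f g h i j k l) X9 = j"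
| "entry (Row a b c d e f g h i j k l) XA = k"
| "entry (Row a b c d e f g h i j k l) XB = l"

fun store :: "'a row \<Rightarrow> ix \<Rightarrow> 'a \<Rightarrow> 'a row" where
  "store (Row a b c d e f g h i j k l) X0 v = Row v b c d e f g h i j k l"
| "store (Row a b c d e f g h i j k l) X1 v = Row a v c d e f g h i j k l"
| "store (Row a b c d e f g h i j k l) X2 v = Row a b v d e f g h i j k l"
| "store (Row a b c d e f g h i j k l) X3 v = Row a b c v e f g h i j k l"
| "store (Row a b c d e f g h i j k l) X4 v = Row a b c d v f g h i j k l"
| "store (Row a b c d e f g h i j k l) X5 v = Row a b c d e v g h i j k l"
| "store (Row a b c d e f g h i j k l) X6 v = Row a b c d e f v h i j k l"
| "store (Row a b c d e f g h i j k l) X7 v = Row a b c d e f g v i j k l"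
| "store (Row a b c d e f g h i j k l) X8 v = Row a b c d e f g h v j k l"
| "store (Row a b c d e f g h i j k l) X9 v = Row a b c d e f g h i v k l"
| "store (Row a b c d e f g h i j k l) XA v = Row a b c d e f g h i j v l"
| "store (Row a b c d e f g h i j k l) XB v = Row a b c d e f g h i j k v"

lemma entry_store: "entry (store r i v) j = (if i = j then v else entry r j)"
  by (cases r; cases i; cases j; simp)

definition const_row :: "'a \<Rightarrow> 'a row" where
  "const_row a = Row a a a a a a a a a a a a"

lemma entry_const_row [simp]: "entry (const_row a) i = a"
  by (cases i) (simp_all add: const_row_def)

type_synonym mat = "kn row row"

definition know :: "mat \<Rightarrow> ix \<Rightarrow> ix \<Rightarrow> kn" where
  "know M i j = entry (entry M i) j"

definition store2 :: "mat \<Rightarrow> ix \<Rightarrow> ix \<Rightarrow> kn \<Rightarrow> mat" where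
  "store2 M i j k = store M i (store (entry M i) j k)"

definition learn :: "mat \<Rightarrow> ix \<Rightarrow> ix \<Rightarrow> kn \<Rightarrow> mat" where
  "learn M i j k = store2 (store2 M i j k) j i k"

lemma know_learn:
  "know (learn M i j k) a b = (if a = i \<and> b = j \<or> a = j \<and> b = i then k else know M a b)"
  by (auto simp: know_def learn_def store2_def entry_store)

fun learn_row :: "mat \<Rightarrow> ix \<Rightarrow> kn list \<Rightarrow> ix list \<Rightarrow> mat" where
  "learn_row M i (k # ks) (j # js) = learn_row (learn M i j k) i ks js"
| "learn_row M i [] js = M"
| "learn_row M i ks [] = M"

text \<open>A graph is given by its lower triangular adjacency matrix, last row first, each row from right to left.\<close>

type_synonym pattern = "kn list list"

fun load :: "pattern \<Rightarrow> ix list \<Rightarrow> mat" where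
  "load (r # rs) (j # js) = learn_row (load rs js) j r js"
| "load [] js = const_row (const_row U)"
| "load rs [] = const_row (const_row U)"

fun fits_row :: "mat \<Rightarrow> ix \<Rightarrow> kn list \<Rightarrow> ix list \<Rightarrow> bool" where
  "fits_row M i [] [] = True"
| "fits_row M i (k # ks) (j # js) = (know M i j = k \<and> fits_row M i ks js)"
| "fits_row M i _ _ = False"

text \<open>The recorded knowledge must coincide with the entries of the pattern, so a leaf closes
  only after every pair that matters has been decided.\<close>

fun fits :: "mat \<Rightarrow> pattern \<Rightarrow> ix list \<Rightarrow> bool" where
  "fits M [] [] = True"
| "fits M (r # rs) (j # js) = (fits_row M j r js \<and> fits M rs js)"
| "fits M _ _ = False"

text \<open>
  A decision tree: \<open>S i j\<close> splits on the adjacency of two named vertices, \<open>L d js\<close> closes a branch in which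
  the vertices \<open>js\<close> realize the excluded pattern called \<open>d\<close>, and \<open>F\<close> leaves a branch to the final test.
\<close>

datatype cert = L ix "ix list" | S ix ix cert cert | F

fun refutes :: "(ix \<times> pattern) list \<Rightarrow> (mat \<Rightarrow> bool) \<Rightarrow> mat \<Rightarrow> cert \<Rightarrow> bool" where
  "refutes D fin M (L d js) = (case map_of D d of None \<Rightarrow> False | Some P \<Rightarrow> fits M P js)"
| "refutes D fin M (S i j s t) =
     (know M i j = Q \<and> refutes D fin (learn M i j Y) s \<and> refutes D fin (learn M i j N) t)"
| "refutes D fin M F = fin M"

text \<open>\<open>B h s t\<close> colours a vertex by \<open>s\<close> if it is adjacent to \<open>h\<close>, and by \<open>t\<close> otherwise.\<close>

datatype ctree = C ix | B ix ctree ctree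

fun hues :: "ctree \<Rightarrow> ix list" where
  "hues (C c) = [c]"
| "hues (B h s t) = hues s @ hues t"

fun tests :: "ctree \<Rightarrow> ix list" where
  "tests (C c) = []"
| "tests (B h s t) = h # tests s @ tests t"

text \<open>Defined only if the matrix decides every adjacency on the path through the colour tree;
  with \<open>None\<close> the final tests fail, so undecided branches are never accepted.\<close>

fun hue :: "mat \<Rightarrow> ix \<Rightarrow> ctree \<Rightarrow> ix option" where
  "hue M x (C c) = Some c"
| "hue M x (B h s t) = (case know M x h of Y \<Rightarrow> hue M x s | N \<Rightarrow> hue M x t | _ \<Rightarrow> None)"

definition palette :: "ix list" where
  "palette = [X0, X1, X2, X3]"

text \<open>
  In both certificates \<open>D\<close> lists the patterns excluded before, and \<open>js\<close> names the vertices of \<open>P\<close>. Here \<open>x\<close>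
  is a vertex adjacent to \<open>u\<close> but not to \<open>v\<close>; the conditions ensure that it is not among \<open>js\<close>.
\<close>

definition domination_cert ::
  "(ix \<times> pattern) list \<Rightarrow> pattern \<Rightarrow> ix list \<Rightarrow> ix \<Rightarrow> ix \<Rightarrow> ix \<Rightarrow> cert \<Rightarrow> bool" where
  "domination_cert D P js u v x t \<longleftrightarrow>
     (let M = load P js in
       distinct (x # js) \<and> length js = length P \<and> u \<in> set js \<and> v \<in> set js \<and> know M u v = N \<and>
       list_all (\<lambda>h. h = u \<or> know M h u = N \<or> know M h v = Y) js \<and>
       refutes D (\<lambda>_. False)
         (learn_row M x (map (\<lambda>h. if h = u then Y else if h = v then N else Q) js) js) t)"

text \<open>
  The vertices \<open>js\<close> get the colours \<open>cs\<close>, all others are coloured by \<open>T\<close>. The tree \<open>s\<close> compares a vertex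
  \<open>x\<close> with \<open>js\<close>, and \<open>t\<close> compares two adjacent vertices \<open>x\<close>, \<open>y\<close> outside \<open>js\<close>.
\<close>

definition coloring_cert ::
  "(ix \<times> pattern) list \<Rightarrow> pattern \<Rightarrow> ix list \<Rightarrow> ix list \<Rightarrow> ctree \<Rightarrow> ix \<Rightarrow> ix \<Rightarrow> cert \<Rightarrow> cert \<Rightarrow> bool"
  where
  "coloring_cert D P js cs T x y s t \<longleftrightarrow>
     (let M = load P js; H = zip js cs; q = map (\<lambda>_. Q) js; Mx = learn_row M x q js in
       distinct (x # y # js) \<and> length js = length P \<and> length cs = length P \<and>
       list_all (\<lambda>c. c \<in> set palette) (cs @ hues T) \<and> list_all (\<lambda>h. h \<in> set js) (tests T) \<and>
       list_all (\<lambda>(h, c). list_all (\<lambda>(h', c'). h = h' \<or> c \<noteq> c' \<or> know M h h' = N) H) H \<and>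
       refutes D (\<lambda>M'. case hue M' x T of None \<Rightarrow> False
           | Some c \<Rightarrow> list_all (\<lambda>(h, c'). c \<noteq> c' \<or> know M' x h = N) H) Mx s \<and>
       refutes D (\<lambda>M'. case hue M' x T of None \<Rightarrow> False
           | Some c \<Rightarrow> (case hue M' y T of None \<Rightarrow> False | Some c' \<Rightarrow> c \<noteq> c'))
         (learn (learn_row Mx y q js) x y Y) t)"

section \<open>Soundness of the certificates\<close>

context simple_graph
begin

definition holds :: "kn \<Rightarrow> 'a \<Rightarrow> 'a \<Rightarrow> bool" where
  "holds k v w \<longleftrightarrow> (case k of U \<Rightarrow> True | Q \<Rightarrow> v \<noteq> w | Y \<Rightarrow> E v w | N \<Rightarrow> v \<noteq> w \<and> \<not> E v w)"

lemma holds_simps [simp]: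
  "holds U v w" "holds Q v w \<longleftrightarrow> v \<noteq> w" "holds Y v w \<longleftrightarrow> E v w"
  "holds N v w \<longleftrightarrow> v \<noteq> w \<and> \<not> E v w"
  by (simp_all add: holds_def)

lemma holds_sym: "holds k v w \<Longrightarrow> holds k w v"
  by (cases k) (auto intro: sym)

fun realizes :: "pattern \<Rightarrow> 'a list \<Rightarrow> bool" where
  "realizes [] [] = True"
| "realizes (r # rs) (v # vs) = (list_all2 (\<lambda>k w. holds k v w) r vs \<and> realizes rs vs)"
| "realizes _ _ = False"

definition absent :: "pattern \<Rightarrow> bool" where
  "absent P \<longleftrightarrow> (\<forall>vs. set vs \<subseteq> V \<longrightarrow> \<not> realizes P vs)"

lemma absentD: "absent P \<Longrightarrow> set vs \<subseteq> V \<Longrightarrow> \<not> realizes P vs"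
  by (simp add: absent_def)

definition models :: "mat \<Rightarrow> (ix \<Rightarrow> 'a) \<Rightarrow> bool" where
  "models M s \<longleftrightarrow> range s \<subseteq> V \<and> (\<forall>i j. holds (know M i j) (s i) (s j))"

lemma modelsD: "models M s \<Longrightarrow> holds (know M i j) (s i) (s j)"
  by (simp add: models_def)

lemma realizes_length: "realizes P vs \<Longrightarrow> length vs = length P"
  by (induction P vs rule: realizes.induct) auto

lemma models_learn: "models M s \<Longrightarrow> holds k (s i) (s j) \<Longrightarrow> models (learn M i j k) s"
  by (auto simp: models_def know_learn intro: holds_sym)

lemma models_learn_row:
  "models M s \<Longrightarrow> list_all2 (\<lambda>k j. holds k (s i) (s j)) ks js \<Longrightarrow> models (learn_row M i ks js) s"
  by (induction M i ks js rule: learn_row.induct) (auto intro: models_learn)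

lemma models_load: "range s \<subseteq> V \<Longrightarrow> realizes P (map s js) \<Longrightarrow> models (load P js) s"
proof (induction P js rule: load.induct)
  case (1 r rs j js)
  then show ?case
    by (auto intro!: models_learn_row simp: list.rel_map)
qed (auto simp: models_def know_def)

lemma fits_row_holds:
  "models M s \<Longrightarrow> fits_row M i ks js \<Longrightarrow> list_all2 (\<lambda>k j. holds k (s i) (s j)) ks js"
  by (induction M i ks js rule: fits_row.induct) (auto dest: modelsD)

lemma fits_realizes: "models M s \<Longrightarrow> fits M P js \<Longrightarrow> realizes P (map s js)"
  by (induction M P js rule: fits.induct) (auto simp: list.rel_map dest: fits_row_holds)

text \<open>The valuation \<open>s\<close> selects a path through the tree: at each split one of the
  two answers is true of \<open>s\<close>, because \<open>Q\<close> records distinctness. The path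
  cannot end in an \<open>L\<close> leaf, which would realize an excluded pattern, so it ends in an
  \<open>F\<close> leaf whose matrix is still correct for \<open>s\<close>.\<close>

lemma refutes_sound:
  assumes D: "\<And>d P. (d, P) \<in> set D \<Longrightarrow> absent P"
  shows "models M s \<Longrightarrow> refutes D fin M t \<Longrightarrow> \<exists>M'. models M' s \<and> fin M'"
proof (induction t arbitrary: M)
  case (L d js)
  then obtain P where P: "map_of D d = Some P" "fits M P js"
    by (auto split: option.splits)
  then have "realizes P (map s js)" "absent P"
    using L.prems(1) by (auto intro: fits_realizes D dest: map_of_SomeD)
  moreover have "set (map s js) \<subseteq> V"
    using L.prems(1) by (auto simp: models_def)
  ultimately show ?case
    by (auto simp: absent_def)
next
  case (S i j t1 t2)
  then have "s i \<noteq> s j"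
    using modelsD[OF S.prems(1), of i j] by simp
  then show ?case
    using S.IH(1)[OF models_learn[OF S.prems(1), of Y i j]]
      S.IH(2)[OF models_learn[OF S.prems(1), of N i j]] S.prems(2)
    by (cases "E (s i) (s j)") auto
qed auto

lemma obtain_valuation:
  assumes "set vs \<subseteq> V" "vs \<noteq> []" "length js = length vs" "distinct js"
  obtains s where "map s js = vs" "range s \<subseteq> V"
proof -
  let ?s = "\<lambda>j. case map_of (zip js vs) j of None \<Rightarrow> hd vs | Some v \<Rightarrow> v"
  have "map ?s js = vs"
    using assms by (intro nth_equalityI) (auto simp: map_of_zip_nth)
  moreover have "range ?s \<subseteq> V"
    using assms by (auto split: option.splits dest!: map_of_SomeD set_zip_rightD)
  ultimately show thesis
    by (rule that)
qed

fun paint :: "(ix \<Rightarrow> 'a) \<Rightarrow> 'a \<Rightarrow> ctree \<Rightarrow> ix" where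
  "paint s v (C c) = c"
| "paint s v (B h t1 t2) = (if E v (s h) then paint s v t1 else paint s v t2)"

lemma paint_hues: "paint s v T \<in> set (hues T)"
  by (induction T) auto

lemma hue_paint: "models M s \<Longrightarrow> hue M x T = Some c \<Longrightarrow> paint s (s x) T = c"
proof (induction T)
  case (B h t1 t2)
  then show ?case
    using modelsD[OF B.prems(1), of x h] by (cases "know M x h") auto
qed auto

lemma paint_cong: "(\<And>h. h \<in> set (tests T) \<Longrightarrow> s h = s' h) \<Longrightarrow> paint s v T = paint s' v T"
  by (induction T) auto

text \<open>Edges are sorted by how many ends lie in \<open>vs\<close>: two are handled by the
  pairwise test on \<open>H\<close>, one by the tree \<open>t1\<close>, none by the tree
  \<open>t2\<close>. The names \<open>x\<close> and \<open>y\<close> are then interpreted as the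
  ends outside \<open>vs\<close>.\<close>

lemma coloring_cert_sound:
  assumes cert: "coloring_cert D P js cs T x y t1 t2"
    and D: "\<And>d P. (d, P) \<in> set D \<Longrightarrow> absent P"
    and vs: "set vs \<subseteq> V" "realizes P vs" "vs \<noteq> []"
  shows "colorable E V 4"
proof -
  define M where "M = load P js"
  define q where "q = map (\<lambda>_. Q) js"
  define H where "H = zip js cs"
  define Mx where "Mx = learn_row M x q js"
  note defs = M_def[symmetric] q_def[symmetric] H_def[symmetric] Mx_def[symmetric]
  have dist: "distinct js" "x \<noteq> y" "x \<notin> set js" "y \<notin> set js"
    and len: "length js = length P" "length cs = length P"
    and hues: "set cs \<subseteq> set palette" "set (hues T) \<subseteq> set palette" "set (tests T) \<subseteq> set js"
    and anchors: "\<And>h c h' c'. (h, c) \<in> set H \<Longrightarrow> (h', c') \<in> set H \<Longrightarrow> h = h' \<or> c \<noteq> c' \<or> know M h h' = N"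
    and single: "refutes D (\<lambda>M'. case hue M' x T of None \<Rightarrow> False
           | Some c \<Rightarrow> list_all (\<lambda>(h, c'). c \<noteq> c' \<or> know M' x h = N) H) Mx t1"
    and pair: "refutes D (\<lambda>M'. case hue M' x T of None \<Rightarrow> False
           | Some c \<Rightarrow> (case hue M' y T of None \<Rightarrow> False | Some c' \<Rightarrow> c \<noteq> c'))
         (learn (learn_row Mx y q js) x y Y) t2"
    using cert unfolding coloring_cert_def Let_def defs
    by (auto simp: list_all_iff)
  obtain s where s: "map s js = vs" "range s \<subseteq> V"
    using obtain_valuation[OF vs(1,3)] realizes_length[OF vs(2)] len dist by metis
  define col where "col v = (case map_of (zip vs cs) v of None \<Rightarrow> paint s v T | Some c \<Rightarrow> c)" for v
  have anchor: "\<exists>h. (h, c) \<in> set H \<and> s h = v" if "map_of (zip vs cs) v = Some c" for v c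
  proof -
    have "(v, c) \<in> set (zip (map s js) cs)"
      using map_of_SomeD[OF that] s by simp
    then show ?thesis
      by (force simp: zip_map1 H_def)
  qed
  have free: "v \<notin> s ` set js" if "map_of (zip vs cs) v = None" for v
    using that len s realizes_length[OF vs(2)] by (auto simp: map_of_zip_is_None)
  have M: "models M s'" if "\<And>h. h \<in> set js \<Longrightarrow> s' h = s h" "range s' \<subseteq> V" for s'
  proof -
    have "map s' js = vs"
      using that s by auto
    then show ?thesis
      unfolding M_def using models_load that vs by auto
  qed
  have Mx: "models Mx s'"
    if "\<And>h. h \<in> set js \<Longrightarrow> s' h = s h" "range s' \<subseteq> V" "s' x \<notin> s ` set js" for s'
    unfolding Mx_def q_def using that
    by (intro models_learn_row M) (auto simp: list.rel_map list_all2_same)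
  \<comment> \<open>The colour tree tests adjacency to named pattern vertices only, so
    reinterpreting \<open>x\<close> and \<open>y\<close> does not change the colour of any
    vertex.\<close>
  have paint: "paint s' v T = paint s v T" if "\<And>h. h \<in> set js \<Longrightarrow> s' h = s h" for s' v
    using that hues by (intro paint_cong) auto
  have anchor_free: "c \<noteq> paint s v T"
    if v: "v \<in> V" "map_of (zip vs cs) v = None" "(h, c) \<in> set H" "E v (s h)" for v h c
  proof -
    let ?s = "s(x := v)"
    have agree: "\<And>h. h \<in> set js \<Longrightarrow> ?s h = s h"
      using dist by auto
    have h: "h \<in> set js"
      using v by (auto simp: H_def dest: set_zip_leftD)
    have "models Mx ?s"
      using agree v s free[OF v(2)] by (intro Mx) auto
    then obtain M' c' where M': "models M' ?s"
        and c': "hue M' x T = Some c'" "c' \<noteq> c \<or> know M' x h = N"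
      using refutes_sound[OF D _ single] v(3) by (fastforce simp: list_all_iff split: option.splits)
    moreover have "know M' x h \<noteq> N"
      using modelsD[OF M', of x h] v(4) agree[OF h] by (cases "know M' x h") auto
    moreover have "c' = paint s v T"
      using hue_paint[OF M' c'(1)] paint[OF agree] by simp
    ultimately show ?thesis
      by auto
  qed
  have proper: "col u \<noteq> col v" if uv: "u \<in> V" "v \<in> V" "E u v" for u v
  proof (cases "map_of (zip vs cs) u")
    case u: (Some c)
    then obtain h where h: "(h, c) \<in> set H" "s h = u"
      using anchor by auto
    show ?thesis
    proof (cases "map_of (zip vs cs) v")
      case v: (Some c')
      then obtain h' where h': "(h', c') \<in> set H" "s h' = v"
        using anchor by auto
      have "h \<noteq> h'" "know M h h' \<noteq> N"
        using uv h h' irrefl modelsD[OF M, of s h h'] s by auto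
      then show ?thesis
        using anchors[OF h(1) h'(1)] u v by (auto simp: col_def)
    next
      case None
      then show ?thesis
        using anchor_free[OF uv(2) None h(1)] uv sym h u by (auto simp: col_def)
    qed
  next
    case u: None
    show ?thesis
    proof (cases "map_of (zip vs cs) v")
      case v: (Some c')
      then obtain h' where h': "(h', c') \<in> set H" "s h' = v"
        using anchor by auto
      then show ?thesis
        using anchor_free[OF uv(1) u h'(1)] uv u v by (auto simp: col_def)
    next
      case v: None
      let ?s = "s(x := u, y := v)"
      have agree: "\<And>h. h \<in> set js \<Longrightarrow> ?s h = s h"
        using dist by auto
      have "models Mx ?s"
        using agree uv s free[OF u] dist by (intro Mx) auto
      then have "models (learn (learn_row Mx y q js) x y Y) ?s"
        using uv dist free[OF v] agree unfolding q_def
        by (intro models_learn models_learn_row) (auto simp: list.rel_map list_all2_same)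
      then obtain M' c c' where M': "models M' ?s"
          and "hue M' x T = Some c" "hue M' y T = Some c'" "c \<noteq> c'"
        using refutes_sound[OF D _ pair] by (fastforce split: option.splits)
      then have "paint s u T \<noteq> paint s v T"
        using hue_paint[OF M', of x T c] hue_paint[OF M', of y T c'] dist
          paint[OF agree, of u] paint[OF agree, of v] by auto
      then show ?thesis
        using u v by (simp add: col_def)
    qed
  qed
  have palette: "col v \<in> set palette" for v
    using hues paint_hues[of s v T]
    by (auto simp: col_def split: option.splits dest!: map_of_SomeD set_zip_rightD)
  \<comment> \<open>Only the four colours of \<open>palette\<close> occur, and on these
    \<open>number\<close> is injective; the common value 3 of the remaining names keeps the function
    below 4.\<close>
  define number where "number c = (case c of X0 \<Rightarrow> 0 | X1 \<Rightarrow> 1 | X2 \<Rightarrow> 2 | _ \<Rightarrow> (3 :: nat))" for c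
  have "number c < 4" for c
    by (cases c) (auto simp: number_def)
  moreover have "number c \<noteq> number c'" if "c \<in> set palette" "c' \<in> set palette" "c \<noteq> c'" for c c'
    using that by (auto simp: number_def palette_def)
  ultimately show ?thesis
    unfolding colorable_def using proper palette by (intro exI[of _ "\<lambda>v. number (col v)"]) auto
qed

end

context critical_graph
begin

lemma absent_coloring:
  assumes "coloring_cert D P js cs T x y t1 t2" "list_all (\<lambda>(d, P). absent P) D" "P \<noteq> []"
  shows "absent P"
  unfolding absent_def
proof (intro allI impI notI)
  fix vs assume vs: "set vs \<subseteq> V" "realizes P vs"
  then have "vs \<noteq> []"
    using realizes_length[of P vs] assms(3) by auto
  with vs show False
    using coloring_cert_sound[OF assms(1) _ vs] assms(2) not_colorable
    by (auto simp: list_all_iff)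
qed

lemma absent_domination:
  assumes cert: "domination_cert D P js u v x t" and D: "list_all (\<lambda>(d, P). absent P) D"
  shows "absent P"
  unfolding absent_def
proof (intro allI impI notI)
  fix vs assume vs: "set vs \<subseteq> V" "realizes P vs"
  define M where "M = load P js"
  have dist: "distinct js" "x \<notin> set js" and len: "length js = length P"
    and uv: "u \<in> set js" "v \<in> set js" "know M u v = N"
    and dom: "\<And>h. h \<in> set js \<Longrightarrow> h = u \<or> know M h u = N \<or> know M h v = Y"
    and ref: "refutes D (\<lambda>_. False)
         (learn_row M x (map (\<lambda>h. if h = u then Y else if h = v then N else Q) js) js) t"
    using cert unfolding domination_cert_def Let_def M_def[symmetric]
    by (auto simp: list_all_iff)
  have "vs \<noteq> []"
    using realizes_length[OF vs(2)] len uv by auto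
  then obtain s where s: "map s js = vs" "range s \<subseteq> V"
    using obtain_valuation[OF vs(1)] realizes_length[OF vs(2)] len dist by metis
  have Ms: "models M s"
    unfolding M_def using models_load s vs by auto
  have "s u \<noteq> s v" "\<not> E (s u) (s v)"
    using modelsD[OF Ms, of u v] uv by auto
  then obtain w where w: "w \<in> V" "E (s u) w" "\<not> E (s v) w"
    using incomparable[of "s u" "s v"] s by auto
  have new: "w \<noteq> s h" if "h \<in> set js" for h
    using dom[OF that] modelsD[OF Ms, of h u] modelsD[OF Ms, of h v] w irrefl sym by auto
  let ?s = "s(x := w)"
  have agree: "\<And>h. h \<in> set js \<Longrightarrow> ?s h = s h"
    using dist by auto
  have "map ?s js = vs"
    using s(1) agree by auto
  then have "models M ?s"
    unfolding M_def using models_load[of ?s P js] s w vs by auto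
  moreover have "list_all2 (\<lambda>k j. holds k (?s x) (?s j))
      (map (\<lambda>h. if h = u then Y else if h = v then N else Q) js) js"
    using new w dist sym by (auto simp: list.rel_map list_all2_same)
  ultimately have "models (learn_row M x (map (\<lambda>h. if h = u then Y else if h = v then N else Q) js) js) ?s"
    by (rule models_learn_row)
  then show False
    using refutes_sound[OF _ _ ref] D by (auto simp: list_all_iff)
qed

end

section \<open>Excluding subgraphs of critical graphs\<close>

text \<open>Names in descending order, because a pattern lists its last vertex first; the name of a
  vertex is then its index in the pattern.\<close>

definition "vs4 = [X3,X2,X1,X0]"

definition "vs5 = [X4,X3,X2,X1,X0]"

definition "vs6 = [X5,X4,X3,X2,X1,X0]"

definition "vs7 = [X6,X5,X4,X3,X2,X1,X0]"

definition "vs8 = [X7,X6,X5,X4,X3,X2,X1,X0]"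

definition "vs9 = [X8,X7,X6,X5,X4,X3,X2,X1,X0]"

definition "vs10 = [X9,X8,X7,X6,X5,X4,X3,X2,X1,X0]"

definition "K3 = [[Y,Y],[Y],[]]"

definition "K4 = [[Y,Y,Y],[Y,Y],[Y],[]]"

definition "M2 = [[Y,N,N],[N,N],[Y],[]]"

definition "M3 = [[Y,N,N,N,N],[N,N,N,N],[Y,N,N],[N,N],[Y],[]]"

section \<open>Patterns for \<open>(2K2, K4)\<close>-free graphs\<close>

definition "P0 = [[N,N,N,N,N,N],[Y,Y,Y,Y,Y],[Y,N,N,Y],[Y,N,N],[Y,N],[Y],[]]"

text \<open>\<open>P0\<close> is the 5-wheel with an additional isolated vertex \<open>X6\<close>.
  Having no neighbour in the pattern, \<open>X6\<close> is dominated by every other vertex, here by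
  \<open>X0\<close>.\<close>

lemma cert_P0: "domination_cert [(X0,K4),(X1,M2)] P0 vs7 X6 X0 X7 (S X7 X1 (S X7 X4 (S X7 X5 (S X7 X2 (L X0
  [X5,X2,X1,X7]) (S X7 X3 (L X0 [X5,X4,X3,X7]) (L X1 [X3,X2,X6,X7]))) (L X1 [X5,X0,X6,X7])) (L X1
  [X4,X0,X6,X7])) (L X1 [X1,X0,X6,X7]))"
  by code_simp

definition "P1 = [[Y,N,Y,N,Y,Y,Y],[Y,N,N,Y,Y,Y],[Y,N,Y,N,Y],[N,N,Y,Y],[N,N,Y],[N,N],[N],[]]"

lemma cert_P1: "domination_cert [(X0,K4),(X1,M2)] P1 vs8 X1 X0 X8 (S X8 X3 (S X8 X2 (S X8 X4 (S X8 X5 (S X8 X6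
  (L X0 [X6,X5,X2,X8]) (S X8 X7 (L X0 [X7,X4,X1,X8]) (L X1 [X7,X6,X3,X8]))) (L X1 [X5,X0,X1,X8]))
  (L X1 [X4,X0,X2,X8])) (S X8 X6 (S X8 X7 (L X0 [X7,X6,X1,X8]) (L X1 [X7,X2,X3,X8])) (L X1
  [X6,X2,X3,X8]))) (L X1 [X3,X0,X1,X8]))"
  by code_simp

definition "P2 = [[Y,Y,N,Y,N,Y],[Y,N,N,Y,N],[N,N,N,Y],[N,N,N],[Y,Y],[Y],[]]"

lemma cert_P2: "domination_cert [(X0,K4),(X1,P1),(X2,M2)] P2 vs7 X3 X2 X7 (S X7 X0 (S X7 X1 (S X7 X6 (S X7 X4 (L
  X0 [X6,X4,X0,X7]) (S X7 X5 (L X1 [X0,X6,X5,X1,X3,X4,X2,X7]) (L X2 [X5,X4,X3,X7]))) (L X2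
  [X6,X2,X3,X7])) (L X2 [X2,X1,X3,X7])) (L X2 [X2,X0,X3,X7]))"
  by code_simp

definition "P3 = [[Y,N,Y,N,Y,Y],[N,N,N,N,Y],[N,N,N,N],[N,N,N],[Y,Y],[Y],[]]"

lemma cert_P3: "domination_cert [(X0,K4),(X1,M2),(X2,P0),(X3,P2)] P3 vs7 X2 X6 X7 (S X7 X3 (S X7 X5 (S X7 X0 (S
  X7 X1 (L X0 [X2,X1,X0,X7]) (S X7 X4 (L X1 [X6,X1,X4,X7]) (L X2 [X4,X0,X5,X6,X1,X2,X7]))) (S X7
  X1 (S X7 X4 (L X1 [X6,X0,X4,X7]) (L X3 [X0,X5,X6,X4,X2,X7,X1])) (L X1 [X1,X0,X3,X7]))) (L X1
  [X6,X5,X2,X7])) (L X1 [X6,X3,X2,X7]))"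
  by code_simp

definition "P4 = [[Y,Y,N,N,Y,N,N],[Y,N,N,Y,N,Y],[N,Y,N,Y,Y],[N,N,N,N],[N,N,N],[Y,Y],[Y],[]]"

lemma cert_P4: "domination_cert [(X0,K4),(X1,M2),(X2,P2),(X3,P3)] P4 vs8 X2 X5 X8 (S X8 X0 (S X8 X1 (L X0
  [X2,X1,X0,X8]) (S X8 X4 (L X1 [X5,X1,X4,X8]) (S X8 X6 (L X0 [X6,X2,X0,X8]) (S X8 X7 (L X2
  [X0,X5,X1,X4,X8,X7,X2]) (L X3 [X0,X1,X4,X8,X7,X6,X5]))))) (S X8 X1 (S X8 X4 (L X1 [X5,X0,X4,X8])
  (S X8 X7 (L X2 [X1,X5,X0,X4,X8,X7,X2]) (S X8 X6 (L X2 [X6,X5,X7,X4,X8,X1,X2]) (L X1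
  [X7,X6,X1,X8])))) (S X8 X3 (L X1 [X1,X0,X3,X8]) (L X1 [X5,X3,X2,X8]))))"
  by code_simp

definition "P5 = [[Y,Y,N,Y,Y,N],[Y,N,N,Y,Y],[N,N,N,Y],[N,N,N],[Y,Y],[Y],[]]"

lemma cert_P5: "domination_cert [(X0,K4),(X1,M2),(X2,P2),(X3,P3),(X4,P4)] P5 vs7 X0 X6 X7 (S X7 X1 (S X7 X2 (L
  X0 [X2,X1,X0,X7]) (S X7 X3 (L X1 [X6,X2,X3,X7]) (S X7 X4 (L X2 [X1,X6,X2,X3,X7,X4,X0]) (S X7 X5
  (L X0 [X5,X1,X0,X7]) (L X3 [X1,X2,X3,X7,X4,X5,X6]))))) (S X7 X3 (L X1 [X6,X1,X3,X7]) (S X7 X2 (S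
  X7 X4 (L X2 [X2,X6,X1,X3,X7,X4,X0]) (S X7 X5 (L X2 [X5,X6,X4,X3,X7,X2,X0]) (L X1
  [X5,X4,X2,X7]))) (S X7 X4 (L X1 [X2,X1,X4,X7]) (S X7 X5 (L X3 [X5,X4,X3,X7,X2,X1,X6]) (L X4
  [X4,X5,X0,X3,X7,X6,X2,X1]))))))"
  by code_simp

text \<open>The gem (a vertex joined to a path on four vertices) with two additional isolated
  vertices.\<close>

definition "P6 = [[Y,N,N,N,Y,Y],[N,N,N,N,Y],[N,N,N,N],[N,N,N],[Y,Y],[Y],[]]"

lemma cert_P6: "domination_cert [(X0,K4),(X1,P3),(X2,M2),(X3,P5)] P6 vs7 X3 X4 X7 (S X7 X0 (S X7 X1 (S X7 X2 (L
  X0 [X2,X1,X0,X7]) (S X7 X5 (L X1 [X7,X5,X4,X3,X2,X1,X0]) (S X7 X6 (L X0 [X6,X1,X0,X7]) (L X2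
  [X6,X5,X3,X7])))) (S X7 X2 (S X7 X5 (L X1 [X7,X5,X4,X3,X1,X2,X0]) (S X7 X6 (L X1
  [X7,X2,X4,X3,X5,X6,X0]) (L X2 [X6,X5,X2,X7]))) (L X2 [X2,X1,X3,X7]))) (S X7 X1 (S X7 X2 (S X7 X5
  (S X7 X6 (L X3 [X0,X6,X5,X4,X2,X1,X7]) (L X2 [X6,X0,X3,X7])) (L X2 [X5,X0,X3,X7])) (L X2
  [X2,X0,X3,X7])) (L X2 [X1,X0,X3,X7])))"
  by code_simp

definition "P7 = [[Y,N,N,N,Y,N,Y],[N,Y,N,N,Y,N],[N,N,N,Y,Y],[N,N,N,Y],[N,N,N],[Y,Y],[Y],[]]"

lemma cert_P7: "domination_cert [(X0,K4),(X1,M2),(X2,P0),(X3,P2)] P7 vs8 X5 X2 X8 (S X8 X7 (S X8 X0 (S X8 X1 (L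
  X0 [X5,X1,X0,X8]) (S X8 X3 (L X1 [X2,X1,X3,X8]) (L X2 [X3,X0,X7,X2,X1,X5,X8]))) (S X8 X1 (S X8
  X3 (L X1 [X2,X0,X3,X8]) (L X3 [X0,X7,X2,X3,X5,X8,X1])) (S X8 X4 (L X1 [X2,X1,X4,X8]) (S X8 X6 (L
  X1 [X2,X0,X6,X8]) (L X1 [X6,X4,X5,X8]))))) (L X1 [X7,X2,X5,X8]))"
  by code_simp

definition "P8 = [[N,Y,N,N,Y,N],[N,N,N,Y,Y],[N,N,N,Y],[N,N,N],[Y,Y],[Y],[]]"

lemma cert_P8: "domination_cert [(X0,K4),(X1,M2),(X2,P7)] P8 vs7 X2 X5 X7 (S X7 X0 (S X7 X1 (L X0 [X2,X1,X0,X7])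
  (S X7 X3 (L X1 [X5,X1,X3,X7]) (S X7 X4 (L X1 [X5,X1,X4,X7]) (S X7 X6 (L X2
  [X7,X6,X5,X4,X3,X2,X1,X0]) (L X1 [X6,X4,X2,X7]))))) (S X7 X3 (L X1 [X5,X0,X3,X7]) (S X7 X6 (L X1
  [X5,X0,X6,X7]) (S X7 X4 (S X7 X1 (L X2 [X7,X4,X5,X6,X3,X2,X0,X1]) (L X1 [X5,X1,X4,X7])) (L X1
  [X6,X4,X2,X7])))))"
  by code_simp

definition "P9 = [[Y,N,N,Y,N,Y,Y],[Y,N,Y,N,Y,N],[N,Y,Y,Y,Y],[N,N,Y,Y],[N,N,Y],[N,N],[N],[]]"

lemma cert_P9: "domination_cert [(X0,K4),(X1,M2)] P9 vs8 X7 X5 X8 (S X8 X2 (S X8 X3 (S X8 X0 (L X0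
  [X7,X3,X0,X8]) (S X8 X4 (S X8 X6 (L X0 [X7,X6,X3,X8]) (L X1 [X6,X5,X4,X8])) (L X1
  [X4,X0,X2,X8]))) (S X8 X1 (S X8 X6 (L X0 [X7,X6,X1,X8]) (L X1 [X6,X3,X2,X8])) (S X8 X4 (L X1
  [X5,X3,X4,X8]) (L X1 [X4,X1,X2,X8])))) (L X1 [X5,X2,X7,X8]))"
  by code_simp

definition "P10 = [[Y,Y,N,Y,N,Y],[N,Y,N,Y,Y],[N,N,N,N],[N,N,N],[Y,Y],[Y],[]]"

lemma cert_P10: "domination_cert [(X0,K4),(X1,M2),(X2,P9)] P10 vs7 X1 X6 X7 (S X7 X3 (S X7 X0 (S X7 X2 (L X0
  [X2,X1,X0,X7]) (L X1 [X6,X2,X3,X7])) (L X1 [X6,X0,X3,X7])) (S X7 X4 (S X7 X5 (S X7 X0 (L X0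
  [X5,X1,X0,X7]) (S X7 X2 (L X2 [X2,X0,X5,X4,X1,X3,X6,X7]) (L X1 [X2,X0,X4,X7]))) (L X1
  [X5,X3,X4,X7])) (L X1 [X6,X4,X1,X7])))"
  by code_simp

definition "P11 = [[Y,Y,Y,N,N,Y,Y],[Y,Y,Y,Y,N,N],[N,Y,Y,Y,Y],[N,N,Y,Y],[N,N,Y],[N,N],[N],[]]"

lemma cert_P11: "domination_cert [(X0,K4),(X1,P10),(X2,M2)] P11 vs8 X2 X3 X8 (S X8 X0 (S X8 X4 (S X8 X7 (L X0
  [X7,X4,X0,X8]) (S X8 X1 (L X1 [X0,X8,X3,X2,X7,X1,X4]) (L X2 [X7,X1,X2,X8]))) (S X8 X1 (S X8 X7
  (L X1 [X0,X8,X3,X2,X4,X1,X7]) (L X2 [X7,X4,X2,X8])) (L X2 [X4,X1,X2,X8]))) (L X2 [X3,X0,X2,X8]))"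
  by code_simp

definition "P12 = [[Y,Y,Y,Y,N,Y],[Y,Y,N,Y,Y],[N,N,N,N],[N,N,N],[Y,Y],[Y],[]]"

lemma cert_P12: "domination_cert [(X0,K4),(X1,M2),(X2,P11)] P12 vs7 X3 X4 X7 (S X7 X1 (S X7 X6 (S X7 X5 (L X0
  [X6,X5,X3,X7]) (S X7 X2 (L X1 [X5,X4,X2,X7]) (S X7 X0 (L X2 [X0,X5,X6,X1,X3,X4,X2,X7]) (L X1
  [X2,X0,X3,X7])))) (L X1 [X6,X4,X1,X7])) (S X7 X0 (S X7 X2 (S X7 X5 (S X7 X6 (L X0 [X6,X2,X0,X7])
  (L X2 [X0,X6,X5,X2,X3,X4,X1,X7])) (L X1 [X5,X4,X2,X7])) (L X1 [X2,X1,X3,X7])) (L X1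
  [X1,X0,X3,X7])))"
  by code_simp

text \<open>The house, that is, a 4-cycle and a triangle sharing an edge, with two additional
  isolated vertices; the first pattern to be excluded by a colouring.\<close>

definition "P13 = [[Y,N,N,N,Y,N],[N,N,N,N,Y],[N,N,N,N],[N,N,N],[Y,Y],[Y],[]]"

lemma cert_P13: "coloring_cert [(X0,K4),(X1,P3),(X2,M2),(X3,P6),(X4,P8),(X5,P12),(X6,P10),(X7,P5)] P13 vs7
  [X1,X2,X2,X2,X2,X3,X1] (B X3 (B X4 (C X0) (B X0 (C X3) (C X1))) (B X1 (C X1) (B X2 (C X3) (C
  X2)))) X7 X8 (S X7 X3 (S X7 X4 F (S X7 X0 (S X7 X1 (S X7 X2 (L X0 [X2,X1,X0,X7]) (S X7 X5 (L X1
  [X7,X5,X4,X3,X2,X1,X0]) (S X7 X6 (L X1 [X7,X6,X4,X3,X2,X0,X1]) (L X2 [X6,X5,X3,X7])))) F) (S X7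
  X1 (S X7 X2 (S X7 X6 (L X1 [X7,X6,X4,X3,X0,X2,X1]) F) (L X2 [X2,X0,X3,X7])) (L X2
  [X1,X0,X3,X7])))) (S X7 X1 (S X7 X0 (S X7 X2 (L X0 [X2,X1,X0,X7]) (S X7 X5 (S X7 X4 (L X1
  [X7,X5,X3,X4,X2,X1,X0]) (L X3 [X1,X2,X4,X3,X5,X7,X0])) (S X7 X6 (S X7 X4 (L X1
  [X7,X6,X3,X4,X2,X0,X1]) (L X3 [X0,X2,X4,X3,X6,X7,X1])) (L X4 [X6,X2,X5,X3,X7,X1,X0])))) (S X7 X6
  (S X7 X2 (S X7 X4 (L X1 [X7,X6,X3,X4,X0,X2,X1]) (L X3 [X2,X0,X4,X3,X6,X7,X1])) (L X2
  [X2,X0,X6,X7])) F)) (S X7 X2 F (S X7 X4 (L X2 [X2,X1,X4,X7]) (S X7 X5 (L X2 [X2,X1,X5,X7])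
  F))))) (S X8 X3 (S X8 X4 (S X7 X3 (S X7 X4 (S X7 X0 (S X8 X0 (S X8 X1 (S X7 X1 (L X0
  [X1,X0,X8,X7]) (S X7 X2 (S X8 X2 (L X0 [X2,X0,X8,X7]) (L X5 [X8,X7,X4,X3,X1,X2,X0])) (L X2
  [X2,X1,X3,X7]))) (S X8 X2 (S X7 X2 (L X0 [X2,X0,X8,X7]) (S X7 X1 (L X5 [X8,X7,X4,X3,X2,X1,X0])
  (L X2 [X2,X1,X3,X7]))) (L X2 [X2,X1,X3,X8]))) (S X8 X2 (S X8 X1 (S X7 X1 (S X7 X2 (L X0
  [X2,X1,X8,X7]) (L X5 [X8,X7,X4,X3,X2,X0,X1])) (S X7 X2 (L X5 [X8,X7,X4,X3,X1,X0,X2]) (L X2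
  [X2,X1,X3,X7]))) (L X2 [X1,X0,X3,X8])) (L X2 [X2,X0,X3,X8]))) (S X7 X2 (S X7 X1 (S X8 X1 (S X8
  X2 (L X0 [X2,X1,X8,X7]) (S X8 X0 (L X5 [X8,X7,X4,X3,X0,X2,X1]) (L X2 [X2,X0,X3,X8]))) (S X8 X2
  (S X8 X0 (L X5 [X8,X7,X4,X3,X0,X1,X2]) (L X2 [X1,X0,X3,X8])) (L X2 [X2,X1,X3,X8]))) (L X2
  [X1,X0,X3,X7])) (L X2 [X2,X0,X3,X7]))) (S X7 X0 F F)) (S X7 X1 F (S X7 X2 F F))) (S X8 X0 (S X8
  X1 (S X8 X2 (L X0 [X2,X1,X0,X8]) (S X8 X5 (L X1 [X8,X5,X4,X3,X2,X1,X0]) (S X8 X6 (L X1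
  [X8,X6,X4,X3,X2,X0,X1]) (L X2 [X6,X5,X3,X8])))) (S X8 X2 (S X8 X5 (L X1 [X8,X5,X4,X3,X1,X2,X0])
  (S X7 X3 (S X7 X4 F (S X7 X0 (S X7 X2 (L X0 [X2,X0,X8,X7]) (S X7 X1 (S X7 X5 (L X1
  [X7,X5,X4,X3,X2,X1,X0]) (L X1 [X0,X1,X4,X5,X3,X8,X7])) (L X2 [X2,X1,X3,X7]))) F)) (S X7 X1 F (S
  X7 X2 (S X7 X0 (L X0 [X2,X0,X8,X7]) (S X7 X4 (L X2 [X1,X0,X4,X7]) (L X1
  [X8,X7,X4,X3,X1,X0,X2]))) F)))) (L X2 [X2,X1,X3,X8]))) (S X7 X3 (S X7 X4 F (S X7 X0 F (S X8 X1
  (S X8 X2 (S X7 X1 (S X7 X2 (L X0 [X2,X1,X8,X7]) (L X2 [X2,X0,X3,X7])) (L X2 [X1,X0,X3,X7])) (L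
  X2 [X2,X0,X3,X8])) (L X2 [X1,X0,X3,X8])))) (S X7 X1 (S X8 X2 (S X8 X1 (S X8 X6 (L X1
  [X8,X6,X4,X3,X0,X2,X1]) (S X7 X2 (L X0 [X2,X1,X8,X7]) (S X7 X0 (S X7 X4 (L X6
  [X8,X7,X3,X4,X2,X0,X1]) (S X7 X6 (L X1 [X8,X2,X4,X3,X6,X7,X1]) (S X7 X5 (L X3
  [X1,X2,X4,X3,X5,X7,X0]) (L X4 [X6,X2,X5,X3,X7,X1,X0])))) (S X7 X4 (L X2 [X2,X0,X4,X7]) (L X1
  [X8,X7,X4,X3,X0,X2,X1]))))) (L X2 [X1,X0,X3,X8])) (L X2 [X2,X0,X3,X8])) (S X7 X2 F F))))) (S X8
  X1 (S X7 X3 (S X7 X4 F (S X7 X0 F (S X7 X2 (S X7 X1 (S X7 X6 (L X1 [X7,X6,X4,X3,X0,X2,X1]) (S X8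
  X2 (L X0 [X2,X1,X8,X7]) (S X8 X0 (S X8 X4 (L X6 [X8,X7,X4,X3,X0,X2,X1]) (S X8 X6 (L X1
  [X7,X2,X4,X3,X6,X8,X1]) (S X8 X5 (L X3 [X1,X2,X4,X3,X5,X8,X0]) (L X4 [X6,X2,X5,X3,X8,X1,X0]))))
  (S X8 X4 (L X2 [X2,X0,X4,X8]) (L X1 [X7,X8,X4,X3,X0,X2,X1]))))) (L X2 [X1,X0,X3,X7])) (L X2
  [X2,X0,X3,X7])))) (S X7 X1 (S X8 X0 (S X8 X2 (L X0 [X2,X1,X0,X8]) (S X7 X0 (L X0 [X1,X0,X8,X7])
  (S X8 X4 (S X8 X6 (L X1 [X8,X6,X3,X4,X2,X0,X1]) (S X8 X5 (L X1 [X8,X5,X3,X4,X2,X1,X0]) (L X2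
  [X6,X5,X4,X8]))) (S X8 X6 (L X3 [X0,X2,X4,X3,X6,X8,X1]) (S X8 X5 (L X3 [X1,X2,X4,X3,X5,X8,X0])
  (L X4 [X6,X2,X5,X3,X8,X1,X0])))))) (S X8 X2 (S X7 X2 (L X0 [X2,X1,X8,X7]) (S X8 X6 (S X8 X4 (L
  X1 [X8,X6,X3,X4,X0,X2,X1]) (L X3 [X2,X0,X4,X3,X6,X8,X1])) (S X8 X5 (S X7 X0 (S X7 X5 (L X7
  [X0,X1,X2,X3,X5,X7,X8]) (S X7 X6 (S X7 X4 (L X1 [X7,X6,X3,X4,X2,X0,X1]) (L X3
  [X0,X2,X4,X3,X6,X7,X1])) (L X4 [X6,X2,X5,X3,X7,X1,X8]))) (S X7 X4 (L X2 [X2,X0,X4,X7]) (S X8 X4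
  (L X1 [X8,X7,X3,X4,X0,X2,X1]) (L X3 [X2,X0,X4,X3,X7,X8,X1])))) (L X2 [X6,X5,X2,X8])))) (S X7 X0
  (S X7 X2 (L X0 [X2,X1,X0,X7]) (S X7 X4 (S X8 X4 (L X2 [X2,X0,X4,X8]) (L X1
  [X7,X8,X3,X4,X2,X0,X1])) (S X8 X4 (L X2 [X2,X0,X4,X8]) (L X3 [X0,X2,X4,X3,X8,X7,X1])))) (S X7 X2
  (S X8 X4 (L X2 [X2,X0,X4,X8]) (S X7 X4 (L X1 [X7,X8,X3,X4,X0,X2,X1]) (L X3
  [X2,X0,X4,X3,X8,X7,X1]))) (L X2 [X2,X0,X8,X7]))))) (S X7 X2 F F))) (S X8 X2 (S X7 X3 (S X7 X4 F
  (S X7 X0 (S X7 X2 (S X7 X1 (L X0 [X2,X1,X0,X7]) (S X8 X0 (L X0 [X2,X0,X8,X7]) (S X8 X4 (L X2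
  [X1,X0,X4,X8]) (L X1 [X7,X8,X4,X3,X1,X0,X2])))) (S X7 X1 (S X7 X6 (L X1 [X7,X6,X4,X3,X2,X0,X1])
  (S X7 X5 (L X1 [X7,X5,X4,X3,X2,X1,X0]) (L X2 [X6,X5,X3,X7]))) (L X2 [X2,X1,X3,X7]))) F)) (S X7
  X1 F (S X7 X2 (S X7 X0 (S X8 X0 (L X0 [X2,X0,X8,X7]) (S X8 X4 (L X2 [X1,X0,X4,X8]) (S X7 X4 (L
  X1 [X7,X8,X3,X4,X1,X0,X2]) (L X3 [X0,X1,X4,X3,X8,X7,X2])))) (S X8 X0 (S X7 X4 (L X2
  [X1,X0,X4,X7]) (S X8 X4 (L X1 [X8,X7,X3,X4,X1,X0,X2]) (L X3 [X0,X1,X4,X3,X7,X8,X2]))) (L X2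
  [X1,X0,X8,X7]))) F))) (S X7 X3 (S X7 X4 F (S X7 X0 F F)) (S X7 X1 F (S X7 X2 F (L X2
  [X2,X1,X8,X7])))))))"
  by code_simp

text \<open>A triangle with two additional isolated vertices. With its exclusion, the non-neighbours
  of a triangle form a clique.\<close>

definition "P14 = [[N,N,N,N],[N,N,N],[Y,Y],[Y],[]]"

lemma cert_P14: "coloring_cert [(X0,K4),(X1,M2),(X2,P13)] P14 vs5 [X1,X1,X0,X2,X3] (B X0 (B X1 (C X0) (B X2 (C
  X2) (C X1))) (B X1 (B X2 (C X3) (C X1)) (C X1))) X5 X6 (S X5 X0 (S X5 X1 (S X5 X2 (L X0
  [X2,X1,X0,X5]) F) (S X5 X2 F (S X5 X3 (L X1 [X2,X1,X3,X5]) (S X5 X4 (L X1 [X2,X1,X4,X5]) F))))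
  (S X5 X1 (S X5 X2 F (S X5 X3 (L X1 [X2,X0,X3,X5]) (S X5 X4 (L X1 [X2,X0,X4,X5]) F))) (S X5 X3 (L
  X1 [X1,X0,X3,X5]) (S X5 X4 (L X1 [X1,X0,X4,X5]) F)))) (S X5 X0 (S X5 X1 (S X6 X0 (S X6 X1 (L X0
  [X1,X0,X6,X5]) (S X6 X2 F F)) (S X6 X1 (S X6 X2 F F) F)) (S X5 X2 (S X6 X0 (S X6 X2 (L X0
  [X2,X0,X6,X5]) (S X6 X1 F F)) (S X6 X1 (S X6 X2 F F) F)) (S X5 X3 (L X1 [X2,X1,X3,X5]) (S X5 X4
  (L X1 [X2,X1,X4,X5]) (S X6 X1 (S X6 X0 F (S X6 X2 F (S X6 X3 (L X1 [X2,X0,X3,X6]) (S X6 X4 (L X1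
  [X2,X0,X4,X6]) (L X2 [X6,X5,X4,X3,X2,X1,X0]))))) (S X6 X2 (S X6 X0 F (S X6 X3 (L X1
  [X1,X0,X3,X6]) (S X6 X4 (L X1 [X1,X0,X4,X6]) (L X2 [X6,X5,X4,X3,X1,X2,X0])))) (L X1
  [X2,X1,X6,X5]))))))) (S X5 X1 (S X5 X2 (S X6 X1 (S X6 X2 (L X0 [X2,X1,X6,X5]) (S X6 X0 F F)) (S
  X6 X0 (S X6 X2 F F) F)) (S X5 X3 (L X1 [X2,X0,X3,X5]) (S X5 X4 (L X1 [X2,X0,X4,X5]) (S X6 X0 (S
  X6 X1 F (S X6 X2 F (S X6 X3 (L X1 [X2,X1,X3,X6]) (S X6 X4 (L X1 [X2,X1,X4,X6]) (L X2
  [X6,X5,X4,X3,X2,X0,X1]))))) (S X6 X2 (S X6 X1 F (S X6 X3 (L X1 [X1,X0,X3,X6]) (S X6 X4 (L X1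
  [X1,X0,X4,X6]) (L X2 [X6,X5,X4,X3,X0,X2,X1])))) (L X1 [X2,X0,X6,X5])))))) (S X5 X3 (L X1
  [X1,X0,X3,X5]) (S X5 X4 (L X1 [X1,X0,X4,X5]) (S X6 X0 (S X6 X1 F (S X6 X2 F (S X5 X2 (S X6 X3 (L
  X1 [X2,X1,X3,X6]) (S X6 X4 (L X1 [X2,X1,X4,X6]) (L X2 [X6,X5,X4,X3,X1,X0,X2]))) (L X1
  [X2,X1,X6,X5])))) (S X6 X1 (S X6 X2 F (S X5 X2 (S X6 X3 (L X1 [X2,X0,X3,X6]) (S X6 X4 (L X1
  [X2,X0,X4,X6]) (L X2 [X6,X5,X4,X3,X0,X1,X2]))) (L X1 [X2,X0,X6,X5]))) (L X1 [X1,X0,X6,X5])))))))"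
  by code_simp

text \<open>The gem with one additional isolated vertex.\<close>

definition "P15 = [[Y,N,N,Y,Y],[N,N,N,Y],[N,N,N],[Y,Y],[Y],[]]"

lemma cert_P15: "domination_cert [(X0,K4),(X1,M2),(X2,P0),(X3,P2),(X4,P14)] P15 vs6 X2 X5 X6 (S X6 X4 (S X6 X0 (S
  X6 X1 (L X0 [X2,X1,X0,X6]) (S X6 X3 (L X1 [X5,X1,X3,X6]) (L X2 [X3,X0,X4,X5,X1,X2,X6]))) (S X6
  X3 (L X1 [X5,X0,X3,X6]) (S X6 X1 (L X3 [X0,X4,X5,X3,X2,X6,X1]) (L X4 [X3,X6,X5,X1,X0])))) (L X1
  [X5,X4,X2,X6]))"
  by code_simp

definition "P16 = [[N,N,Y,Y],[N,N,N],[Y,Y],[Y],[]]"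

text \<open>\<open>P16\<close> is the diamond with an additional isolated vertex. The two vertices
  of degree 2 in the diamond are twins, so each of them dominates the other.\<close>

lemma cert_P16: "domination_cert [(X0,K4),(X1,M2),(X2,P15),(X3,P14)] P16 vs5 X2 X4 X5 (S X5 X0 (S X5 X1 (L X0
  [X2,X1,X0,X5]) (S X5 X3 (L X1 [X4,X1,X3,X5]) (L X2 [X1,X4,X3,X5,X2,X0]))) (S X5 X3 (L X1
  [X4,X0,X3,X5]) (S X5 X1 (L X2 [X0,X4,X3,X5,X2,X1]) (L X3 [X3,X5,X4,X1,X0]))))"
  by code_simp

definition "P17 = [[Y,Y,N,N,Y,Y,N,Y],[Y,Y,N,N,N,Y,N],[N,Y,Y,N,Y,Y],[N,Y,N,Y,Y],[N,N,N,Y],[N,N,N],[Y,Y],[Y],[]]"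

lemma cert_P17: "domination_cert [(X0,K4),(X1,M2)] P17 vs9 X4 X1 X9 (S X9 X2 (S X9 X0 (S X9 X5 (S X9 X6 (L X0
  [X6,X4,X0,X9]) (S X9 X8 (L X0 [X8,X2,X0,X9]) (L X1 [X8,X6,X5,X9]))) (L X1 [X5,X1,X4,X9])) (S X9
  X3 (L X1 [X1,X0,X3,X9]) (S X9 X6 (S X9 X7 (S X9 X8 (L X0 [X8,X7,X6,X9]) (L X1 [X8,X3,X4,X9])) (L
  X1 [X7,X1,X4,X9])) (L X1 [X6,X3,X2,X9])))) (L X1 [X2,X1,X4,X9]))"
  by code_simp

definition "P18 = [[Y,N,N,Y,N,N,N,N],[Y,Y,N,N,N,Y,Y],[N,Y,Y,Y,Y,N],[N,N,Y,Y,Y],[N,Y,Y,Y],[N,N,Y],[N,N],[N],[]]"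

lemma cert_P18: "domination_cert [(X0,K4),(X1,M2),(X2,P17)] P18 vs9 X8 X0 X9 (S X9 X3 (S X9 X5 (S X9 X1 (S X9 X2
  (S X9 X7 (L X0 [X7,X5,X1,X9]) (L X1 [X7,X0,X2,X9])) (S X9 X4 (S X9 X6 (L X0 [X6,X4,X1,X9]) (L X1
  [X6,X2,X8,X9])) (L X1 [X4,X2,X3,X9]))) (S X9 X4 (S X9 X6 (S X9 X2 (L X0 [X6,X4,X2,X9]) (S X9 X7
  (L X2 [X4,X1,X6,X5,X3,X2,X8,X7,X9]) (L X1 [X7,X1,X3,X9]))) (L X1 [X6,X1,X8,X9])) (L X1
  [X4,X1,X3,X9]))) (L X1 [X5,X0,X8,X9])) (L X1 [X3,X0,X8,X9]))"
  by code_simp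

definition "P19 = [[Y,N,N,Y,N,Y,Y],[Y,Y,N,Y,N,N],[N,N,N,Y,N],[N,N,N,Y],[N,N,N],[Y,Y],[Y],[]]"

lemma cert_P19: "domination_cert [(X0,K4),(X1,M2),(X2,P18)] P19 vs8 X2 X7 X8 (S X8 X3 (S X8 X0 (S X8 X1 (L X0
  [X2,X1,X0,X8]) (S X8 X4 (L X1 [X7,X1,X4,X8]) (S X8 X5 (S X8 X6 (L X2
  [X4,X0,X8,X1,X6,X3,X5,X2,X7]) (L X1 [X6,X4,X3,X8])) (L X1 [X5,X1,X3,X8])))) (S X8 X1 (S X8 X4 (S
  X8 X5 (L X1 [X7,X0,X5,X8]) (S X8 X6 (L X2 [X5,X1,X8,X0,X6,X3,X4,X2,X7]) (L X1 [X6,X5,X3,X8])))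
  (L X1 [X4,X0,X3,X8])) (L X1 [X1,X0,X3,X8]))) (L X1 [X7,X3,X2,X8]))"
  by code_simp

definition "P20 = [[Y,N,Y,Y,N,Y,Y],[Y,Y,N,Y,N,N],[N,N,N,Y,N],[N,N,N,Y],[N,N,N],[Y,Y],[Y],[]]"

lemma cert_P20: "domination_cert [(X0,K4),(X1,P17),(X2,M2),(X3,P19)] P20 vs8 X3 X4 X8 (S X8 X0 (S X8 X6 (S X8 X5
  (S X8 X7 (S X8 X1 (L X0 [X7,X1,X0,X8]) (S X8 X2 (L X1 [X6,X2,X8,X1,X3,X5,X4,X0,X7]) (L X2
  [X2,X1,X3,X8]))) (L X2 [X7,X4,X5,X8])) (S X8 X1 (S X8 X2 (L X0 [X2,X1,X0,X8]) (L X3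
  [X8,X6,X5,X4,X3,X2,X1,X0])) (L X2 [X5,X1,X3,X8]))) (L X2 [X6,X4,X3,X8])) (L X2 [X4,X0,X3,X8]))"
  by code_simp

definition "P21 = [[Y,N,Y,Y,Y,Y,N],[Y,Y,N,Y,N,N],[N,N,N,Y,N],[N,N,N,Y],[N,N,N],[Y,Y],[Y],[]]"

lemma cert_P21: "domination_cert [(X0,K4),(X1,P20),(X2,P19),(X3,M2)] P21 vs8 X3 X4 X8 (S X8 X0 (S X8 X6 (S X8 X1
  (S X8 X2 (L X0 [X2,X1,X0,X8]) (S X8 X5 (L X1 [X8,X6,X4,X5,X3,X2,X0,X1]) (L X2
  [X8,X6,X5,X4,X3,X2,X1,X0]))) (S X8 X2 (S X8 X5 (S X8 X7 (L X0 [X7,X6,X2,X8]) (L X3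
  [X7,X4,X5,X8])) (L X3 [X5,X1,X3,X8])) (L X3 [X2,X1,X3,X8]))) (L X3 [X6,X4,X3,X8])) (L X3
  [X4,X0,X3,X8]))"
  by code_simp

definition "P22 = [[Y,N,N,Y,N,Y,N],[Y,Y,N,N,N,Y],[N,Y,Y,Y,Y],[N,N,Y,Y],[N,N,Y],[N,N],[N],[]]"

lemma cert_P22: "domination_cert [(X0,K4),(X1,P20),(X2,P19),(X3,P21),(X4,M2)] P22 vs8 X2 X1 X8 (S X8 X4 (S X8 X7
  (S X8 X0 (S X8 X6 (L X0 [X6,X4,X0,X8]) (S X8 X3 (L X1 [X8,X7,X1,X3,X2,X6,X4,X0]) (L X2
  [X8,X7,X1,X3,X2,X6,X4,X0]))) (S X8 X3 (S X8 X6 (L X3 [X8,X7,X1,X3,X2,X6,X4,X0]) (L X4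
  [X6,X0,X2,X8])) (L X4 [X3,X0,X2,X8]))) (L X4 [X7,X1,X2,X8])) (L X4 [X4,X1,X2,X8]))"
  by code_simp

text \<open>A 5-cycle, a vertex adjacent to two consecutive cycle vertices and to the cycle vertex
  opposite to them, and an isolated vertex; again it is the isolated vertex that is
  dominated.\<close>

definition "P23 = [[N,N,Y,N,Y,Y],[N,N,N,N,N],[Y,N,N,Y],[Y,N,N],[Y,N],[Y],[]]"

lemma cert_P23: "domination_cert [(X0,K4),(X1,P22),(X2,M2)] P23 vs7 X5 X3 X7 (S X7 X2 (S X7 X4 (S X7 X6 (S X7 X0
  (S X7 X1 (L X0 [X6,X1,X0,X7]) (L X1 [X3,X6,X7,X1,X4,X5,X2,X0])) (S X7 X1 (L X1
  [X3,X6,X7,X0,X2,X5,X4,X1]) (L X2 [X1,X0,X5,X7]))) (L X2 [X6,X3,X5,X7])) (L X2 [X4,X3,X5,X7])) (L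
  X2 [X3,X2,X5,X7]))"
  by code_simp

definition "P24 = [[Y,N,N,Y,N,N,Y,N],[Y,Y,Y,N,Y,N,N],[N,Y,Y,N,Y,Y],[Y,Y,N,Y,Y],[N,N,N,Y],[N,N,N],[Y,Y],[Y],[]]"

lemma cert_P24: "domination_cert [(X0,K4),(X1,M2),(X2,P23),(X3,P16)] P24 vs9 X5 X6 X9 (S X9 X0 (S X9 X1 (L X0
  [X5,X1,X0,X9]) (S X9 X2 (S X9 X4 (L X0 [X5,X4,X0,X9]) (L X1 [X6,X4,X2,X9])) (S X9 X3 (L X1
  [X2,X1,X3,X9]) (S X9 X8 (L X1 [X6,X3,X8,X9]) (S X9 X7 (L X2 [X2,X3,X8,X7,X9,X0,X1]) (L X1
  [X8,X7,X0,X9])))))) (S X9 X2 (S X9 X3 (S X9 X8 (L X1 [X6,X0,X8,X9]) (L X2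
  [X5,X8,X2,X0,X6,X3,X9])) (L X1 [X6,X3,X2,X9])) (S X9 X1 (S X9 X3 (L X1 [X2,X0,X3,X9]) (S X9 X4
  (S X9 X7 (L X0 [X7,X5,X4,X9]) (L X2 [X0,X3,X7,X4,X9,X1,X2])) (S X9 X7 (L X2
  [X2,X3,X4,X7,X9,X1,X0]) (L X1 [X7,X4,X1,X9])))) (L X3 [X6,X9,X2,X1,X0]))))"
  by code_simp

definition "P25 = [[Y,N,N,Y,N,Y,N,Y],[Y,Y,N,N,N,Y,Y],[N,Y,Y,Y,Y,Y],[N,N,Y,Y,Y],[N,Y,Y,Y],[N,N,Y],[N,N],[N],[]]"

lemma cert_P25: "coloring_cert [(X0,K4),(X1,M2),(X2,P16),(X3,P23),(X4,P14),(X5,P24)] P25 vs9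
  [X1,X0,X3,X3,X0,X0,X2,X1,X2] (B X1 (B X2 (C X3) (C X2)) (C X1)) X9 XA (S X9 X1 (S X9 X5 (S X9
  X7 (L X0 [X7,X5,X1,X9]) (S X9 X0 (S X9 X3 (S X9 X4 (S X9 X8 (L X0 [X8,X4,X0,X9]) (L X1
  [X8,X7,X3,X9])) (S X9 X6 (L X0 [X6,X3,X0,X9]) (L X1 [X6,X4,X5,X9]))) (L X2 [X7,X3,X9,X5,X1])) (S
  X9 X2 (L X1 [X7,X0,X2,X9]) F))) (S X9 X2 (S X9 X6 (S X9 X4 (L X0 [X6,X4,X1,X9]) (S X9 X7 (L X0
  [X7,X6,X1,X9]) (S X9 X3 (L X1 [X7,X5,X3,X9]) (S X9 X8 (L X2 [X4,X3,X9,X8,X2]) (L X3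
  [X5,X3,X8,X2,X9,X1,X7]))))) F) (S X9 X3 (L X1 [X5,X2,X3,X9]) (S X9 X7 (L X4 [X3,X2,X7,X1,X9]) (S
  X9 X8 (L X3 [X7,X3,X2,X8,X9,X1,X5]) (L X1 [X8,X2,X1,X9])))))) (S X9 X8 (S X9 X5 (S X9 X3 (S X9
  X0 (L X2 [X8,X1,X3,X0,X9]) (S X9 X4 (S X9 X2 (L X0 [X8,X4,X2,X9]) (S X9 X7 (L X5
  [X2,X4,X0,X9,X8,X3,X1,X5,X7]) (L X1 [X7,X1,X3,X9]))) (L X1 [X4,X1,X3,X9]))) (S X9 X2 (L X4
  [X3,X1,X8,X2,X9]) (S X9 X4 (L X2 [X2,X3,X9,X8,X4]) (L X3 [X2,X3,X1,X5,X9,X8,X4])))) (L X1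
  [X5,X1,X8,X9])) F)) (S X9 X1 (S XA X1 (S XA X2 (S X9 X2 (S XA X4 (S XA X8 (L X0
  [X8,X4,X2,XA]) (S XA X3 (S XA X7 (S XA X6 (L X0 [X6,X4,X1,XA]) (S XA X5 (L X0
  [X7,X5,X1,XA]) (L X5 [X8,X2,X6,XA,X4,X3,X5,X7,X1]))) (L X1 [X8,X7,X3,XA])) (L X2
  [X2,X3,X1,X4,XA]))) (S XA X8 (S X9 X8 (L X0 [X8,X2,XA,X9]) (S X9 X3 (S X9 X7 (S X9 X6 (L X0
  [X7,X6,X1,X9]) (S XA X7 (L X0 [X7,X1,XA,X9]) (S XA X3 (S X9 X5 (L X0 [X7,X5,X1,X9]) (S X9 X4
  (L X5 [X8,X2,X6,X9,X4,X3,X5,X7,X1]) (L X1 [X8,X4,X3,X9]))) (L X2 [X4,X3,XA,X8,X2])))) (L X1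
  [X8,X7,X3,X9])) (S X9 X5 (L X4 [X8,X3,X5,X1,X9]) (S X9 X7 (L X2 [X5,X3,X9,X7,X1]) (L X3
  [X5,X3,X8,X2,X9,X1,X7]))))) (S XA X3 (L X1 [X8,X4,X3,XA]) (S XA X5 (L X1 [X8,X4,X5,XA]) (S
  XA X7 (L X2 [X5,X3,XA,X7,X1]) (L X3 [X5,X3,X8,X2,XA,X1,X7])))))) F) (S X9 X2 F (S XA X3 (S
  X9 X3 (L X2 [X3,X2,X1,XA,X9]) (S X9 X7 (L X4 [X3,X2,X7,X1,X9]) (S X9 X8 (S X9 X5 (L X2
  [X7,X3,X9,X5,X1]) (L X3 [X7,X3,X2,X8,X9,X1,X5])) (L X1 [X8,X2,X1,X9])))) (S XA X7 (L X4
  [X3,X2,X7,X1,XA]) (S XA X8 (S XA X5 (L X2 [X7,X3,XA,X5,X1]) (L X3 [X7,X3,X2,X8,XA,X1,X5]))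
  (L X1 [X8,X2,X1,XA])))))) (S X9 X2 F F)) (S XA X1 (S XA X2 F F) (S XA X3 (S XA X7 (S XA X5
  (S XA X4 (S XA X0 (L X0 [X7,X5,X0,XA]) (S X9 X7 (S X9 X5 (L X0 [X7,X5,XA,X9]) (S X9 X3 (L X1
  [X5,X1,X3,X9]) (S X9 X8 (L X1 [X5,X1,X8,X9]) (S X9 X2 (S X9 X4 (L X2 [X8,X3,X9,X4,X2]) (L X3
  [X5,X3,X4,X2,X9,X7,X1])) (S X9 X4 (L X3 [X8,X3,X5,X7,X9,X4,X2]) (L X1 [X4,X2,X7,X9])))))) (S X9
  X3 (L X1 [X7,X1,X3,X9]) (S X9 X5 (S X9 X4 (S X9 X8 (S X9 X2 (L X0 [X8,X4,X2,X9]) (L X2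
  [X2,X3,X9,X8,X4])) (L X3 [X1,X3,X8,X4,X9,X5,X7])) (S X9 X8 (L X3 [X7,X3,X4,X8,X9,X5,X1]) (L X1
  [X8,X4,X5,X9]))) (L X4 [X3,X9,X7,X5,X1]))))) (L X1 [X4,X1,X3,XA])) (L X1 [X5,X1,X3,XA])) (L X1
  [X7,X1,X3,XA])) (S XA X5 (S XA X7 (L X2 [X1,X3,XA,X7,X5]) (S XA X4 (S XA X8 (S XA X2 (L
  X0 [X8,X4,X2,XA]) (L X2 [X2,X3,XA,X8,X4])) (L X3 [X1,X3,X8,X4,XA,X5,X7])) (S XA X8 (L X3
  [X7,X3,X4,X8,XA,X5,X1]) (L X1 [X8,X4,X5,XA])))) (S XA X8 (L X1 [X5,X1,X8,XA]) (S XA X7 (S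
  XA X2 (S XA X4 (L X2 [X8,X3,XA,X4,X2]) (L X3 [X5,X3,X4,X2,XA,X7,X1])) (S XA X4 (L X3
  [X8,X3,X5,X7,XA,X4,X2]) (L X1 [X4,X2,X7,XA]))) (L X4 [X3,XA,X7,X5,X1])))))))"
  by code_simp

definition "P26 = [[Y,N,Y,Y,N,N,N,Y],[Y,N,N,Y,N,Y,N],[N,Y,Y,Y,N,Y],[N,Y,Y,Y,Y],[N,N,Y,Y],[N,Y,Y],[N,N],[N],[]]"

lemma cert_P26: "coloring_cert [(X0,K4),(X1,P25),(X2,M2),(X3,P24),(X4,P16),(X5,P14),(X6,P23)] P26 vs9
  [X2,X3,X1,X1,X3,X2,X2,X0,X0] (C X0) X9 XA (S X9 X0 (S X9 X4 (S X9 X6 (L X0 [X6,X4,X0,X9]) (S X9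
  X8 (L X0 [X8,X4,X0,X9]) (S X9 X2 (S X9 X7 (S X9 X1 (S X9 X3 (L X0 [X7,X3,X1,X9]) (S X9 X5 (L X1
  [X4,X1,X5,X7,X0,X2,X8,X3,X9]) (L X2 [X5,X3,X4,X9]))) (S X9 X3 (L X3
  [X1,X7,X6,X9,X3,X2,X8,X4,X0]) (L X2 [X3,X1,X2,X9]))) (L X2 [X8,X7,X2,X9])) (L X4
  [X8,X2,X9,X4,X0])))) (S X9 X2 (S X9 X1 (S X9 X8 (S X9 X3 (S X9 X5 (L X0 [X5,X3,X0,X9]) (S X9 X7
  (L X0 [X7,X3,X1,X9]) (L X3 [X7,X1,X5,X9,X3,X2,X4,X8,X0]))) (S X9 X6 (S X9 X7 (L X1
  [X8,X7,X6,X1,X0,X2,X4,X3,X9]) (L X2 [X7,X3,X2,X9])) (L X2 [X6,X3,X8,X9]))) (L X2 [X8,X4,X2,X9]))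
  (L X2 [X4,X1,X2,X9])) (S X9 X7 (S X9 X3 (L X5 [X4,X2,X7,X3,X9]) (S X9 X1 (L X4 [X3,X2,X9,X7,X1])
  (L X6 [X3,X2,X4,X0,X9,X7,X1]))) (S X9 X1 (S X9 X8 (L X4 [X4,X2,X9,X8,X0]) (L X6
  [X4,X2,X7,X1,X9,X0,X8])) (L X2 [X7,X1,X0,X9]))))) (S X9 X1 (S X9 X6 (S X9 X8 (S X9 X2 (S X9 X3
  (S X9 X4 (S X9 X7 (L X0 [X7,X3,X1,X9]) (L X1 [X1,X4,X6,X8,X3,X2,X7,X0,X9])) (L X2
  [X4,X0,X2,X9])) (L X2 [X3,X0,X2,X9])) (S X9 X7 (L X5 [X2,X0,X7,X1,X9]) (S X9 X3 (L X4
  [X7,X2,X9,X3,X1]) (L X6 [X7,X2,X0,X8,X9,X1,X3])))) (L X2 [X8,X0,X1,X9])) (L X2 [X6,X0,X1,X9]))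
  F)) (S X9 X3 (S X9 X1 (S X9 X7 (L X0 [X7,X3,X1,X9]) (S X9 X2 (S X9 X8 (S X9 X5 (L X0
  [X5,X3,X1,X9]) (S X9 X0 (S X9 X4 (L X0 [X8,X4,X0,X9]) (L X3 [X7,X1,X5,X9,X3,X2,X4,X8,X0])) (S X9
  X4 (S X9 X6 (L X1 [X1,X4,X6,X8,X3,X2,X7,X0,X9]) (L X2 [X6,X0,X1,X9])) (L X2 [X4,X0,X2,X9])))) (L
  X2 [X8,X7,X2,X9])) (L X4 [X7,X2,X9,X3,X1]))) (S X9 X7 (S X9 X2 (S X9 X4 (S X9 X6 (L X0
  [X7,X6,X3,X9]) (S X9 X0 (S X9 X8 (L X0 [X8,X4,X0,X9]) (L X3 [X1,X7,X6,X9,X3,X2,X8,X4,X0])) (S X9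
  X8 (S X9 X5 (L X1 [X7,X8,X5,X4,X3,X2,X1,X0,X9]) (L X2 [X5,X0,X7,X9])) (L X2 [X8,X0,X2,X9])))) (L
  X2 [X4,X1,X2,X9])) (L X4 [X1,X2,X9,X7,X3])) (S X9 X2 (L X2 [X7,X1,X2,X9]) (S X9 X0 (L X2
  [X7,X1,X0,X9]) (S X9 X8 (S X9 X4 (L X4 [X0,X2,X9,X8,X4]) (L X6 [X7,X2,X4,X8,X9,X3,X1])) (S X9 X4
  (L X6 [X1,X2,X8,X4,X9,X3,X7]) (L X2 [X8,X4,X3,X9]))))))) (S X9 X2 (S X9 X1 (S X9 X0 (S X9 X7 (S
  X9 X4 (S X9 X8 (L X0 [X8,X4,X0,X9]) (S X9 X5 (L X1 [X4,X1,X5,X7,X0,X2,X8,X3,X9]) (L X2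
  [X5,X3,X4,X9]))) (S X9 X8 (S X9 X6 (L X1 [X8,X7,X6,X1,X0,X2,X4,X3,X9]) (L X2 [X6,X3,X8,X9])) (L
  X2 [X8,X4,X2,X9]))) (L X2 [X7,X3,X2,X9])) (L X2 [X3,X0,X2,X9])) (L X2 [X3,X1,X2,X9])) (S X9 X8
  (S X9 X1 (S X9 X4 (L X5 [X3,X2,X8,X4,X9]) (S X9 X0 (L X4 [X4,X2,X9,X8,X0]) (L X6
  [X4,X2,X3,X1,X9,X8,X0]))) (L X2 [X3,X1,X8,X9])) (S X9 X0 (S X9 X4 (L X4 [X8,X2,X9,X4,X0]) (S X9
  X7 (S X9 X1 (L X4 [X3,X2,X9,X7,X1]) (L X6 [X3,X2,X4,X0,X9,X7,X1])) (S X9 X1 (L X6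
  [X3,X2,X8,X0,X9,X1,X7]) (L X2 [X7,X1,X0,X9])))) (S X9 X4 (S X9 X7 (L X6 [X8,X2,X3,X7,X9,X4,X0])
  (L X2 [X7,X3,X4,X9])) (L X5 [X2,X9,X8,X4,X0]))))))"
  by code_simp

definition "P27 = [[Y,N,N,N,N,N,N],[N,N,Y,Y,Y,Y],[N,Y,Y,Y,N],[N,Y,Y,Y],[N,Y,Y],[N,Y],[N],[]]"

lemma cert_P27: "coloring_cert [(X0,K4),(X1,P24),(X2,M2),(X3,P16),(X4,P26),(X5,P25),(X6,P23),(X7,P14)] P27 vs8
  [X0,X1,X1,X1,X3,X0,X0,X2] (B X0 (C X3) (C X2)) X8 X9 (S X8 X0 (S X8 X3 (S X8 X6 (L X0
  [X6,X3,X0,X8]) (S X8 X1 (S X8 X5 (L X0 [X5,X3,X1,X8]) (S X8 X7 (S X8 X2 (S X8 X4 (L X0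
  [X4,X2,X0,X8]) (L X1 [X5,X1,X6,X8,X3,X7,X4,X2,X0])) (L X2 [X5,X2,X7,X8])) (L X3
  [X1,X7,X0,X3,X8]))) (S X8 X5 (S X8 X7 (S X8 X4 (S X8 X2 (L X0 [X4,X2,X0,X8]) (L X4
  [X4,X1,X6,X8,X2,X3,X7,X5,X0])) (L X2 [X4,X1,X7,X8])) (L X2 [X7,X6,X5,X8])) (L X2
  [X5,X1,X0,X8])))) F) F) (S X8 X0 (S X9 X0 (S X9 X2 (S X9 X4 (L X0 [X4,X2,X0,X9]) (S X9 X7 (S X9
  X6 (L X0 [X6,X2,X0,X9]) (S X8 X2 (L X0 [X2,X0,X9,X8]) (S X9 X1 (S X8 X7 (S X8 X5 (S X8 X4 (S X8
  X3 (S X8 X1 (L X0 [X5,X3,X1,X8]) (S X8 X6 (L X0 [X6,X3,X0,X8]) (L X4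
  [X4,X1,X6,X8,X2,X3,X7,X5,X0]))) (S X8 X1 (S X8 X6 (L X5 [X4,X1,X6,X5,X0,X7,X2,X3,X8]) (L X2
  [X6,X3,X4,X8])) (L X2 [X3,X1,X7,X8]))) (L X2 [X4,X2,X7,X8])) (L X2 [X5,X2,X7,X8])) (S X8 X4 (L
  X3 [X2,X7,X8,X4,X0]) (S X8 X3 (L X2 [X4,X2,X3,X8]) (S X8 X5 (S X8 X1 (L X3 [X3,X7,X8,X5,X1]) (L
  X6 [X3,X7,X4,X0,X8,X5,X1])) (S X8 X1 (L X6 [X4,X7,X5,X1,X8,X0,X2]) (L X2 [X5,X1,X0,X8])))))) (L
  X2 [X4,X1,X7,X9])))) (L X3 [X4,X7,X9,X2,X0]))) (S X9 X4 (S X9 X7 (S X9 X5 (S X8 X4 (L X0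
  [X4,X0,X9,X8]) (S X9 X3 (S X9 X1 (L X0 [X5,X3,X1,X9]) (S X9 X6 (L X0 [X6,X3,X0,X9]) (L X4
  [X4,X1,X6,X9,X2,X3,X7,X5,X0]))) (S X9 X6 (S X9 X1 (L X5 [X4,X1,X6,X5,X0,X7,X2,X3,X9]) (L X2
  [X3,X1,X7,X9])) (L X2 [X6,X3,X4,X9])))) (L X2 [X5,X2,X7,X9])) (L X3 [X2,X7,X9,X4,X0])) (S X9 X7
  (L X2 [X4,X2,X7,X9]) (S X9 X3 (L X2 [X4,X2,X3,X9]) (S X9 X5 (S X9 X1 (L X3 [X3,X7,X9,X5,X1]) (L
  X6 [X3,X7,X4,X0,X9,X5,X1])) (S X9 X1 (L X6 [X4,X7,X5,X1,X9,X0,X2]) (L X2 [X5,X1,X0,X9]))))))) F)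
  (S X9 X0 F (S X9 X7 (S X9 X3 (S X9 X4 (S X9 X2 (S X8 X2 (S X8 X4 (L X0 [X4,X2,X9,X8]) (S X8 X7
  (L X2 [X4,X0,X7,X8]) (S X8 X5 (L X2 [X4,X0,X5,X8]) (S X8 X1 (S X8 X3 (L X3 [X5,X7,X8,X3,X1]) (L
  X6 [X4,X7,X3,X1,X8,X2,X0])) (S X8 X3 (L X6 [X5,X7,X4,X2,X8,X3,X1]) (L X2 [X3,X1,X2,X8])))))) (S
  X8 X7 (L X2 [X2,X0,X7,X8]) (S X8 X4 (S X8 X1 (L X2 [X2,X0,X1,X8]) (S X8 X3 (S X8 X5 (L X3
  [X1,X7,X8,X5,X3]) (L X6 [X0,X7,X5,X3,X8,X4,X2])) (S X8 X5 (L X6 [X2,X7,X3,X5,X8,X4,X0]) (L X2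
  [X5,X3,X4,X8])))) (L X7 [X7,X8,X4,X2,X0])))) (L X2 [X2,X0,X7,X9])) (L X2 [X4,X0,X7,X9])) (L X2
  [X3,X0,X7,X9])) (S X9 X4 (S X9 X2 (L X3 [X0,X7,X9,X4,X2]) (S X9 X1 (L X2 [X2,X0,X1,X9]) (S X9 X3
  (S X9 X5 (L X3 [X1,X7,X9,X5,X3]) (L X6 [X0,X7,X5,X3,X9,X4,X2])) (S X9 X5 (L X6
  [X2,X7,X3,X5,X9,X4,X0]) (L X2 [X5,X3,X4,X9]))))) (S X9 X5 (L X2 [X4,X0,X5,X9]) (S X9 X2 (S X9 X1
  (S X9 X3 (L X3 [X5,X7,X9,X3,X1]) (L X6 [X4,X7,X3,X1,X9,X2,X0])) (S X9 X3 (L X6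
  [X5,X7,X4,X2,X9,X3,X1]) (L X2 [X3,X1,X2,X9]))) (L X7 [X7,X9,X4,X2,X0])))))))"
  by code_simp

text \<open>The triangular prism, which is the complement of a 6-cycle, with an additional isolated
  vertex.\<close>

definition "P28 = [[Y,Y,N,Y,N,N],[Y,N,N,Y,N],[N,N,N,Y],[N,N,N],[Y,Y],[Y],[]]"

lemma cert_P28: "coloring_cert [(X0,K4),(X1,P27),(X2,M2),(X3,P16),(X4,P23),(X5,P14)] P28 vs7
  [X2,X3,X1,X2,X1,X2,X0] (C X0) X7 X8 (S X7 X0 (S X7 X1 (S X7 X2 (L X0 [X2,X1,X0,X7]) (S X7 X3 (S
  X7 X6 (S X7 X4 (S X7 X5 (L X0 [X6,X5,X4,X7]) (L X1 [X3,X7,X5,X2,X4,X1,X6,X0])) (S X7 X5 (L X1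
  [X3,X7,X4,X2,X5,X0,X6,X1]) (L X2 [X5,X4,X3,X7]))) (L X2 [X6,X2,X3,X7])) (L X3
  [X2,X3,X7,X1,X0]))) (S X7 X2 (S X7 X3 (S X7 X5 (S X7 X4 (S X7 X6 (L X0 [X6,X5,X4,X7]) (L X1
  [X3,X7,X6,X1,X4,X2,X5,X0])) (S X7 X6 (L X1 [X3,X7,X4,X1,X6,X0,X5,X2]) (L X2 [X6,X4,X3,X7]))) (L
  X2 [X5,X1,X3,X7])) (L X3 [X1,X3,X7,X2,X0])) (S X7 X3 (L X2 [X2,X1,X3,X7]) (S X7 X4 (L X2
  [X2,X1,X4,X7]) (S X7 X5 (S X7 X6 (L X3 [X4,X3,X7,X6,X5]) (L X4 [X1,X3,X6,X5,X7,X0,X2])) (S X7 X6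
  (L X4 [X2,X3,X5,X6,X7,X0,X1]) (L X2 [X6,X5,X0,X7]))))))) F) (S X8 X1 (S X8 X2 (S X8 X0 (L X0
  [X2,X1,X0,X8]) (S X8 X3 (S X8 X4 (S X8 X5 (S X8 X6 (L X0 [X6,X5,X4,X8]) (L X1
  [X3,X8,X6,X0,X5,X2,X4,X1])) (S X8 X6 (L X1 [X3,X8,X5,X0,X6,X1,X4,X2]) (L X2 [X6,X5,X3,X8]))) (L
  X2 [X4,X0,X3,X8])) (L X3 [X0,X3,X8,X2,X1]))) (S X8 X3 (S X8 X6 (S X8 X0 (S X8 X4 (S X8 X5 (L X0
  [X6,X5,X4,X8]) (L X1 [X3,X8,X5,X2,X4,X1,X6,X0])) (S X8 X5 (L X1 [X3,X8,X4,X2,X5,X0,X6,X1]) (L X2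
  [X5,X4,X3,X8]))) (L X2 [X2,X0,X3,X8])) (L X2 [X6,X2,X3,X8])) (S X8 X0 (L X3 [X2,X3,X8,X1,X0]) (S
  X8 X5 (L X2 [X2,X0,X5,X8]) (S X8 X6 (S X8 X4 (L X3 [X5,X3,X8,X6,X4]) (L X4
  [X2,X3,X4,X6,X8,X1,X0])) (S X8 X4 (L X4 [X0,X3,X6,X4,X8,X1,X2]) (L X2 [X6,X4,X1,X8]))))))) (S X8
  X3 (S X8 X5 (S X8 X2 (S X8 X0 (S X8 X4 (S X8 X6 (L X0 [X6,X5,X4,X8]) (L X1
  [X3,X8,X6,X1,X4,X2,X5,X0])) (S X8 X6 (L X1 [X3,X8,X4,X1,X6,X0,X5,X2]) (L X2 [X6,X4,X3,X8]))) (L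
  X2 [X1,X0,X3,X8])) (L X2 [X2,X1,X3,X8])) (L X2 [X5,X1,X3,X8])) (S X8 X2 (S X8 X0 (L X3
  [X1,X3,X8,X2,X0]) (S X8 X6 (L X2 [X1,X0,X6,X8]) (S X8 X5 (S X8 X4 (L X3 [X6,X3,X8,X5,X4]) (L X4
  [X1,X3,X4,X5,X8,X2,X0])) (S X8 X4 (L X4 [X0,X3,X5,X4,X8,X2,X1]) (L X2 [X5,X4,X2,X8]))))) (S X8
  X0 (S X8 X4 (L X2 [X2,X1,X4,X8]) (S X8 X6 (S X8 X5 (L X3 [X4,X3,X8,X6,X5]) (L X4
  [X2,X3,X5,X6,X8,X0,X1])) (S X8 X5 (L X4 [X1,X3,X6,X5,X8,X0,X2]) (L X2 [X6,X5,X0,X8])))) (L X5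
  [X3,X8,X2,X1,X0])))))"
  by code_simp

definition "P29 = [[Y,N,Y,N,N,Y,N],[N,Y,Y,Y,Y,N],[N,N,N,Y,N],[N,N,N,Y],[N,N,N],[Y,Y],[Y],[]]"

lemma cert_P29: "coloring_cert [(X0,K4),(X1,P16),(X2,M2),(X3,P23),(X4,P14)] P29 vs8 [X2,X0,X2,X3,X3,X2,X3,X0] (B
  X0 (B X3 (C X1) (C X3)) (B X2 (C X0) (C X2))) X8 X9 (S X8 X0 (S X8 X3 F (S X8 X1 (S X8 X2 (L X0
  [X2,X1,X0,X8]) (L X1 [X2,X3,X8,X1,X0])) (S X8 X2 (L X1 [X1,X3,X8,X2,X0]) (S X8 X4 (L X2
  [X2,X1,X4,X8]) F)))) (S X8 X2 (S X8 X1 (S X8 X6 (L X0 [X6,X2,X1,X8]) F) (S X8 X3 (L X2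
  [X1,X0,X3,X8]) (S X8 X4 (S X8 X5 (L X3 [X2,X3,X4,X8,X5,X1,X0]) (L X2 [X5,X1,X4,X8])) (S X8 X7 (L
  X3 [X1,X3,X4,X7,X8,X2,X0]) (L X2 [X7,X4,X2,X8]))))) (S X8 X5 (L X2 [X2,X0,X5,X8]) (S X8 X7 (L X2
  [X2,X0,X7,X8]) F)))) (S X8 X0 (S X8 X3 (S X9 X0 (S X9 X3 (S X9 X1 (S X8 X1 (L X0 [X1,X0,X9,X8])
  (S X8 X2 (S X9 X2 (L X0 [X2,X0,X9,X8]) (S X8 X7 (S X8 X5 (S X9 X6 (S X9 X7 (L X0 [X7,X6,X1,X9])
  (S X9 X4 (S X8 X6 (L X0 [X6,X3,X9,X8]) (S X8 X4 (L X0 [X4,X0,X9,X8]) (L X2 [X6,X4,X5,X8]))) (L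
  X2 [X7,X4,X3,X9]))) (S X9 X5 (L X2 [X6,X2,X5,X9]) (S X9 X4 (L X3 [X4,X5,X3,X6,X2,X0,X9]) (S X9
  X7 (L X3 [X4,X5,X2,X0,X9,X7,X6]) (L X2 [X7,X6,X0,X9]))))) (L X2 [X5,X1,X3,X8])) (L X2
  [X7,X1,X3,X8]))) (L X2 [X2,X1,X3,X8]))) (S X9 X2 (S X8 X2 (L X0 [X2,X0,X9,X8]) (S X9 X7 (S X9 X5
  (S X8 X1 (S X8 X6 (S X8 X7 (L X0 [X7,X6,X1,X8]) (S X8 X4 (S X9 X4 (L X0 [X4,X0,X9,X8]) (S X9 X6
  (L X0 [X6,X3,X9,X8]) (L X2 [X6,X4,X5,X9]))) (L X2 [X7,X4,X3,X8]))) (S X8 X5 (L X2 [X6,X2,X5,X8])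
  (S X8 X7 (S X8 X4 (L X4 [X5,X2,X7,X4,X8]) (L X3 [X4,X5,X2,X0,X8,X7,X6])) (L X2 [X7,X6,X0,X8]))))
  (L X2 [X2,X1,X3,X8])) (L X2 [X5,X1,X3,X9])) (L X2 [X7,X1,X3,X9]))) (L X2 [X2,X1,X3,X9]))) F) (S
  X9 X2 F F)) (S X9 X0 (S X9 X3 F (S X9 X2 (S X9 X1 (L X0 [X2,X1,X0,X9]) (L X1 [X1,X3,X9,X2,X0]))
  (S X9 X1 (L X1 [X2,X3,X9,X1,X0]) (S X8 X2 (L X1 [X2,X3,X9,X0,X8]) (S X8 X1 (L X1
  [X1,X3,X9,X0,X8]) (L X2 [X2,X1,X9,X8])))))) (S X9 X2 F F))) (S X8 X2 (S X9 X0 (S X9 X3 F F) (S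
  X9 X2 (S X8 X1 (S X8 X3 (S X9 X1 (L X0 [X2,X1,X9,X8]) (S X9 X3 (L X2 [X1,X0,X3,X9]) (S X9 X4 (S
  X9 X5 (L X3 [X2,X3,X4,X9,X5,X1,X0]) (L X2 [X5,X1,X4,X9])) (S X9 X7 (L X3 [X1,X3,X4,X7,X9,X2,X0])
  (L X2 [X7,X4,X2,X9]))))) (L X1 [X0,X3,X8,X2,X1])) (S X9 X1 (S X9 X3 (S X8 X3 (L X2
  [X1,X0,X3,X8]) (S X8 X4 (S X8 X5 (L X3 [X2,X3,X4,X8,X5,X1,X0]) (L X2 [X5,X1,X4,X8])) (S X8 X7 (L
  X3 [X1,X3,X4,X7,X8,X2,X0]) (L X2 [X7,X4,X2,X8])))) (L X1 [X0,X3,X9,X2,X1])) (L X2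
  [X1,X0,X9,X8]))) F)) (S X9 X0 (S X9 X3 F F) (S X9 X2 F (L X2 [X2,X0,X9,X8])))))"
  by code_simp

definition "P30 = [[Y,Y,Y,N,Y,N,Y],[Y,Y,Y,N,Y,N],[N,Y,Y,Y,Y],[N,N,Y,Y],[N,N,Y],[N,N],[N],[]]"

lemma cert_P30: "coloring_cert [(X0,K4),(X1,M2),(X2,P14),(X3,P29),(X4,P23),(X5,P16)] P30 vs8
  [X2,X0,X1,X1,X3,X3,X3,X0] (B X7 (B X0 (C X1) (C X0)) (B X2 (C X2) (C X3))) X8 X9 (S X8 X7 (S X8
  X0 (S X8 X4 (L X0 [X7,X4,X0,X8]) (S X8 X5 (L X0 [X7,X5,X0,X8]) F)) (S X8 X6 (S X8 X4 (L X0
  [X7,X6,X4,X8]) (S X8 X2 (L X1 [X4,X0,X2,X8]) (S X8 X1 (L X2 [X2,X0,X6,X1,X8]) (S X8 X3 (L X1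
  [X4,X1,X3,X8]) (S X8 X5 (L X0 [X7,X6,X5,X8]) (L X3 [X1,X6,X2,X4,X8,X3,X5,X0])))))) F)) (S X8 X2
  F (S X8 X1 (L X1 [X7,X2,X1,X8]) (S X8 X3 (L X1 [X7,X2,X3,X8]) F)))) (S X9 X7 (S X9 X0 (S X8 X7
  (S X8 X0 (L X0 [X7,X0,X9,X8]) F) (S X8 X2 F F)) (S X8 X7 (S X8 X0 F (S X9 X4 (S X8 X4 (L X0
  [X7,X4,X9,X8]) (S X8 X2 (L X1 [X4,X0,X2,X8]) (S X9 X6 (L X0 [X7,X6,X4,X9]) (S X9 X2 (S X9 X5 (L
  X0 [X7,X5,X2,X9]) (S X9 X3 (S X8 X5 (S X8 X6 (L X0 [X7,X6,X5,X8]) (S X8 X1 (S X8 X3 (L X4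
  [X6,X2,X0,X3,X8,X1,X4]) (L X1 [X3,X0,X1,X8])) (L X2 [X2,X8,X6,X4,X1]))) (L X1 [X5,X0,X9,X8])) (L
  X1 [X3,X0,X2,X9]))) (S X9 X5 (S X8 X5 (L X0 [X7,X5,X9,X8]) (S X8 X1 (S X8 X6 (L X2
  [X2,X0,X6,X1,X8]) (S X8 X3 (L X4 [X6,X2,X0,X3,X8,X1,X4]) (L X1 [X3,X0,X1,X8]))) (S X8 X3 (L X1
  [X4,X1,X3,X8]) (S X8 X6 (L X3 [X1,X6,X2,X4,X8,X3,X5,X0]) (L X2 [X2,X8,X6,X4,X1]))))) (L X1
  [X5,X2,X4,X9])))))) (S X8 X4 (S X8 X6 (L X0 [X7,X6,X4,X8]) (S X9 X2 (L X1 [X4,X0,X2,X9]) (S X8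
  X2 (S X8 X5 (L X0 [X7,X5,X2,X8]) (S X8 X3 (S X9 X5 (S X9 X6 (L X0 [X7,X6,X5,X9]) (S X9 X1 (S X9
  X3 (L X4 [X6,X2,X0,X3,X9,X1,X4]) (L X1 [X3,X0,X1,X9])) (L X2 [X2,X9,X6,X4,X1]))) (L X1
  [X5,X0,X9,X8])) (L X1 [X3,X0,X2,X8]))) (S X8 X5 (S X8 X1 (L X5 [X6,X2,X8,X4,X1]) (S X9 X5 (L X0
  [X7,X5,X9,X8]) (S X9 X1 (S X9 X6 (L X2 [X2,X0,X6,X1,X9]) (S X9 X3 (L X4 [X6,X2,X0,X3,X9,X1,X4])
  (L X1 [X3,X0,X1,X9]))) (S X9 X6 (S X9 X3 (L X1 [X4,X1,X3,X9]) (L X3 [X1,X6,X2,X4,X9,X3,X5,X0]))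
  (L X1 [X6,X1,X9,X8]))))) (L X1 [X5,X2,X4,X8]))))) (L X1 [X4,X0,X9,X8])))) (S X8 X2 F F))) (S X9
  X2 (S X8 X7 (S X8 X0 F F) (S X8 X2 (S X8 X1 (S X8 X0 (S X8 X5 (S X8 X6 (L X0 [X6,X5,X1,X8]) (S
  X8 X3 (L X0 [X5,X3,X0,X8]) (L X1 [X6,X3,X2,X8]))) (S X9 X5 (S X9 X3 (S X9 X6 (L X0
  [X6,X5,X3,X9]) (S X9 X0 (L X0 [X5,X3,X0,X9]) (S X9 X1 (L X1 [X7,X0,X1,X9]) (L X1
  [X6,X1,X2,X9])))) (S X9 X6 (S X9 X1 (L X0 [X6,X5,X1,X9]) (S X8 X4 (S X9 X4 (S X9 X0 (L X0
  [X4,X0,X9,X8]) (L X1 [X3,X0,X2,X9])) (L X1 [X4,X1,X2,X9])) (S X9 X4 (S X8 X3 (L X1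
  [X7,X4,X3,X8]) (L X4 [X9,X3,X1,X4,X7,X2,X8])) (L X1 [X7,X4,X9,X8])))) (L X1 [X6,X3,X2,X9]))) (L
  X1 [X7,X5,X9,X8]))) (L X1 [X7,X0,X1,X8])) (S X8 X4 (S X8 X6 (S X9 X4 (S X9 X6 (L X0
  [X6,X4,X9,X8]) (S X9 X1 (S X9 X0 (S X9 X3 (S X8 X0 (L X0 [X4,X0,X9,X8]) (S X8 X3 (S X8 X5 (L X0
  [X6,X5,X3,X8]) (S X9 X5 (L X0 [X5,X3,X0,X9]) (L X1 [X7,X5,X9,X8]))) (L X1 [X3,X0,X2,X8]))) (L X1
  [X6,X3,X2,X9])) (L X1 [X7,X0,X1,X9])) (L X1 [X6,X1,X2,X9]))) (S X9 X3 (L X1 [X7,X4,X3,X9]) (S X9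
  X0 (S X9 X6 (S X9 X1 (S X9 X5 (L X0 [X6,X5,X1,X9]) (S X8 X5 (S X8 X3 (L X0 [X6,X5,X3,X8]) (L X4
  [X8,X3,X1,X4,X7,X2,X9])) (L X1 [X7,X5,X9,X8]))) (L X1 [X4,X1,X2,X9])) (L X1 [X6,X3,X2,X9])) (L
  X1 [X3,X0,X2,X9])))) (L X1 [X6,X1,X2,X8])) (L X1 [X4,X1,X2,X8]))) F)) (S X8 X7 (S X8 X0 F F) (S
  X8 X2 F (L X1 [X7,X2,X9,X8])))))"
  by code_simp

definition "P31 = [[Y,N,N,N,Y,Y,Y],[Y,Y,N,Y,N,N],[Y,Y,Y,Y,Y],[N,N,Y,Y],[N,N,N],[N,N],[N],[]]"

lemma cert_P31: "coloring_cert [(X0,K4),(X1,M2),(X2,P16),(X3,P28),(X4,P23),(X5,P30),(X6,P14)] P31 vs8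
  [X0,X1,X0,X3,X3,X3,X1,X1] (B X3 (B X7 (C X2) (C X0)) (B X6 (C X3) (C X1))) X8 X9 (S X8 X3 (S X8
  X7 F (S X8 X2 (S X8 X5 (S X8 X6 (L X0 [X6,X5,X2,X8]) (L X1 [X7,X6,X3,X8])) F) (L X1
  [X7,X2,X3,X8]))) (S X8 X2 (S X8 X6 (S X8 X7 (L X0 [X7,X6,X2,X8]) (L X2 [X7,X3,X8,X6,X2])) (S X8
  X7 (L X2 [X6,X3,X8,X7,X2]) (S X8 X0 (S X8 X4 (L X3 [X6,X7,X2,X3,X4,X0,X8]) (L X4
  [X7,X3,X4,X0,X8,X2,X6])) (S X8 X4 (L X4 [X6,X3,X0,X4,X8,X2,X7]) (L X1 [X4,X0,X2,X8]))))) (S X8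
  X6 (S X8 X4 (S X8 X7 (L X2 [X7,X3,X4,X6,X8]) (L X1 [X7,X2,X4,X8])) F) (S X8 X0 (L X1
  [X6,X2,X0,X8]) (S X8 X1 (L X1 [X6,X2,X1,X8]) F))))) (S X8 X3 (S X8 X7 (S X9 X3 (S X9 X7 (S X8 X6
  (S X9 X6 (L X0 [X7,X6,X9,X8]) (S X9 X2 (S X8 X2 (L X0 [X7,X2,X9,X8]) (S X9 X4 (S X8 X4 (S X8 X5
  (L X0 [X6,X5,X4,X8]) (S X8 X0 (S X8 X1 (L X2 [X1,X2,X0,X4,X8]) (S X9 X1 (L X5
  [X8,X7,X9,X6,X1,X3,X2,X4]) (S X9 X5 (L X5 [X4,X9,X5,X8,X2,X1,X3,X6]) (L X1 [X5,X1,X9,X8])))) (S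
  X9 X0 (L X5 [X8,X7,X9,X6,X0,X3,X2,X4]) (S X9 X5 (L X5 [X4,X9,X5,X8,X2,X0,X3,X6]) (L X1
  [X5,X0,X9,X8]))))) (S X8 X5 (S X8 X0 (L X5 [X8,X6,X5,X7,X4,X3,X2,X0]) (L X1 [X4,X0,X3,X8])) (L
  X1 [X5,X4,X7,X8]))) (L X1 [X6,X4,X3,X9]))) (L X1 [X6,X2,X3,X9]))) (S X8 X2 (S X9 X2 (L X0
  [X7,X2,X9,X8]) (S X8 X4 (S X9 X6 (S X9 X4 (S X9 X5 (L X0 [X6,X5,X4,X9]) (S X9 X0 (S X9 X1 (L X2
  [X1,X2,X0,X4,X9]) (S X8 X1 (L X5 [X9,X7,X8,X6,X1,X3,X2,X4]) (S X8 X5 (L X5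
  [X4,X8,X5,X9,X2,X1,X3,X6]) (L X1 [X5,X1,X9,X8])))) (S X8 X0 (L X5 [X9,X7,X8,X6,X0,X3,X2,X4]) (S
  X8 X5 (L X5 [X4,X8,X5,X9,X2,X0,X3,X6]) (L X1 [X5,X0,X9,X8]))))) (S X9 X5 (S X9 X0 (L X5
  [X9,X6,X5,X7,X4,X3,X2,X0]) (L X1 [X4,X0,X3,X9])) (L X1 [X5,X4,X7,X9]))) (L X1 [X6,X2,X3,X9])) (L
  X1 [X6,X4,X3,X8]))) (L X1 [X6,X2,X3,X8]))) F) (S X9 X6 F F)) (S X9 X3 (S X9 X7 F (S X8 X2 (S X8
  X6 (S X9 X2 (S X9 X6 (L X0 [X6,X2,X9,X8]) (L X1 [X7,X6,X3,X9])) (L X1 [X7,X2,X3,X9])) (L X1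
  [X7,X6,X3,X8])) (L X1 [X7,X2,X3,X8]))) (S X9 X6 F F))) (S X8 X6 (S X9 X3 (S X9 X7 F F) (S X9 X6
  (S X8 X2 (S X8 X7 (L X0 [X7,X6,X2,X8]) (L X2 [X7,X3,X8,X6,X2])) (S X8 X7 (L X2 [X2,X3,X8,X7,X6])
  (S X9 X2 (L X2 [X2,X3,X8,X6,X9]) (S X9 X7 (L X2 [X7,X3,X8,X6,X9]) (L X1 [X7,X2,X9,X8]))))) F))
  (S X9 X3 (S X9 X7 F F) (S X9 X6 F (S X8 X2 (S X8 X7 (L X2 [X6,X3,X8,X7,X2]) (S X9 X7 (S X9 X2 (L
  X2 [X7,X3,X8,X2,X9]) (S X8 X4 (S X9 X4 (L X3 [X6,X7,X2,X3,X4,X9,X8]) (L X4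
  [X2,X3,X4,X8,X9,X7,X6])) (S X9 X4 (L X4 [X7,X3,X4,X9,X8,X2,X6]) (L X1 [X6,X4,X9,X8])))) (L X1
  [X7,X6,X9,X8]))) (S X9 X2 (S X8 X7 (S X9 X7 (L X2 [X2,X3,X8,X7,X9]) (S X9 X4 (S X8 X4 (L X3
  [X6,X2,X7,X3,X4,X9,X8]) (L X4 [X2,X3,X4,X9,X8,X7,X6])) (S X8 X4 (L X4 [X7,X3,X4,X8,X9,X2,X6]) (L
  X1 [X6,X4,X9,X8])))) (L X6 [X3,X8,X7,X6,X2])) (L X1 [X6,X2,X9,X8])))))))"
  by code_simp

definition "P32 = [[Y,Y,Y,Y,N,Y],[Y,N,N,Y,N],[N,N,N,Y],[N,N,N],[Y,Y],[Y],[]]"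

lemma cert_P32: "coloring_cert [(X0,K4),(X1,P30),(X2,M2),(X3,P14),(X4,P23),(X5,P16),(X6,P28),(X7,P31)] P32 vs7
  [X0,X1,X2,X2,X2,X0,X1] (B X4 (B X0 (C X3) (B X5 (C X3) (C X1))) (B X6 (C X2) (C X0))) X7 X8 (S
  X7 X4 (S X7 X0 F (S X7 X5 F F)) (S X7 X6 (S X7 X0 (S X7 X2 (L X0 [X6,X2,X0,X7]) (S X7 X3 (S X7
  X1 (S X7 X5 (L X1 [X7,X0,X6,X1,X4,X3,X2,X5]) (L X2 [X5,X4,X3,X7])) (L X2 [X2,X1,X3,X7])) F)) (S
  X7 X3 (L X2 [X4,X0,X3,X7]) (S X7 X2 (S X7 X1 (L X3 [X4,X3,X2,X1,X7]) (S X7 X5 (L X4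
  [X1,X3,X4,X5,X7,X2,X0]) (L X2 [X5,X4,X2,X7]))) F))) (S X7 X1 (L X2 [X6,X4,X1,X7]) F))) (S X7 X4
  (S X7 X0 (S X8 X4 (S X8 X0 (L X0 [X4,X0,X8,X7]) (S X8 X5 (S X8 X2 (S X7 X5 (L X0 [X5,X4,X8,X7])
  (S X8 X3 (S X7 X2 (S X7 X3 (S X7 X1 (L X0 [X2,X1,X0,X7]) (L X2 [X5,X1,X3,X7])) (L X3
  [X5,X3,X2,X0,X7])) (S X7 X1 (S X7 X3 (S X8 X1 (L X1 [X7,X1,X8,X0,X5,X3,X2,X4]) (L X2
  [X1,X0,X3,X8])) (L X5 [X4,X3,X1,X0,X7])) (L X2 [X2,X1,X4,X7]))) (S X8 X1 (L X5 [X5,X3,X2,X1,X8])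
  (L X6 [X1,X0,X2,X3,X5,X4,X8])))) (L X2 [X2,X0,X5,X8])) F)) (S X8 X6 F F)) (S X7 X5 (S X8 X4 (S
  X8 X0 (S X7 X2 (S X8 X5 (L X0 [X5,X4,X8,X7]) (S X7 X3 (S X8 X2 (S X8 X3 (S X8 X1 (L X0
  [X2,X1,X0,X8]) (L X2 [X5,X1,X3,X8])) (L X3 [X5,X3,X2,X0,X8])) (S X8 X1 (S X8 X3 (S X7 X1 (L X1
  [X8,X1,X7,X0,X5,X3,X2,X4]) (L X2 [X1,X0,X3,X7])) (L X5 [X4,X3,X1,X0,X8])) (L X2 [X2,X1,X4,X8])))
  (S X7 X1 (L X5 [X5,X3,X2,X1,X7]) (L X6 [X1,X0,X2,X3,X5,X4,X7])))) (L X2 [X2,X0,X5,X7])) (S X8 X5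
  (L X0 [X5,X4,X8,X7]) F)) (S X8 X6 F F)) (S X8 X4 (S X8 X0 F (S X8 X5 F (S X7 X3 (S X7 X1 (S X8
  X3 (L X3 [X5,X0,X3,X8,X7]) (S X8 X2 (S X8 X1 (L X5 [X0,X3,X8,X2,X1]) (L X4
  [X0,X3,X5,X4,X8,X2,X1])) (S X8 X1 (S X8 X6 (L X7 [X1,X0,X6,X4,X3,X2,X5,X8]) (L X2
  [X6,X3,X1,X8])) (L X2 [X2,X1,X4,X8])))) (L X2 [X1,X0,X3,X7])) (S X7 X1 (S X7 X6 (S X7 X2 (L X5
  [X0,X3,X7,X2,X1]) (L X7 [X1,X0,X6,X4,X3,X2,X5,X7])) (L X2 [X6,X3,X1,X7])) (S X7 X2 (L X4
  [X0,X3,X5,X4,X7,X2,X1]) (L X2 [X2,X1,X4,X7])))))) (S X8 X6 F F)))) (S X7 X6 (S X8 X4 (S X8 X0 F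
  (S X8 X5 F F)) (S X8 X6 (S X7 X0 (S X8 X0 (L X0 [X6,X0,X8,X7]) (S X8 X3 (L X2 [X4,X0,X3,X8]) (S
  X8 X2 (S X8 X5 (S X8 X1 (L X3 [X4,X3,X2,X1,X8]) (L X4 [X1,X3,X4,X5,X8,X2,X0])) (L X2
  [X5,X4,X2,X8])) (S X8 X5 (L X2 [X2,X0,X5,X8]) (S X7 X2 (L X0 [X6,X2,X0,X7]) (S X7 X5 (S X7 X1 (S
  X7 X3 (L X1 [X7,X0,X6,X1,X4,X3,X2,X5]) (L X5 [X5,X3,X0,X1,X7])) (S X8 X1 (S X7 X3 (L X2
  [X2,X1,X3,X7]) (L X7 [X1,X0,X6,X7,X3,X2,X5,X8])) (L X2 [X2,X1,X8,X7]))) (L X2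
  [X5,X4,X8,X7]))))))) (S X8 X0 (S X7 X3 (L X2 [X4,X0,X3,X7]) (S X7 X2 (S X7 X5 (S X7 X1 (L X3
  [X4,X3,X2,X1,X7]) (L X4 [X1,X3,X4,X5,X7,X2,X0])) (L X2 [X5,X4,X2,X7])) (S X7 X5 (L X2
  [X2,X0,X5,X7]) (S X8 X2 (L X0 [X6,X2,X0,X8]) (S X8 X5 (S X8 X1 (S X8 X3 (L X1
  [X8,X0,X6,X1,X4,X3,X2,X5]) (L X5 [X5,X3,X0,X1,X8])) (S X7 X1 (S X8 X3 (L X2 [X2,X1,X3,X8]) (L X7
  [X1,X0,X6,X8,X3,X2,X5,X7])) (L X2 [X2,X1,X8,X7]))) (L X2 [X5,X4,X8,X7])))))) (L X2
  [X4,X0,X8,X7]))) F)) (S X8 X4 (S X8 X0 F (S X8 X5 F F)) (S X8 X6 F (L X2 [X6,X4,X8,X7])))))"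
  by code_simp

text \<open>The house with one additional isolated vertex. The end \<open>X4\<close> of its floor
  has the neighbours \<open>X0\<close> and \<open>X5\<close>, both adjacent to \<open>X1\<close>, so
  domination applies.\<close>

definition "P33 = [[Y,N,N,Y,N],[N,N,N,Y],[N,N,N],[Y,Y],[Y],[]]"

lemma cert_P33: "domination_cert [(X0,P32),(X1,M2),(X2,P16),(X3,P28),(X4,P23)] P33 vs6 X4 X1 X6 (S X6 X2 (S X6 X0
  (S X6 X3 (S X6 X5 (L X0 [X6,X5,X4,X3,X2,X1,X0]) (L X1 [X5,X1,X3,X6])) (L X2 [X4,X3,X2,X0,X6]))
  (S X6 X3 (L X1 [X1,X0,X3,X6]) (S X6 X5 (L X3 [X1,X0,X2,X3,X5,X4,X6]) (L X4
  [X0,X3,X5,X4,X6,X2,X1])))) (L X1 [X2,X1,X4,X6]))"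
  by code_simp

definition "P34 = [[Y,Y,Y,Y,N],[N,N,N,Y],[N,N,N],[Y,Y],[Y],[]]"

lemma cert_P34: "coloring_cert [(X0,K4),(X1,M2),(X2,P16),(X3,P33),(X4,P14)] P34 vs6 [X0,X2,X2,X1,X3,X0] (B X3 (B
  X0 (B X1 (C X1) (C X3)) (C X0)) (C X2)) X6 X7 (S X6 X3 (S X6 X0 (S X6 X1 (S X6 X2 (L X0
  [X2,X1,X0,X6]) F) F) (S X6 X1 (S X6 X2 (S X6 X5 (L X0 [X5,X2,X1,X6]) F) (L X1 [X2,X0,X3,X6])) (L
  X1 [X1,X0,X3,X6]))) (S X6 X4 (S X6 X1 (S X6 X0 (L X2 [X4,X3,X1,X0,X6]) (S X6 X2 (L X2
  [X0,X3,X6,X2,X1]) (L X3 [X4,X6,X3,X2,X0,X1]))) (S X6 X2 (S X6 X0 (L X2 [X4,X3,X2,X0,X6]) (L X3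
  [X4,X6,X3,X1,X0,X2])) (L X1 [X2,X1,X4,X6]))) F)) (S X6 X3 (S X6 X0 (S X6 X1 (S X7 X3 (S X7 X0 (S
  X7 X1 (L X0 [X1,X0,X7,X6]) F) F) F) (S X7 X3 (S X7 X0 (S X7 X1 F (S X6 X2 (S X7 X2 (L X0
  [X2,X0,X7,X6]) (L X1 [X2,X1,X3,X7])) (L X1 [X2,X1,X3,X6]))) F) F)) (S X7 X3 (S X7 X0 (S X7 X1 F
  F) (S X6 X2 (S X6 X1 (S X7 X1 (S X7 X2 (L X0 [X2,X1,X7,X6]) (L X1 [X2,X0,X3,X7])) (L X1
  [X1,X0,X3,X7])) (L X1 [X1,X0,X3,X6])) (L X1 [X2,X0,X3,X6]))) F)) (S X7 X3 (S X7 X0 (S X7 X1 F F)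
  F) (S X6 X0 (S X6 X2 (S X6 X1 (L X0 [X2,X1,X0,X6]) (L X2 [X1,X3,X6,X2,X0])) (S X6 X1 (L X2
  [X2,X3,X6,X1,X0]) (S X7 X1 (S X7 X0 (L X2 [X1,X3,X6,X0,X7]) (S X7 X2 (L X2 [X0,X3,X7,X2,X1]) (L
  X3 [X7,X6,X3,X2,X1,X0]))) (S X7 X2 (S X7 X0 (L X2 [X2,X3,X6,X0,X7]) (L X3 [X7,X6,X3,X1,X2,X0]))
  (L X1 [X2,X1,X7,X6]))))) (S X6 X2 (S X6 X1 (L X2 [X0,X3,X6,X2,X1]) (S X7 X0 (S X7 X2 (L X2
  [X0,X3,X6,X2,X7]) (S X7 X1 (L X2 [X2,X3,X7,X1,X0]) (L X3 [X7,X6,X3,X1,X0,X2]))) (S X7 X1 (S X7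
  X2 (L X2 [X1,X3,X6,X2,X7]) (L X3 [X7,X6,X3,X0,X1,X2])) (L X1 [X1,X0,X7,X6])))) (S X6 X1 (S X7 X0
  (S X7 X1 (L X2 [X0,X3,X6,X1,X7]) (S X7 X2 (L X2 [X1,X3,X7,X2,X0]) (L X3 [X7,X6,X3,X2,X0,X1])))
  (S X7 X2 (S X7 X1 (L X2 [X2,X3,X6,X1,X7]) (L X3 [X7,X6,X3,X0,X2,X1])) (L X1 [X2,X0,X7,X6]))) (L
  X4 [X3,X6,X2,X1,X0]))))))"
  by code_simp

text \<open>An edge joined completely to three independent vertices, and a further vertex adjacent
  to exactly two of these three.\<close>

definition "P35 = [[N,Y,N,Y,Y],[Y,N,Y,Y],[N,N,N],[Y,Y],[Y],[]]"

lemma cert_P35: "coloring_cert [(X0,K4),(X1,M2),(X2,P34),(X3,P16),(X4,P33),(X5,P14)] P35 vs6 [X0,X0,X3,X3,X2,X1]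
  (B X2 (B X0 (C X2) (C X1)) (B X3 (C X0) (C X3))) X6 X7 (S X6 X2 (S X6 X0 (S X6 X1 (L X0
  [X2,X1,X0,X6]) F) F) (S X6 X3 (S X6 X0 (S X6 X1 (S X6 X4 (L X0 [X4,X1,X0,X6]) (S X6 X5 (L X0
  [X5,X1,X0,X6]) F)) (L X1 [X2,X1,X3,X6])) (L X1 [X2,X0,X3,X6])) F)) (S X7 X2 (S X6 X2 (S X7 X0 (S
  X6 X0 (L X0 [X2,X0,X7,X6]) F) (S X6 X0 F (S X7 X1 (S X6 X1 (L X0 [X2,X1,X7,X6]) (S X6 X3 (L X1
  [X1,X0,X3,X6]) (S X6 X4 (L X2 [X4,X6,X3,X1,X0,X2]) (L X1 [X4,X3,X2,X6])))) (S X7 X3 (L X1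
  [X1,X0,X3,X7]) (S X7 X5 (L X2 [X5,X7,X3,X1,X0,X2]) (L X1 [X5,X3,X2,X7])))))) (S X7 X0 (S X6 X3 F
  F) (S X6 X3 F F))) (S X7 X3 (S X6 X2 (S X6 X0 F F) (S X6 X3 (S X6 X0 (S X7 X1 (S X7 X0 (S X6 X1
  (L X0 [X1,X0,X7,X6]) (L X1 [X2,X1,X3,X6])) (L X1 [X2,X0,X3,X7])) (L X1 [X2,X1,X3,X7])) (L X1
  [X2,X0,X3,X6])) F)) (S X6 X2 (S X6 X0 F F) (S X6 X3 F (S X6 X1 (S X6 X0 (L X3 [X2,X3,X6,X1,X0])
  (S X7 X0 (S X7 X1 (L X3 [X0,X3,X6,X1,X7]) (L X4 [X7,X6,X3,X2,X0,X1])) (L X1 [X2,X0,X7,X6]))) (S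
  X6 X0 (S X7 X1 (S X7 X0 (L X3 [X1,X3,X6,X0,X7]) (L X4 [X7,X6,X3,X2,X1,X0])) (L X1
  [X2,X1,X7,X6])) (L X5 [X3,X6,X2,X1,X0])))))))"
  by code_simp

text \<open>The 4-wheel with hub \<open>X0\<close>, and a further vertex adjacent to exactly two
  consecutive rim vertices.\<close>

definition "P36 = [[Y,Y,Y,N,Y],[Y,N,Y,Y],[N,N,N],[Y,Y],[Y],[]]"

lemma cert_P36: "coloring_cert [(X0,K4),(X1,P35),(X2,P16),(X3,M2),(X4,P34),(X5,P14)] P36 vs6 [X3,X1,X0,X1,X0,X2]
  (B X0 (C X0) (B X5 (C X2) (C X3))) X6 X7 (S X6 X0 (S X6 X1 (S X6 X2 (L X0 [X2,X1,X0,X6]) (S X6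
  X3 (S X6 X4 (L X0 [X4,X1,X0,X6]) (L X1 [X4,X6,X3,X2,X1,X0])) (L X2 [X2,X3,X6,X1,X0]))) (S X6 X3
  (S X6 X2 (S X6 X5 (L X0 [X5,X2,X0,X6]) (L X1 [X5,X6,X3,X1,X2,X0])) (L X3 [X2,X1,X3,X6])) F)) (S
  X6 X5 F F)) (S X6 X0 (S X7 X0 (S X7 X2 (S X7 X1 (L X0 [X2,X1,X0,X7]) (S X7 X5 (L X0
  [X5,X2,X0,X7]) (S X7 X3 (L X1 [X5,X7,X3,X1,X2,X0]) (L X2 [X1,X3,X7,X2,X0])))) (S X7 X1 (S X7 X3
  (S X7 X4 (L X0 [X4,X1,X0,X7]) (L X1 [X4,X7,X3,X2,X1,X0])) (L X2 [X2,X3,X7,X1,X0])) (S X6 X2 (S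
  X6 X1 (L X0 [X2,X1,X0,X6]) (S X6 X3 (S X6 X5 (L X0 [X5,X2,X0,X6]) (L X1 [X5,X6,X3,X1,X2,X0])) (L
  X2 [X1,X3,X6,X2,X0]))) (S X6 X1 (S X6 X3 (S X6 X4 (L X0 [X4,X1,X0,X6]) (L X1
  [X4,X6,X3,X2,X1,X0])) (L X2 [X2,X3,X6,X1,X0])) (L X3 [X2,X1,X7,X6]))))) (S X7 X5 F F)) (S X7 X0
  (S X6 X5 F F) (S X7 X5 (S X6 X5 (S X7 X2 (S X6 X2 (L X0 [X5,X2,X7,X6]) (S X6 X3 (L X3
  [X2,X0,X3,X6]) (S X6 X1 (L X4 [X5,X6,X3,X2,X0,X1]) (L X5 [X3,X6,X2,X1,X0])))) (S X7 X3 (L X3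
  [X2,X0,X3,X7]) (S X7 X1 (L X4 [X5,X7,X3,X2,X0,X1]) (L X5 [X3,X7,X2,X1,X0])))) F) (S X6 X5 F (L
  X3 [X5,X0,X7,X6])))))"
  by code_simp

definition "P37 = [[Y,Y,Y,Y,Y],[Y,N,N,Y],[Y,N,N],[Y,N],[Y],[]]"

lemma cert_P37: "coloring_cert [(X0,K4),(X1,P36),(X2,M2),(X3,P16),(X4,P34),(X5,P35)] P37 vs6 [X2,X1,X0,X1,X0,X3]
  (B X2 (B X5 (C X0) (B X0 (C X2) (C X3))) (B X4 (C X3) (B X3 (C X1) (C X0)))) X6 X7 (S X6 X2 (S
  X6 X5 (S X6 X1 (L X0 [X5,X2,X1,X6]) (S X6 X3 (L X0 [X5,X3,X2,X6]) F)) (S X6 X0 F F)) (S X6 X4 (S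
  X6 X0 (S X6 X1 (S X6 X5 (L X0 [X5,X1,X0,X6]) (L X1 [X5,X1,X2,X4,X6,X0])) (L X2 [X2,X1,X4,X6]))
  F) (S X6 X3 F (S X6 X1 (L X2 [X4,X3,X1,X6]) F)))) (S X7 X2 (S X7 X5 (S X6 X2 (S X6 X5 (L X0
  [X5,X2,X7,X6]) (S X6 X0 F F)) (S X6 X4 F (S X6 X3 F (S X6 X0 (L X2 [X3,X2,X0,X6]) (S X6 X1 (L X2
  [X4,X3,X1,X6]) (S X6 X5 (S X7 X1 (L X0 [X5,X2,X1,X7]) (S X7 X0 (S X7 X3 (L X0 [X5,X3,X2,X7]) (S
  X7 X4 (L X0 [X5,X4,X0,X7]) (L X2 [X4,X3,X7,X6]))) (L X2 [X1,X0,X7,X6]))) (L X3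
  [X4,X6,X1,X5,X0]))))))) (S X7 X0 (S X6 X2 (S X6 X5 F (S X6 X0 (S X7 X1 (S X7 X4 (S X7 X3 (S X6
  X4 (L X0 [X4,X0,X7,X6]) (S X6 X3 (L X0 [X3,X2,X7,X6]) (L X1 [X2,X7,X6,X5,X4,X3]))) (L X1
  [X5,X4,X3,X1,X7,X0])) (L X1 [X5,X0,X4,X2,X7,X1])) (S X6 X1 (S X6 X4 (S X6 X3 (S X7 X4 (L X0
  [X4,X0,X7,X6]) (S X7 X3 (L X0 [X3,X2,X7,X6]) (L X4 [X6,X1,X7,X4,X3,X5]))) (L X1
  [X5,X4,X3,X1,X6,X0])) (L X1 [X5,X0,X4,X2,X6,X1])) (L X2 [X5,X1,X7,X6]))) F)) (S X6 X4 F (S X6 X3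
  F F))) (S X6 X2 (S X6 X5 F (S X6 X0 F (L X2 [X5,X0,X7,X6]))) (S X6 X4 (S X7 X4 (S X7 X3 (L X1
  [X5,X4,X0,X2,X7,X3]) (S X6 X1 (S X6 X5 (S X6 X0 (L X0 [X5,X1,X0,X6]) (S X7 X1 (S X6 X3 (L X0
  [X5,X4,X3,X6]) (L X4 [X4,X0,X3,X7,X6,X1])) (L X5 [X2,X6,X7,X0,X5,X1]))) (S X6 X0 (L X1
  [X5,X1,X2,X4,X6,X0]) (L X2 [X5,X0,X7,X6]))) (L X2 [X2,X1,X4,X6]))) (L X2 [X4,X0,X2,X7])) (S X6
  X3 F F))))) (S X7 X4 (S X6 X2 (S X6 X5 F (S X6 X0 F (S X6 X4 (S X7 X1 (S X7 X0 (S X7 X5 (L X0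
  [X5,X1,X0,X7]) (L X1 [X5,X1,X2,X4,X7,X0])) (S X7 X5 (S X6 X1 (S X7 X3 (L X0 [X5,X4,X3,X7]) (S X6
  X3 (L X4 [X5,X7,X0,X3,X2,X6]) (L X4 [X4,X0,X3,X7,X6,X1]))) (L X5 [X2,X7,X6,X0,X5,X1])) (L X2
  [X5,X0,X7,X6]))) (L X2 [X2,X1,X4,X7])) (L X2 [X4,X0,X2,X6])))) (S X6 X4 (S X7 X0 (S X6 X0 (L X0
  [X4,X0,X7,X6]) (L X3 [X0,X2,X6,X4,X7])) (S X6 X0 (L X3 [X0,X2,X7,X4,X6]) (S X7 X1 (S X6 X1 (L X4
  [X1,X0,X2,X7,X6,X4]) (L X2 [X2,X1,X4,X6])) (L X2 [X2,X1,X4,X7])))) (S X6 X3 F F))) (S X6 X2 (S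
  X7 X3 (S X6 X5 F (S X6 X0 F F)) (S X6 X5 (S X7 X0 (L X2 [X3,X2,X0,X7]) (S X7 X1 (L X2
  [X4,X3,X1,X7]) (S X7 X5 (S X6 X3 (L X0 [X5,X3,X2,X6]) (S X6 X4 (S X6 X1 (L X0 [X5,X2,X1,X6]) (S
  X6 X0 (L X0 [X5,X4,X0,X6]) (L X2 [X1,X0,X7,X6]))) (L X2 [X4,X3,X7,X6]))) (L X3
  [X4,X7,X1,X5,X0])))) (S X6 X0 F F))) (S X7 X3 (S X6 X4 F (S X6 X3 (S X6 X5 (S X7 X5 (L X0
  [X5,X3,X7,X6]) (S X6 X1 (S X7 X1 (L X4 [X3,X2,X4,X7,X6,X1]) (L X1 [X3,X6,X7,X2,X1,X5])) (S X6 X0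
  (S X7 X0 (L X4 [X3,X4,X2,X7,X6,X0]) (L X1 [X3,X6,X7,X4,X0,X5])) (L X2 [X1,X0,X3,X6])))) (S X7 X5
  (S X6 X1 (S X7 X1 (L X4 [X3,X2,X4,X7,X6,X1]) (S X7 X0 (S X6 X0 (L X4 [X3,X4,X2,X7,X6,X0]) (L X5
  [X1,X7,X6,X4,X5,X0])) (L X2 [X1,X0,X3,X7]))) (S X7 X1 (L X1 [X3,X7,X6,X2,X1,X5]) (L X2
  [X2,X1,X7,X6]))) (L X2 [X5,X2,X7,X6]))) F)) (S X6 X4 F (S X6 X3 F (L X2 [X3,X2,X7,X6])))))))"
  by code_simp

definition "P38 = [[N,N,N],[Y,Y],[Y],[]]"

lemma cert_P38: "coloring_cert [(X0,K4),(X1,P16),(X2,P36),(X3,M2),(X4,P33)] P38 vs4 [X0,X1,X3,X0] (B X3 (B X2 (C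
  X2) (C X1)) (B X0 (C X3) (C X0))) X4 X5 (S X4 X3 (S X4 X2 F F) (S X4 X0 (S X4 X1 (S X4 X2 (L X0
  [X2,X1,X0,X4]) (L X1 [X2,X3,X4,X1,X0])) F) F)) (S X4 X3 (S X4 X2 (S X5 X3 (S X5 X2 (S X4 X0 (S
  X5 X0 (L X0 [X2,X0,X5,X4]) (S X5 X1 (S X4 X1 (L X0 [X2,X1,X5,X4]) (L X2 [X5,X4,X3,X1,X0,X2])) (L
  X3 [X1,X0,X3,X5]))) (S X4 X1 (S X5 X1 (L X0 [X2,X1,X5,X4]) (S X5 X0 (L X2 [X5,X4,X3,X0,X1,X2])
  (L X3 [X1,X0,X3,X5]))) (L X3 [X1,X0,X3,X4]))) F) (S X5 X0 F F)) (S X5 X3 (S X5 X2 F (S X4 X1 (S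
  X5 X0 (S X4 X0 (S X5 X1 (L X0 [X1,X0,X5,X4]) (L X3 [X2,X1,X3,X5])) (L X3 [X2,X0,X3,X4])) (L X3
  [X2,X0,X3,X5])) (L X3 [X2,X1,X3,X4]))) (S X5 X0 F F))) (S X5 X3 (S X5 X2 (S X4 X0 F F) (S X4 X0
  F F)) (S X4 X0 (S X5 X0 (S X4 X1 (S X5 X1 (L X0 [X1,X0,X5,X4]) (L X1 [X1,X3,X5,X0,X4])) (S X5 X1
  (L X1 [X1,X3,X4,X0,X5]) (S X4 X2 (L X1 [X1,X3,X4,X2,X0]) (S X5 X2 (L X1 [X2,X3,X4,X0,X5]) (L X3
  [X2,X1,X5,X4]))))) F) (S X5 X0 F (S X4 X2 (S X4 X1 (L X1 [X0,X3,X4,X2,X1]) (S X5 X1 (S X5 X2 (L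
  X1 [X1,X3,X4,X2,X5]) (L X4 [X5,X4,X3,X0,X1,X2])) (L X3 [X1,X0,X5,X4]))) (S X5 X2 (S X5 X1 (L X1
  [X0,X3,X5,X2,X1]) (S X4 X1 (L X4 [X5,X4,X3,X0,X2,X1]) (L X3 [X1,X0,X5,X4]))) (L X3
  [X2,X0,X5,X4])))))))"
  by code_simp

definition "P39 = [[N,N,N,N,N],[Y,N,N,Y],[Y,N,N],[Y,N],[Y],[]]"

lemma cert_P39: "coloring_cert [(X0,P38),(X1,M2),(X2,K4),(X3,P37),(X4,P35),(X5,P34)] P39 vs6 [X3,X3,X0,X2,X3,X2]
  (B X3 (B X0 (C X1) (C X2)) (B X4 (B X2 (C X0) (C X2)) (C X3))) X6 X7 (S X6 X3 (S X6 X0 F (S X6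
  X2 (L X0 [X0,X3,X2,X6]) F)) (S X6 X4 (S X6 X2 F (S X6 X0 (L X1 [X3,X2,X0,X6]) F)) (S X6 X1 (L X1
  [X4,X3,X1,X6]) (S X6 X5 (L X1 [X4,X3,X5,X6]) F)))) (S X7 X3 (S X7 X0 (S X6 X3 (S X6 X0 (S X7 X1
  (S X6 X1 (L X2 [X1,X0,X7,X6]) (S X7 X2 (S X7 X4 (L X3 [X7,X4,X3,X2,X1,X0]) (L X0 [X4,X2,X1,X7]))
  (S X6 X2 (S X7 X4 (L X0 [X2,X4,X0,X7]) (S X6 X5 (S X6 X4 (L X4 [X2,X7,X1,X4,X3,X6]) (S X7 X5 (L
  X0 [X4,X5,X7,X6]) (L X5 [X6,X2,X5,X0,X7,X1]))) (L X0 [X5,X3,X2,X6]))) (L X0 [X2,X0,X7,X6])))) (S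
  X6 X1 (S X6 X2 (S X6 X4 (L X3 [X6,X4,X3,X2,X1,X0]) (L X0 [X4,X2,X1,X6])) (S X7 X2 (S X7 X4 (L X0
  [X1,X4,X3,X7]) (S X6 X5 (S X6 X4 (L X4 [X1,X7,X2,X4,X0,X6]) (S X7 X5 (L X0 [X4,X5,X7,X6]) (L X5
  [X6,X1,X5,X3,X7,X2]))) (L X0 [X5,X1,X0,X6]))) (L X0 [X2,X0,X7,X6]))) (L X0 [X1,X3,X7,X6]))) F)
  (S X6 X4 (S X6 X2 F F) F)) (S X6 X3 (S X6 X0 F (L X0 [X0,X3,X7,X6])) (S X6 X4 (S X6 X2 F (S X7
  X2 (L X0 [X0,X3,X2,X7]) (S X6 X1 (S X6 X5 (L X1 [X3,X2,X5,X6]) (S X7 X4 (L X0 [X2,X4,X7,X6]) (S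
  X7 X5 (L X1 [X4,X0,X5,X7]) (S X7 X1 (L X0 [X5,X1,X7,X6]) (L X1 [X1,X0,X3,X7]))))) (L X1
  [X2,X1,X4,X6])))) F))) (S X7 X4 (S X7 X2 (S X6 X3 (S X6 X0 F F) (S X6 X4 (S X6 X2 (S X6 X5 (S X7
  X5 (L X0 [X3,X5,X7,X6]) (S X7 X0 (L X0 [X5,X4,X0,X7]) (S X7 X1 (L X0 [X5,X2,X1,X7]) (S X6 X1 (S
  X6 X0 (L X3 [X6,X4,X0,X1,X2,X7]) (L X0 [X0,X2,X7,X6])) (L X0 [X1,X4,X7,X6]))))) (S X6 X0 (L X0
  [X5,X4,X0,X6]) (S X7 X0 (S X6 X1 (L X0 [X5,X2,X1,X6]) (S X7 X1 (L X3 [X7,X4,X0,X1,X2,X6]) (L X0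
  [X1,X4,X7,X6]))) (L X0 [X0,X2,X7,X6])))) F) F)) (S X6 X3 (S X6 X0 F (S X6 X2 (L X0
  [X0,X3,X2,X6]) (S X7 X5 (L X1 [X3,X2,X5,X7]) (S X7 X1 (S X6 X4 (L X0 [X2,X4,X7,X6]) (S X6 X5 (L
  X1 [X4,X0,X5,X6]) (S X6 X1 (L X0 [X5,X1,X7,X6]) (L X1 [X1,X0,X3,X6])))) (L X1 [X2,X1,X4,X7])))))
  (S X6 X4 (S X6 X2 F (L X1 [X3,X2,X7,X6])) F))) (S X6 X3 (S X6 X0 F F) (S X6 X4 (S X6 X2 F F) (L
  X1 [X4,X3,X7,X6])))))"
  by code_simp

section \<open>Patterns for \<open>(3K2, K3)\<close>-free graphs\<close>

definition "R0 = [[N,N,Y,N,N,Y,N,N,N],[Y,N,Y,N,N,Y,N,Y],[N,N,N,N,N,N,N],[Y,N,N,N,N,N],[N,N,N,N,N],[Y,N,N,Y],[Y,N,N],[Y,N],[Y],[]]"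

text \<open>\<open>R0\<close> to \<open>R7\<close> all extend \<open>R8\<close> by a tenth vertex
  \<open>X9\<close>; it is always adjacent to \<open>X6\<close>, and never to \<open>X4\<close>,
  \<open>X5\<close> or \<open>X8\<close>. They differ in its adjacency to \<open>X7\<close> and to
  the rest of the 5-cycle.\<close>

lemma cert_R0: "coloring_cert [(X0,K3),(X1,M3)] R0 vs10 [X3,X2,X3,X1,X0,X3,X2,X1,X3,X1] (B X6 (C X0) (B X7 (C
  X2) (B X8 (C X1) (B X9 (B X2 (C X2) (B X5 (C X2) (C X1))) (C X3))))) XA XB (S XA X6 (S XA X5
  (L X0 [X6,X5,XA]) F) (S XA X7 (S XA X3 (S XA X2 (L X0 [X3,X2,XA]) (S XA X4 (L X0
  [X4,X3,XA]) (S XA X9 (L X0 [X9,X3,XA]) (S XA X0 (S XA X1 (L X0 [X1,X0,XA]) (L X1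
  [X9,X6,X2,X1,X7,XA])) (L X1 [X9,X6,X4,X0,X7,XA]))))) (S XA X8 (L X0 [X8,X7,XA]) F)) (S XA
  X8 (S XA X0 (L X0 [X8,X0,XA]) (S XA X2 (L X0 [X8,X2,XA]) F)) (S XA X9 (S XA X3 (L X0
  [X9,X3,XA]) (S XA X2 F (S XA X5 F (S XA X0 (L X1 [X6,X5,X3,X2,X0,XA]) F)))) (S XA X1 (L X1
  [X8,X7,X9,X6,X1,XA]) (S XA X4 (L X1 [X8,X7,X9,X6,X4,XA]) F)))))) (S XA X6 (S XB X6 (L X0
  [X6,XB,XA]) (S XA X9 (L X0 [X9,X6,XA]) (S XA X5 (L X0 [X6,X5,XA]) (S XB X7 F (S XB X8 F
  (S XB X9 (S XB X3 (L X0 [X9,X3,XB]) (S XB X2 F (S XB X5 F F))) F)))))) (S XB X6 (S XB X9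
  (L X0 [X9,X6,XB]) (S XA X7 F (S XA X8 F (S XA X9 (S XA X3 (L X0 [X9,X3,XA]) (S XB X5 (L
  X0 [X6,X5,XB]) (S XA X2 F (S XA X5 F F)))) F)))) (S XB X7 (S XA X7 (L X0 [X7,XB,XA]) (S
  XB X8 (L X0 [X8,X7,XB]) (S XA X8 F (S XA X9 (S XA X3 (L X0 [X9,X3,XA]) (S XB X9 (L X0
  [X9,XB,XA]) (S XB X2 (S XA X2 (L X0 [X2,XB,XA]) (S XB X1 (L X0 [X2,X1,XB]) (S XB X0 (S
  XA X0 (L X0 [X0,XB,XA]) (S XB X4 (L X0 [X4,X0,XB]) (S XB X3 (L X0 [X3,X2,XB]) (S XB X5
  (S XA X5 (L X0 [X5,XB,XA]) F) (L X1 [X6,X5,X4,X3,X7,XB]))))) (L X1 [X9,X6,X1,X0,X7,XB]))))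
  (S XB X4 (L X1 [X9,X6,X8,X2,X4,XB]) (S XB X1 (S XB X0 (L X0 [X1,X0,XB]) (L X1
  [X9,X6,X4,X0,X7,XB])) (L X1 [X9,X6,X2,X1,X7,XB])))))) F)))) (S XB X8 (S XA X8 (L X0
  [X8,XB,XA]) (S XB X2 (L X0 [X8,X2,XB]) (S XB X0 (L X0 [X8,X0,XB]) (S XB X5 (L X0
  [X8,X5,XB]) (S XA X7 F (S XA X9 (S XA X3 (L X0 [X9,X3,XA]) (S XB X9 (L X0 [X9,XB,XA]) (S
  XA X2 F (S XA X5 F (S XB X3 (S XB X1 (S XA X1 (L X0 [X1,XB,XA]) (S XA X4 (L X1
  [X6,X5,X2,X1,X4,XA]) (S XA X0 (L X1 [X6,X5,X3,X2,X0,XA]) (S XB X4 (L X0 [X4,X3,XB]) (L X1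
  [X6,X5,X4,X0,XB,XA]))))) (L X1 [X6,X5,X1,X0,X3,XB])) (L X1 [X6,X5,X3,X2,XB,XA]))))))
  F)))))) (S XB X9 (S XB X3 (L X0 [X9,X3,XB]) (S XA X9 (L X0 [X9,XB,XA]) (S XA X7 (S XA X8
  (L X0 [X8,X7,XA]) (S XA X1 (S XA X0 (L X0 [X1,X0,XA]) (S XA X4 (S XA X2 (L X0 [X2,X1,XA])
  (L X1 [X9,X6,X8,X2,X4,XA])) (L X1 [X9,X6,X4,X0,X7,XA]))) (S XA X0 (S XA X2 (S XB X2 (L X0
  [X2,XB,XA]) (S XB X0 (L X0 [X0,XB,XA]) (S XA X4 (L X0 [X4,X0,XA]) (S XA X3 (L X0
  [X3,X2,XA]) (S XA X5 (S XB X5 (L X0 [X5,XB,XA]) F) (L X1 [X6,X5,X4,X3,X7,XA])))))) (L X1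
  [X9,X6,X2,X1,X7,XA])) (L X1 [X9,X6,X1,X0,X7,XA])))) (S XA X8 (S XA X0 (L X0 [X8,X0,XA]) (S
  XA X2 (L X0 [X8,X2,XA]) (S XA X5 (L X0 [X8,X5,XA]) (S XB X2 F (S XB X5 F (S XA X3 (S XA
  X1 (S XB X1 (L X0 [X1,XB,XA]) (S XB X4 (L X1 [X6,X5,X2,X1,X4,XB]) (S XA X4 (L X0
  [X4,X3,XA]) (S XB X0 (L X1 [X6,X5,X3,X2,X0,XB]) (L X1 [X6,X5,X4,X0,XB,XA]))))) (L X1
  [X6,X5,X1,X0,X3,XA])) (L X1 [X6,X5,X3,X2,XB,XA]))))))) (S XA X4 (L X1 [X8,X7,X9,X6,X4,XA])
  (S XA X1 (L X1 [X8,X7,X9,X6,X1,XA]) (S XB X2 F (S XB X5 F F)))))))) (S XB X1 (L X1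
  [X8,X7,X9,X6,X1,XB]) (S XB X4 (L X1 [X8,X7,X9,X6,X4,XB]) (S XA X7 F (S XA X8 F (S XA X9 (S
  XA X3 (L X0 [X9,X3,XA]) (S XA X2 F (S XA X5 F F))) (L X1 [X8,X7,X9,X6,XB,XA])))))))))))"
  by code_simp

definition "R1 = [[N,N,Y,N,N,Y,N,Y,N],[Y,N,Y,N,N,Y,N,Y],[N,N,N,N,N,N,N],[Y,N,N,N,N,N],[N,N,N,N,N],[Y,N,N,Y],[Y,N,N],[Y,N],[Y],[]]"

lemma cert_R1: "coloring_cert [(X0,K3),(X1,M3),(X2,R0)] R1 vs10 [X1,X2,X0,X2,X3,X1,X2,X1,X2,X0] (B X3 (B X1 (C
  X1) (B X6 (B X8 (C X1) (C X3)) (C X1))) (B X5 (C X2) (B X6 (C X3) (B X0 (C X2) (C X0))))) XA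
  XB (S XA X3 (S XA X2 (L X0 [X3,X2,XA]) (S XA X4 (L X0 [X4,X3,XA]) (S XA X9 (L X0
  [X9,X3,XA]) (S XA X1 F (S XA X6 (S XA X5 (L X0 [X6,X5,XA]) (S XA X8 F F)) F))))) (S XA X6
  (S XA X5 (L X0 [X6,X5,XA]) F) (S XA X8 (S XA X0 (L X0 [X8,X0,XA]) (S XA X5 (L X0
  [X8,X5,XA]) (S XA X7 (L X0 [X8,X7,XA]) F))) (S XA X1 (S XA X0 (L X0 [X1,X0,XA]) (S XA X2
  (L X0 [X2,X1,XA]) (S XA X9 (L X0 [X9,X1,XA]) (S XA X4 (L X1 [X9,X6,X8,X2,X4,XA]) (S XA X7
  (L X1 [X9,X6,X4,X0,X7,XA]) (L X1 [X8,X7,X4,X3,X1,XA])))))) (S XA X5 F (S XA X0 F (S XA X7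
  (L X1 [X6,X5,X1,X0,X7,XA]) F))))))) (S XA X3 (S XB X3 (L X0 [X3,XB,XA]) (S XA X1 (S XB X5
  F (S XB X6 F (S XB X0 F F))) (S XB X5 (S XA X6 (S XA X8 F F) F) (S XB X6 (S XA X6 (L X0
  [X6,XB,XA]) F) (S XB X0 (S XA X6 (S XA X8 F F) F) (S XA X6 (S XA X8 F F) F)))))) (S XA
  X5 (S XB X3 (S XB X1 F (S XB X6 (S XB X8 F F) F)) (S XB X5 (L X0 [X5,XB,XA]) (S XB X6 F
  (S XB X0 (S XB X2 (S XB X1 (L X0 [X1,X0,XB]) (S XB X8 (L X0 [X8,X0,XB]) (S XB X4 (L X0
  [X4,X0,XB]) (S XB X7 (L X1 [X6,X5,X4,X3,X7,XB]) (S XA X0 (L X0 [X0,XB,XA]) (S XB X9 (S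
  XA X2 (L X0 [X2,XB,XA]) (S XA X9 (L X0 [X9,XB,XA]) (S XA X6 (L X0 [X6,X5,XA]) (S XA X8
  (L X0 [X8,X5,XA]) (S XA X4 (L X1 [X9,X6,X8,X2,X4,XA]) (S XA X7 (L X1 [X9,X6,X4,X0,X7,XA])
  (L X1 [X8,X7,X4,X3,XB,XA]))))))) (L X2 [X9,X8,X7,X6,X5,X4,X3,X2,XB,X0]))))))) (L X1
  [X6,X5,X3,X2,X0,XB])) F)))) (S XB X3 (S XA X6 (S XB X1 F (S XB X6 (L X0 [X6,XB,XA]) F))
  (S XA X0 (S XB X1 F (S XB X6 (S XB X8 F F) F)) (S XB X1 F (S XB X6 (S XB X8 F F) F)))) (S
  XA X6 (S XB X5 F (S XB X6 (L X0 [X6,XB,XA]) (S XB X0 F F))) (S XA X0 (S XB X5 (S XA X2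
  (S XA X8 (L X0 [X8,X0,XA]) (S XA X1 (L X0 [X1,X0,XA]) (S XA X4 (L X0 [X4,X0,XA]) (S XA X7
  (L X1 [X6,X5,X4,X3,X7,XA]) (S XA X9 (S XB X0 (L X0 [X0,XB,XA]) (S XB X8 (L X0 [X8,X5,XB])
  (S XB X6 (L X0 [X6,X5,XB]) (S XB X9 (L X0 [X9,XB,XA]) (S XB X2 (L X0 [X2,XB,XA]) (S XB
  X4 (L X1 [X9,X6,X8,X2,X4,XB]) (S XB X7 (L X1 [X9,X6,X4,X0,X7,XB]) (L X1
  [X8,X7,X4,X3,XB,XA])))))))) (L X2 [X9,X8,X7,X6,X5,X4,X3,X2,XA,X0])))))) (L X1
  [X6,X5,X3,X2,X0,XA])) (S XB X6 F (S XB X0 (L X0 [X0,XB,XA]) F))) (S XB X5 F (S XB X6 F (S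
  XB X0 F (S XA X1 (S XA X2 (L X0 [X2,X1,XA]) (S XA X4 (S XB X4 (L X0 [X4,XB,XA]) (S XB
  X2 (L X1 [X6,X5,X4,X0,X2,XB]) (L X1 [X6,X5,X3,X2,XB,XA]))) (L X1 [X6,X5,X4,X3,X1,XA]))) (S
  XB X1 (S XB X2 (L X0 [X2,X1,XB]) (S XB X4 (S XA X4 (L X0 [X4,XB,XA]) (S XA X2 (L X1
  [X6,X5,X4,X0,X2,XA]) (L X1 [X6,X5,X3,X2,XB,XA]))) (L X1 [X6,X5,X4,X3,X1,XB]))) (L X1
  [X6,X5,X1,X0,XB,XA])))))))))))"
  by code_simp

definition "R2 = [[N,Y,Y,N,N,N,N,N,N],[Y,N,Y,N,N,Y,N,Y],[N,N,N,N,N,N,N],[Y,N,N,N,N,N],[N,N,N,N,N],[Y,N,N,Y],[Y,N,N],[Y,N],[Y],[]]"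

lemma cert_R2: "coloring_cert [(X0,K3),(X1,M3)] R2 vs10 [X2,X0,X1,X3,X2,X3,X1,X3,X0,X1] (B X6 (C X2) (B X7 (C
  X0) (B X3 (C X3) (B X4 (C X1) (B X8 (C X3) (C X0)))))) XA XB (S XA X6 (S XA X5 (L X0
  [X6,X5,XA]) (S XA X9 (L X0 [X9,X6,XA]) F)) (S XA X7 (S XA X8 (L X0 [X8,X7,XA]) (S XA X1
  (S XA X0 (L X0 [X1,X0,XA]) (S XA X2 (L X0 [X2,X1,XA]) (S XA X9 (L X0 [X9,X7,XA]) (S XA X3
  (L X1 [X9,X6,X8,X0,X3,XA]) (S XA X4 (L X1 [X9,X6,X8,X2,X4,XA]) (L X1
  [X9,X6,X4,X3,X1,XA])))))) F)) (S XA X3 (S XA X2 (L X0 [X3,X2,XA]) (S XA X4 (L X0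
  [X4,X3,XA]) F)) (S XA X4 (S XA X0 (L X0 [X4,X0,XA]) F) (S XA X8 (S XA X2 (L X0
  [X8,X2,XA]) F) (S XA X1 (L X1 [X8,X7,X4,X3,X1,XA]) F)))))) (S XA X6 (S XB X6 (L X0
  [X6,XB,XA]) (S XB X7 F (S XB X3 F (S XB X4 F (S XB X8 F F))))) (S XA X7 (S XB X6 F (S
  XB X7 (L X0 [X7,XB,XA]) (S XB X3 F (S XB X4 F (S XB X8 F (S XB X1 (L X1
  [X8,X7,X4,X3,X1,XB]) (S XA X8 (L X0 [X8,X7,XA]) (S XA X9 (L X0 [X9,X7,XA]) (S XA X2 (S XA
  X3 (L X0 [X3,X2,XA]) (S XA X1 (L X0 [X2,X1,XA]) (S XB X2 (L X0 [X2,XB,XA]) (S XB X5 (S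
  XB X9 (S XA X5 (L X0 [X5,XB,XA]) (S XA X0 (S XA X4 (L X0 [X4,X0,XA]) (L X1
  [X6,X5,X4,X3,X7,XA])) (L X1 [X6,X5,X1,X0,X7,XA]))) (L X1 [X9,X7,X2,X1,X5,XB])) (S XB X9 (L
  X1 [X8,X5,X4,X3,X9,XB]) (S XB X0 (L X1 [X6,X5,X3,X2,X0,XB]) (S XA X0 (S XA X4 (L X0
  [X4,X0,XA]) (L X1 [X9,X6,X4,X3,XB,XA])) (L X1 [X9,X6,X1,X0,XB,XA])))))))) (S XA X4 (L X1
  [X9,X6,X8,X2,X4,XA]) (S XA X3 (S XA X0 (S XA X1 (L X0 [X1,X0,XA]) (S XA X5 (S XB X5 (L X0
  [X5,XB,XA]) (S XB X9 (L X1 [X8,X5,X4,X3,X9,XB]) (S XB X2 (S XB X0 (L X0 [X0,XB,XA]) (L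
  X1 [X6,X5,X4,X0,X2,XB])) (L X1 [X9,X6,X2,X1,XB,XA])))) (L X1 [X6,X5,X2,X1,X7,XA]))) (L X1
  [X9,X6,X8,X0,X3,XA])) (S XA X5 (S XB X9 (S XB X5 (L X0 [X5,XB,XA]) (L X1
  [X8,X5,X4,X3,X9,XB])) (L X1 [X9,X6,X4,X3,XB,XA])) (L X1 [X6,X5,X3,X2,X7,XA]))))))))))))) (S
  XB X6 (S XA X3 F (S XA X4 F (S XA X8 F F))) (S XA X3 (S XB X7 F (S XB X3 (L X0
  [X3,XB,XA]) (S XB X4 F (S XB X8 (S XB X9 (S XB X5 (L X0 [X8,X5,XB]) (S XB X0 (L X0
  [X8,X0,XB]) (S XB X2 (L X0 [X8,X2,XB]) (S XA X8 (L X0 [X8,XB,XA]) (S XA X9 (L X0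
  [X9,XB,XA]) (S XA X0 (S XA X4 (L X0 [X4,X0,XA]) (S XA X1 (L X0 [X1,X0,XA]) (S XA X2 (L
  X0 [X3,X2,XA]) (S XB X1 (L X1 [X6,X5,X4,X3,X1,XB]) (S XA X5 (L X1 [X9,X7,X2,X1,X5,XA]) (L
  X1 [X6,X5,X2,X1,XB,XA])))))) (L X1 [X9,X6,X8,X0,X3,XA]))))))) (L X1 [X9,X6,X4,X3,X8,XB]))
  F)))) (S XA X4 (S XB X7 F (S XB X3 F (S XB X4 (L X0 [X4,XB,XA]) (S XB X8 F F)))) (S XA
  X8 (S XB X7 F (S XB X3 (S XA X5 (L X0 [X8,X5,XA]) (S XA X2 (L X0 [X8,X2,XA]) (S XA X0 (L
  X0 [X8,X0,XA]) (S XA X9 (S XB X9 (L X0 [X9,XB,XA]) (S XB X8 (L X0 [X8,XB,XA]) (S XB X0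
  (S XB X4 (L X0 [X4,X0,XB]) (S XA X1 (L X1 [X6,X5,X4,X3,X1,XA]) (S XB X2 (L X0 [X3,X2,XB])
  (S XB X1 (L X0 [X1,X0,XB]) (S XB X5 (L X1 [X9,X7,X2,X1,X5,XB]) (L X1
  [X6,X5,X2,X1,XB,XA])))))) (L X1 [X9,X6,X8,X0,X3,XB])))) (L X1 [X9,X6,X4,X3,X8,XA]))))) (S
  XB X4 F (S XB X8 (L X0 [X8,XB,XA]) F)))) (S XB X7 (S XA X1 (L X1 [X8,X7,X4,X3,X1,XA]) (S
  XB X8 (L X0 [X8,X7,XB]) (S XB X9 (L X0 [X9,X7,XB]) (S XA X5 (S XB X5 (L X0 [X5,XB,XA])
  (S XA X9 (S XB X0 (S XB X4 (L X0 [X4,X0,XB]) (S XB X3 (S XB X1 (L X0 [X1,X0,XB]) (S XB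
  X2 (L X0 [X3,X2,XB]) (L X1 [X6,X5,X2,X1,X7,XB]))) (L X1 [X6,X5,X4,X3,X7,XB]))) (S XB X3 (L
  X1 [X9,X6,X8,X0,X3,XB]) (S XB X2 (S XB X1 (L X0 [X2,X1,XB]) (L X1 [X6,X5,X1,X0,X7,XB])) (L
  X1 [X6,X5,X3,X2,X7,XB])))) (L X1 [X9,X7,X4,X3,X5,XA]))) (S XA X9 (L X1 [X8,X5,X4,X3,X9,XA])
  (S XA X0 (S XA X2 (S XB X2 (L X0 [X2,XB,XA]) (S XB X4 (L X1 [X9,X6,X8,X2,X4,XB]) (S XB
  X3 (S XB X0 (L X0 [X0,XB,XA]) (L X1 [X9,X6,X8,X0,X3,XB])) (L X1 [X9,X6,X4,X3,XB,XA])))) (L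
  X1 [X6,X5,X3,X2,X0,XA])) (S XA X2 (L X1 [X6,X5,X4,X0,X2,XA]) (S XB X2 (S XB X0 (S XB X3 (L
  X0 [X3,X2,XB]) (S XB X4 (L X0 [X4,X0,XB]) (L X1 [X9,X6,X4,X3,XB,XA]))) (L X1
  [X9,X6,X8,X0,XB,XA])) (L X1 [X9,X6,X8,X2,XB,XA]))))))))) (S XB X3 F (S XB X4 F (S XB X8 F
  (L X1 [X8,X7,X4,X3,XB,XA])))))))))))"
  by code_simp

definition "R3 = [[N,Y,Y,N,N,N,N,N,Y],[Y,N,Y,N,N,Y,N,Y],[N,N,N,N,N,N,N],[Y,N,N,N,N,N],[N,N,N,N,N],[Y,N,N,Y],[Y,N,N],[Y,N],[Y],[]]"

lemma cert_R3: "coloring_cert [(X0,K3),(X1,R2),(X2,M3)] R3 vs10 [X3,X3,X2,X2,X1,X0,X1,X0,X3,X2] (B X3 (B X8 (B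
  X9 (C X2) (C X0)) (C X0)) (B X9 (C X2) (B X2 (C X3) (C X1)))) XA XB (S XA X3 (S XA X2 (L X0
  [X3,X2,XA]) (S XA X4 (L X0 [X4,X3,XA]) (S XA X8 (S XA X0 (L X0 [X8,X0,XA]) (S XA X7 (L X0
  [X8,X7,XA]) (S XA X9 (S XA X6 (L X0 [X9,X6,XA]) F) F))) F))) (S XA X9 (S XA X0 (L X0
  [X9,X0,XA]) (S XA X6 (L X0 [X9,X6,XA]) (S XA X7 (L X0 [X9,X7,XA]) F))) (S XA X2 (S XA X1
  (L X0 [X2,X1,XA]) (S XA X8 (L X0 [X8,X2,XA]) F)) (S XA X5 (S XA X0 (S XA X1 (L X0
  [X1,X0,XA]) (S XA X4 (L X0 [X4,X0,XA]) (S XA X6 (L X0 [X6,X5,XA]) (S XA X7 (L X1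
  [X3,X0,X4,X2,X1,X5,X6,X9,X7,XA]) (L X2 [X9,X7,X2,X1,X5,XA]))))) (L X2 [X3,X2,X9,X0,X5,XA]))
  F)))) (S XB X3 (S XA X3 (L X0 [X3,XB,XA]) (S XB X8 (S XA X9 (S XB X9 (L X0 [X9,XB,XA])
  F) (S XA X2 (S XB X9 F F) (S XB X9 F F))) (S XA X9 F (S XA X2 F F)))) (S XB X9 (S XA X3
  (S XA X8 (S XA X9 (L X0 [X9,XB,XA]) F) F) (S XA X9 (L X0 [X9,XB,XA]) (S XA X2 F F))) (S
  XB X2 (S XA X3 (S XA X8 (S XA X9 F F) F) (S XA X9 F (S XA X2 (L X0 [X2,XB,XA]) F))) (S
  XA X3 (S XA X8 (S XA X9 F F) F) (S XA X9 F (S XA X2 F (S XA X0 (S XB X0 (L X0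
  [X0,XB,XA]) (S XA X4 (L X0 [X4,X0,XA]) (S XA X5 (S XA X7 (S XA X6 (L X0 [X6,X5,XA]) (S
  XA X1 (L X0 [X1,X0,XA]) (L X1 [X3,X0,X4,X2,X1,X5,X6,X9,X7,XA]))) (L X2 [X9,X7,X3,X2,X5,XA]))
  (S XA X6 (S XA X8 (L X0 [X8,X0,XA]) (S XA X7 (S XB X7 (L X0 [X7,XB,XA]) (S XB X5 (L X2
  [X3,X2,X9,X0,X5,XB]) (S XB X6 (L X0 [X6,XB,XA]) (S XB X4 (S XB X1 (S XB X8 (L X1
  [X9,X8,X7,X6,X5,X4,X3,X2,X1,XB]) (L X2 [X9,X6,X8,X2,X4,XB])) (L X2 [X6,X5,X2,X1,X4,XB])) (S
  XB X8 (L X2 [X9,X6,X4,X3,X8,XB]) (L X2 [X8,X5,X4,X3,XB,XA])))))) (L X2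
  [X8,X7,X4,X3,X6,XA]))) (L X2 [X6,X5,X3,X2,X0,XA]))))) (S XB X0 (S XB X4 (L X0 [X4,X0,XB])
  (S XB X6 (S XB X8 (L X0 [X8,X0,XB]) (S XB X5 (L X0 [X6,X5,XB]) (S XB X7 (S XA X7 (L X0
  [X7,XB,XA]) (S XA X5 (L X2 [X3,X2,X9,X0,X5,XA]) (S XA X6 (L X0 [X6,XB,XA]) (S XA X4 (S
  XA X1 (S XA X8 (L X1 [X9,X8,X7,X6,X5,X4,X3,X2,X1,XA]) (L X2 [X9,X6,X8,X2,X4,XA])) (L X2
  [X6,X5,X2,X1,X4,XA])) (S XA X8 (L X2 [X9,X6,X4,X3,X8,XA]) (L X2 [X8,X5,X4,X3,XB,XA]))))))
  (L X2 [X8,X7,X4,X3,X6,XB])))) (S XB X5 (S XB X7 (S XB X1 (L X0 [X1,X0,XB]) (L X1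
  [X3,X0,X4,X2,X1,X5,X6,X9,X7,XB])) (L X2 [X9,X7,X3,X2,X5,XB])) (L X2 [X6,X5,X3,X2,X0,XB]))))
  (L X2 [X3,X2,X9,X0,XB,XA])))))))))"
  by code_simp

definition "R4 = [[N,Y,Y,N,N,Y,N,N,N],[Y,N,Y,N,N,Y,N,Y],[N,N,N,N,N,N,N],[Y,N,N,N,N,N],[N,N,N,N,N],[Y,N,N,Y],[Y,N,N],[Y,N],[Y],[]]"

lemma cert_R4: "coloring_cert [(X0,K3),(X1,M3),(X2,R2),(X3,R3)] R4 vs10 [X2,X3,X1,X1,X0,X3,X1,X2,X3,X2] (B X0 (B
  X5 (B X2 (B X9 (C X1) (C X3)) (C X3)) (B X7 (C X0) (C X3))) (B X6 (C X0) (B X9 (C X1) (C X2))))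
  XA XB (S XA X0 (S XA X1 (L X0 [X1,X0,XA]) (S XA X4 (L X0 [X4,X0,XA]) (S XA X8 (L X0
  [X8,X0,XA]) (S XA X5 (S XA X2 (S XA X3 (L X0 [X3,X2,XA]) (S XA X6 (L X0 [X6,X5,XA]) (S
  XA X9 (S XA X7 (L X0 [X9,X7,XA]) F) F))) F) (S XA X7 F F))))) (S XA X6 (S XA X5 (L X0
  [X6,X5,XA]) F) (S XA X9 (S XA X3 (L X0 [X9,X3,XA]) (S XA X7 (L X0 [X9,X7,XA]) F)) (S XA
  X2 (S XA X1 (L X0 [X2,X1,XA]) (S XA X3 (L X0 [X3,X2,XA]) (S XA X4 (S XA X5 (L X1
  [X9,X3,X1,X0,X5,XA]) (S XA X7 (L X1 [X6,X5,X1,X0,X7,XA]) (S XA X8 (L X0 [X8,X2,XA]) (L X2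
  [X9,X8,X7,X6,X5,X4,XA,X2,X1,X0])))) (L X1 [X9,X6,X4,X0,X2,XA])))) F)))) (S XA X0 (S XB X0 (L
  X0 [X0,XB,XA]) (S XB X6 (S XA X5 (S XA X2 (S XA X9 F F) F) (S XA X7 (S XA X8 (L X0
  [X8,X0,XA]) (S XA X1 (L X0 [X1,X0,XA]) (S XA X6 (L X0 [X6,XB,XA]) (S XA X2 (S XA X3 (L
  X0 [X3,X2,XA]) (S XA X4 (L X0 [X4,X0,XA]) (L X1 [X6,X5,X4,X3,X7,XA]))) (L X1
  [X6,X5,X2,X1,X7,XA]))))) F)) (S XA X5 (S XA X2 (S XB X9 (S XA X9 (L X0 [X9,XB,XA]) F) (S
  XA X9 F F)) (S XB X9 F F)) (S XA X7 (S XB X9 F F) (S XB X9 F F))))) (S XB X0 (S XA X6 (S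
  XB X5 (S XB X2 (S XB X9 F F) F) (S XB X7 (S XB X8 (L X0 [X8,X0,XB]) (S XB X6 (L X0
  [X6,XB,XA]) (S XB X4 (L X0 [X4,X0,XB]) (S XB X3 (S XB X9 (L X0 [X9,X3,XB]) (S XB X2 (L
  X0 [X3,X2,XB]) (S XB X1 (L X0 [X1,X0,XB]) (L X1 [X6,X5,X2,X1,X7,XB])))) (L X1
  [X6,X5,X4,X3,X7,XB]))))) F)) (S XB X5 (S XB X2 (S XA X9 (S XB X9 (L X0 [X9,XB,XA]) F) (S
  XB X9 F F)) (S XA X9 F F)) (S XB X7 (S XA X9 F F) (S XA X9 F F)))) (S XA X6 (S XB X6 (L
  X0 [X6,XB,XA]) (S XB X9 F F)) (S XB X6 (S XA X9 F F) (S XB X9 (S XA X9 (L X0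
  [X9,XB,XA]) F) (S XA X9 F (S XA X4 (S XB X4 (L X0 [X4,XB,XA]) (S XA X3 (L X0
  [X4,X3,XA]) (S XB X2 (L X1 [X9,X6,X4,X0,X2,XB]) (S XA X8 (S XA X2 (L X0 [X8,X2,XA]) (S XA
  X5 (L X0 [X8,X5,XA]) (S XA X7 (L X0 [X8,X7,XA]) (S XA X1 (S XB X1 (L X0 [X1,XB,XA]) (S
  XB X5 (S XB X7 (S XB X3 (L X3 [X9,XB,X7,X6,X5,X2,X1,XA,X4,X3]) (L X1 [X9,X3,X1,X0,X5,XB]))
  (L X1 [X9,X7,X1,X0,X5,XB])) (S XB X3 (L X1 [X6,X5,X1,X0,X3,XB]) (L X1
  [X6,X5,X3,X2,XB,XA])))) (L X1 [X6,X5,X2,X1,X4,XA]))))) (S XA X2 (S XA X1 (L X0 [X2,X1,XA])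
  (S XA X5 (L X1 [X9,X3,X1,X0,X5,XA]) (S XA X7 (L X1 [X6,X5,X1,X0,X7,XA]) (L X2
  [X9,X8,X7,X6,X5,X4,XA,X2,X1,X0])))) (L X1 [X9,X6,X8,X2,X4,XA])))))) (S XB X4 (S XA X2 (L X1
  [X9,X6,X4,X0,X2,XA]) (S XB X3 (L X0 [X4,X3,XB]) (S XB X1 (S XB X2 (L X0 [X2,X1,XB]) (S XB
  X8 (S XB X5 (L X0 [X8,X5,XB]) (S XB X7 (L X0 [X8,X7,XB]) (S XA X1 (L X0 [X1,XB,XA]) (S
  XA X5 (S XA X7 (S XA X3 (L X3 [XB,X3,X4,X1,X2,X5,X6,X9,X7,XA]) (L X1 [X9,X3,X1,X0,X5,XA]))
  (L X1 [X9,X7,X1,X0,X5,XA])) (S XA X3 (L X1 [X6,X5,X1,X0,X3,XA]) (L X1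
  [X6,X5,X3,X2,XB,XA])))))) (L X1 [X9,X6,X8,X2,X4,XB]))) (S XB X5 (L X1 [X9,X3,X1,X0,X5,XB])
  (S XB X2 (S XB X7 (L X1 [X6,X5,X1,X0,X7,XB]) (S XB X8 (L X0 [X8,X2,XB]) (L X2
  [X9,X8,X7,X6,X5,X4,XB,X2,X1,X0]))) (L X1 [X6,X5,X2,X1,X4,XB])))))) (L X1
  [X9,X6,X4,X0,XB,XA])))))))))"
  by code_simp

definition "R5 = [[N,Y,Y,N,N,Y,N,N,Y],[Y,N,Y,N,N,Y,N,Y],[N,N,N,N,N,N,N],[Y,N,N,N,N,N],[N,N,N,N,N],[Y,N,N,Y],[Y,N,N],[Y,N],[Y],[]]"

lemma cert_R5: "coloring_cert [(X0,K3),(X1,M3),(X2,R4),(X3,R1),(X4,R0),(X5,R3),(X6,R2)] R5 vs10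
  [X3,X3,X1,X1,X0,X2,X1,X0,X3,X0] (B X8 (C X0) (B X3 (C X2) (B X0 (B X5 (B X7 (C X2) (C X1)) (C
  X3)) (B X9 (C X1) (C X3))))) XA XB (S XA X8 (S XA X0 (L X0 [X8,X0,XA]) (S XA X2 (L X0
  [X8,X2,XA]) (S XA X5 (L X0 [X8,X5,XA]) F))) (S XA X3 (S XA X4 (L X0 [X4,X3,XA]) F) (S XA
  X9 (S XA X0 (L X0 [X9,X0,XA]) (S XA X6 (L X0 [X9,X6,XA]) (S XA X7 (L X0 [X9,X7,XA]) F)))
  (S XA X5 (S XA X6 (L X0 [X6,X5,XA]) (S XA X0 (S XA X4 (L X0 [X4,X0,XA]) (S XA X7 F F)) (S
  XA X1 (S XA X2 (L X0 [X2,X1,XA]) (S XA X4 (L X1 [X9,X6,X8,X2,X4,XA]) (S XA X7 (L X2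
  [XA,X9,X7,X5,X6,X2,X1,X0,X4,X3]) (L X1 [X8,X7,X4,X3,X1,XA])))) F))) (S XA X1 (L X1
  [X8,X5,X9,X3,X1,XA]) (S XA X0 F F)))))) (S XB X8 (S XA X8 (L X0 [X8,XB,XA]) (S XA X3 F (S
  XA X0 (S XA X5 (S XA X7 F F) F) (S XA X9 F F)))) (S XB X3 (S XA X8 F (S XA X3 (L X0
  [X3,XB,XA]) (S XA X0 (S XA X5 (S XA X7 (S XA X9 (L X0 [X9,X0,XA]) (S XB X0 (L X0
  [X0,XB,XA]) (S XB X2 (L X0 [X3,X2,XB]) (S XB X9 (L X0 [X9,X3,XB]) (S XB X5 (L X0
  [X5,XB,XA]) (S XB X4 (L X0 [X4,X3,XB]) (S XB X7 (L X0 [X7,XB,XA]) (S XA X6 (L X0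
  [X6,X5,XA]) (S XA X1 (L X0 [X1,X0,XA]) (S XA X4 (L X0 [X4,X0,XA]) (S XB X6 (S XB X1 (L X3
  [XB,X8,X7,X6,X5,X4,X3,X2,X1,X0]) (L X4 [XB,X8,X7,X6,X5,X4,X3,X2,X1,X0])) (S XB X1 (L X5
  [X8,X9,X7,X5,X6,X1,XB,X3,X4,X0]) (L X1 [X6,X5,X1,X0,X3,XB]))))))))))))) F) F) (S XA X9 F
  F)))) (S XA X8 (S XB X0 (S XB X5 (S XB X7 F F) F) (S XB X9 F F)) (S XB X0 (S XA X3 (S XB
  X5 (S XB X7 (S XB X9 (L X0 [X9,X0,XB]) (S XA X0 (L X0 [X0,XB,XA]) (S XA X2 (L X0
  [X3,X2,XA]) (S XA X9 (L X0 [X9,X3,XA]) (S XA X5 (L X0 [X5,XB,XA]) (S XA X4 (L X0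
  [X4,X3,XA]) (S XA X7 (L X0 [X7,XB,XA]) (S XA X6 (S XA X1 (L X3
  [XA,X8,X7,X6,X5,X4,X3,X2,X1,X0]) (L X4 [XA,X8,X7,X6,X5,X4,X3,X2,X1,X0])) (S XA X1 (L X5
  [X8,X9,X7,X5,X6,X1,XA,X3,X4,X0]) (L X1 [X6,X5,X1,X0,X3,XA])))))))))) F) F) (S XA X0 (L X0
  [X0,XB,XA]) (S XB X5 (S XA X9 (S XB X7 F (S XB X4 (L X0 [X4,X0,XB]) (S XB X1 (L X0
  [X1,X0,XB]) (S XB X9 (L X0 [X9,XB,XA]) (S XB X6 (L X0 [X6,X5,XB]) (S XA X7 (L X0
  [X9,X7,XA]) (S XB X2 (S XA X6 (L X0 [X9,X6,XA]) (S XA X5 (L X0 [X5,XB,XA]) (S XA X4 (S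
  XA X2 (L X0 [X2,XB,XA]) (S XA X1 (L X2 [X8,X9,X7,X5,X6,X1,X2,X3,X4,XA]) (L X1
  [X6,X5,X2,X1,X4,XA]))) (L X1 [X8,X7,X4,X3,XB,XA])))) (L X1 [X9,X7,X2,X1,X5,XB])))))))) (S
  XB X7 F F)) (S XA X9 F (S XB X9 (L X0 [X9,X0,XB]) (S XB X1 (L X0 [X1,X0,XB]) (S XA X5 (S
  XB X4 (L X0 [X4,X0,XB]) (S XA X6 (L X0 [X6,X5,XA]) (S XA X2 (S XB X2 (L X0 [X2,XB,XA])
  (S XB X6 (S XB X7 (L X5 [X2,X0,X1,X3,X4,X5,X6,XB,X7,X8]) (L X1 [X8,X7,X4,X3,X6,XB])) (L X1
  [X6,X5,X3,X2,X0,XB]))) (S XA X4 (L X1 [X9,X6,X8,X2,X4,XA]) (S XA X7 (S XA X1 (L X2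
  [XA,X9,X7,X5,X6,X2,X1,X0,X4,X3]) (L X6 [X5,X9,X6,XA,X7,X1,X2,X3,X4,X0])) (S XA X1 (L X1
  [X8,X7,X4,X3,X1,XA]) (L X1 [X9,X7,X2,X1,X5,XA]))))))) (L X1 [X8,X5,X9,X3,XB,XA])))))))) (S
  XA X3 (S XB X9 F F) (S XB X9 (S XA X0 (S XA X5 (S XA X7 F (S XA X4 (L X0 [X4,X0,XA]) (S
  XA X1 (L X0 [X1,X0,XA]) (S XA X9 (L X0 [X9,XB,XA]) (S XA X6 (L X0 [X6,X5,XA]) (S XB X7
  (L X0 [X9,X7,XB]) (S XA X2 (S XB X6 (L X0 [X9,X6,XB]) (S XB X5 (L X0 [X5,XB,XA]) (S XB
  X4 (S XB X2 (L X0 [X2,XB,XA]) (S XB X1 (L X2 [X8,X9,X7,X5,X6,X1,X2,X3,X4,XB]) (L X1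
  [X6,X5,X2,X1,X4,XB]))) (L X1 [X8,X7,X4,X3,XB,XA])))) (L X1 [X9,X7,X2,X1,X5,XA])))))))) F) (S
  XA X9 (L X0 [X9,XB,XA]) F)) (S XA X0 (S XA X5 (S XA X7 F F) (S XA X9 (L X0 [X9,X0,XA])
  (S XA X1 (L X0 [X1,X0,XA]) (S XB X5 (S XA X4 (L X0 [X4,X0,XA]) (S XB X6 (L X0 [X6,X5,XB])
  (S XB X2 (S XA X2 (L X0 [X2,XB,XA]) (S XA X6 (S XA X7 (L X5
  [X2,X0,X1,X3,X4,X5,X6,XA,X7,X8]) (L X1 [X8,X7,X4,X3,X6,XA])) (L X1 [X6,X5,X3,X2,X0,XA]))) (S
  XB X4 (L X1 [X9,X6,X8,X2,X4,XB]) (S XB X7 (S XB X1 (L X2 [XB,X9,X7,X5,X6,X2,X1,X0,X4,X3])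
  (L X6 [X5,X9,X6,XB,X7,X1,X2,X3,X4,X0])) (S XB X1 (L X1 [X8,X7,X4,X3,X1,XB]) (L X1
  [X9,X7,X2,X1,X5,XB]))))))) (L X1 [X8,X5,X9,X3,XB,XA]))))) (S XA X9 F (S XB X5 (S XA X5 (L
  X0 [X5,XB,XA]) (S XA X1 (L X1 [X8,X5,X9,X3,X1,XA]) (S XB X6 (L X0 [X6,X5,XB]) (S XB X2 (S
  XA X2 (L X0 [X2,XB,XA]) (S XA X7 (S XA X6 (S XA X4 (L X2 [XA,X8,X7,X6,X5,X3,X4,X0,X1,X2])
  (L X6 [X6,X8,X5,XA,X7,X4,X3,X2,X1,X0])) (L X1 [X6,X5,X1,X0,X7,XA])) (S XA X4 (L X1
  [X9,X7,X2,X1,X4,XA]) (S XB X1 (L X0 [X2,X1,XB]) (S XA X6 (L X1 [X8,X7,X4,X3,X6,XA]) (S XB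
  X4 (L X3 [X9,XB,XA,X6,X5,X1,X0,X4,X3,X2]) (S XB X7 (L X2 [XB,X9,X7,X5,X6,X1,X2,X3,X4,X0]) (L
  X1 [X8,X7,X4,X3,XB,XA])))))))) (S XB X4 (L X1 [X9,X6,X8,X2,X4,XB]) (S XB X7 (S XB X1 (L X2
  [XB,X9,X7,X5,X6,X2,X1,X0,X4,X3]) (L X6 [X5,X9,X6,XB,X7,X1,X2,X3,X4,X0])) (S XB X1 (L X1
  [X8,X7,X4,X3,X1,XB]) (L X1 [X9,X7,X2,X1,X5,XB])))))))) (S XA X5 (S XB X1 (L X1
  [X8,X5,X9,X3,X1,XB]) (S XA X6 (L X0 [X6,X5,XA]) (S XA X2 (S XB X2 (L X0 [X2,XB,XA]) (S
  XB X7 (S XB X6 (S XB X4 (L X2 [XB,X8,X7,X6,X5,X3,X4,X0,X1,X2]) (L X6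
  [X6,X8,X5,XB,X7,X4,X3,X2,X1,X0])) (L X1 [X6,X5,X1,X0,X7,XB])) (S XB X4 (L X1
  [X9,X7,X2,X1,X4,XB]) (S XA X1 (L X0 [X2,X1,XA]) (S XB X6 (L X1 [X8,X7,X4,X3,X6,XB]) (S XA
  X4 (L X3 [X9,XA,XB,X6,X5,X1,X0,X4,X3,X2]) (S XA X7 (L X2 [XA,X9,X7,X5,X6,X1,X2,X3,X4,X0]) (L
  X1 [X8,X7,X4,X3,XB,XA])))))))) (S XA X4 (L X1 [X9,X6,X8,X2,X4,XA]) (S XA X7 (S XA X1 (L X2
  [XA,X9,X7,X5,X6,X2,X1,X0,X4,X3]) (L X6 [X5,X9,X6,XA,X7,X1,X2,X3,X4,X0])) (S XA X1 (L X1
  [X8,X7,X4,X3,X1,XA]) (L X1 [X9,X7,X2,X1,X5,XA]))))))) (L X1 [X8,X5,X9,X3,XB,XA])))))))))))"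
  by code_simp

definition "R6 = [[N,Y,Y,N,N,Y,N,Y,N],[Y,N,Y,N,N,Y,N,Y],[N,N,N,N,N,N,N],[Y,N,N,N,N,N],[N,N,N,N,N],[Y,N,N,Y],[Y,N,N],[Y,N],[Y],[]]"

lemma cert_R6: "coloring_cert [(X0,K3),(X1,M3),(X2,R1),(X3,R4)] R6 vs10 [X3,X2,X1,X2,X3,X2,X0,X1,X0,X1] (B X6 (B
  X8 (B X1 (B X4 (C X1) (C X3)) (B X4 (C X3) (C X1))) (C X3)) (B X8 (C X1) (B X4 (C X0) (B X9 (C
  X0) (C X2))))) XA XB (S XA X8 (S XA X0 (L X0 [X8,X0,XA]) (S XA X2 (L X0 [X8,X2,XA]) (S
  XA X5 (L X0 [X8,X5,XA]) (S XA X7 (L X0 [X8,X7,XA]) (S XA X6 (S XA X9 (L X0 [X9,X6,XA]) (S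
  XA X1 (S XA X4 F F) (S XA X4 F F))) F))))) (S XA X6 (S XA X5 (L X0 [X6,X5,XA]) (S XA X9
  (L X0 [X9,X6,XA]) F)) (S XA X1 (S XA X2 (L X0 [X2,X1,XA]) (S XA X9 (L X0 [X9,X1,XA]) (S
  XA X4 (L X1 [X9,X6,X8,X2,X4,XA]) F))) (S XA X4 (S XA X3 (L X0 [X4,X3,XA]) F) (S XA X9 (S
  XA X3 (L X0 [X9,X3,XA]) F) F))))) (S XB X6 (S XA X6 (L X0 [X6,XB,XA]) (S XB X8 (S XA X8
  (L X0 [X8,XB,XA]) (S XB X1 (S XA X4 (S XB X4 F F) (S XA X9 (S XB X4 F F) (S XB X4 F F)))
  (S XB X4 (S XA X4 F (S XA X9 F F)) (S XA X4 F (S XA X9 F F))))) (S XA X8 F (S XA X4 F (S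
  XA X9 F F))))) (S XB X8 (S XA X6 (S XA X8 (L X0 [X8,XB,XA]) F) (S XA X8 (L X0
  [X8,XB,XA]) (S XA X4 F (S XA X9 F F)))) (S XB X4 (S XA X6 (S XA X8 (S XA X1 (S XA X4 F
  F) (S XA X4 F F)) F) (S XA X8 F (S XA X4 (L X0 [X4,XB,XA]) (S XA X9 (S XB X9 (L X0
  [X9,XB,XA]) (S XB X2 (S XA X3 (L X0 [X9,X3,XA]) (S XA X7 (L X0 [X9,X7,XA]) (S XB X1 (L
  X0 [X2,X1,XB]) (S XB X5 (S XA X5 (L X0 [X5,XB,XA]) (S XA X1 (L X0 [X9,X1,XA]) (S XA X2
  (L X0 [X2,XB,XA]) (S XA X0 (L X1 [X6,X5,X3,X2,X0,XA]) (L X2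
  [X8,X9,XA,X5,X6,X4,X0,X1,X2,X3]))))) (L X1 [X8,X5,X9,X1,X4,XB]))))) (L X1
  [X9,X6,X8,X2,X4,XB]))) F)))) (S XB X9 (S XA X6 (S XA X8 (S XA X1 (S XA X4 F F) (S XA X4 F
  F)) F) (S XA X8 F (S XA X4 (S XA X9 (L X0 [X9,XB,XA]) (S XA X2 (S XA X1 (L X0
  [X2,X1,XA]) (S XA X5 (S XB X3 (L X0 [X9,X3,XB]) (S XB X5 (L X0 [X5,XB,XA]) (S XB X2 (L
  X0 [X2,XB,XA]) (S XB X1 (L X0 [X9,X1,XB]) (S XB X0 (L X1 [X6,X5,X3,X2,X0,XB]) (L X2
  [X8,X9,XB,X5,X6,X4,X0,X1,X2,X3])))))) (L X1 [X8,X5,X9,X1,X4,XA]))) (L X1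
  [X9,X6,X8,X2,X4,XA]))) (S XA X9 (L X0 [X9,XB,XA]) F)))) (S XA X6 (S XA X8 (S XA X1 (S XA
  X4 F F) (S XA X4 F F)) F) (S XA X8 F (S XA X4 F (S XA X9 F (S XB X0 (S XA X0 (L X0
  [X0,XB,XA]) (S XA X2 (L X1 [X9,X6,X4,X0,X2,XA]) (S XB X2 (S XB X3 (L X0 [X3,X2,XB]) (S
  XB X1 (L X0 [X1,X0,XB]) (S XB X5 (S XA X5 (L X0 [X5,XB,XA]) (S XA X1 (S XA X3 (S XA X7
  (L X1 [X6,X5,X4,X0,X7,XA]) (L X3 [X8,X9,X7,X5,X6,X4,X0,X1,XA,X3])) (L X1
  [X6,X5,X4,X3,X1,XA])) (S XA X3 (L X1 [X6,X5,X1,X0,X3,XA]) (L X2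
  [X9,XB,XA,X6,X5,X4,X3,X2,X1,X0])))) (S XB X7 (L X1 [X6,X5,X4,X3,X7,XB]) (L X3
  [X9,X8,X7,X6,X5,X4,X3,X2,XB,X0]))))) (L X1 [X9,X6,X8,X2,XB,XA])))) (S XA X0 (S XB X2 (L X1
  [X9,X6,X4,X0,X2,XB]) (S XA X2 (S XA X3 (L X0 [X3,X2,XA]) (S XA X1 (L X0 [X1,X0,XA]) (S XA
  X5 (S XB X5 (L X0 [X5,XB,XA]) (S XB X1 (S XB X7 (L X1 [X6,X5,X4,X0,X7,XB]) (S XB X3 (L X3
  [X8,X9,X7,X5,X6,X4,X0,X1,XB,X3]) (L X1 [X6,X5,X4,X3,X1,XB]))) (S XB X3 (L X1
  [X6,X5,X1,X0,X3,XB]) (L X2 [X9,XA,XB,X6,X5,X4,X3,X2,X1,X0])))) (S XA X7 (L X1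
  [X6,X5,X4,X3,X7,XA]) (L X3 [X9,X8,X7,X6,X5,X4,X3,X2,XA,X0]))))) (L X1 [X9,X6,X8,X2,XB,XA])))
  (L X1 [X9,X6,X4,X0,XB,XA])))))))))))"
  by code_simp

definition "R7 = [[N,Y,Y,N,N,N,Y,N,Y],[Y,N,Y,N,N,Y,N,Y],[N,N,N,N,N,N,N],[Y,N,N,N,N,N],[N,N,N,N,N],[Y,N,N,Y],[Y,N,N],[Y,N],[Y],[]]"

text \<open>The cycle vertex \<open>X1\<close> has only its two cycle neighbours \<open>X0\<close>
  and \<open>X2\<close> in the pattern, and \<open>X8\<close> is adjacent to both.\<close>

lemma cert_R7: "domination_cert [(X0,K3),(X1,R6),(X2,R5),(X3,R1),(X4,M3),(X5,R3),(X6,R2)] R7 vs10 X1 X8 XA (S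
  XA X0 (L X0 [X1,X0,XA]) (S XA X2 (L X0 [X2,X1,XA]) (S XA X3 (S XA X4 (L X0 [X4,X3,XA]) (S
  XA X5 (S XA X6 (L X0 [X6,X5,XA]) (S XA X7 (S XA X9 (L X0 [X9,X7,XA]) (L X1
  [X9,XA,X7,X6,X5,X4,X0,X1,X2,X3])) (S XA X9 (L X2 [X0,XA,X1,X4,X3,X7,X8,X5,X6,X9]) (L X3
  [XA,X9,X7,X5,X6,X4,X3,X2,X1,X0])))) (S XA X6 (S XA X7 (L X1 [X8,XA,X7,X5,X6,X4,X0,X1,X2,X3])
  (L X3 [XA,X8,X7,X6,X5,X4,X3,X2,X1,X0])) (S XA X7 (L X4 [X6,X5,X4,X0,X7,XA]) (S XA X9 (L X5
  [X8,X9,X7,X5,X6,X4,X3,XA,X1,X0]) (L X6 [X3,X0,X4,XA,X1,X5,X6,X9,X7,X8])))))) (S XA X5 (S XA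
  X6 (L X0 [X6,X5,XA]) (S XA X7 (S XA X9 (L X0 [X9,X7,XA]) (S XA X4 (L X1
  [X9,XA,X7,X6,X5,X3,X2,X1,X0,X4]) (L X4 [X9,X6,X4,X3,X1,XA]))) (S XA X4 (S XA X9 (L X2
  [X2,XA,X1,X3,X4,X7,X8,X5,X6,X9]) (L X3 [XA,X9,X7,X5,X6,X3,X4,X0,X1,X2])) (L X4
  [X8,X7,X4,X3,X1,XA])))) (S XA X4 (S XA X6 (S XA X7 (L X1 [X8,XA,X7,X5,X6,X3,X2,X1,X0,X4])
  (L X3 [XA,X8,X7,X6,X5,X3,X4,X0,X1,X2])) (S XA X7 (L X4 [X6,X5,X3,X2,X7,XA]) (S XA X9 (L X5
  [X8,X9,X7,X5,X6,X3,X4,XA,X1,X2]) (L X6 [X4,X2,X3,XA,X1,X5,X6,X9,X7,X8])))) (L X4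
  [X8,X5,X4,X3,X1,XA]))))))"
  by code_simp

text \<open>The 5-cycle on \<open>X0\<close> to \<open>X4\<close>, the edge between
  \<open>X5\<close> and \<open>X6\<close>, and the vertex \<open>X7\<close> are pairwise
  anticomplete. The vertex \<open>X8\<close> connects them: it is adjacent to \<open>X7\<close>, to
  \<open>X5\<close>, and to the cycle vertices \<open>X0\<close> and \<open>X2\<close>.\<close>

definition "R8 = [[Y,N,Y,N,N,Y,N,Y],[N,N,N,N,N,N,N],[Y,N,N,N,N,N],[N,N,N,N,N],[Y,N,N,Y],[Y,N,N],[Y,N],[Y],[]]"

text \<open>The only neighbour of \<open>X7\<close> is \<open>X8\<close>, which is also adjacent to
  \<open>X5\<close>. A vertex adjacent to \<open>X7\<close> but not to \<open>X5\<close> completes a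
  triangle, a \<open>3K2\<close>, or one of \<open>R2\<close> to \<open>R7\<close>, up to renaming
  of the vertices.\<close>

lemma cert_R8: "domination_cert [(X0,K3),(X1,R5),(X2,M3),(X3,R6),(X4,R4),(X5,R7),(X6,R3),(X7,R2)] R8 vs9 X7 X5
  X9 (S X9 X8 (L X0 [X8,X7,X9]) (S X9 X3 (S X9 X2 (L X0 [X3,X2,X9]) (S X9 X4 (L X0 [X4,X3,X9]) (S
  X9 X0 (S X9 X1 (L X0 [X1,X0,X9]) (S X9 X6 (L X1 [X8,X9,X7,X5,X6,X1,X2,X3,X4,X0]) (L X2
  [X6,X5,X2,X1,X7,X9]))) (S X9 X6 (S X9 X1 (L X3 [X8,X9,X7,X5,X6,X4,X0,X1,X2,X3]) (L X4
  [X9,X8,X7,X6,X5,X4,X3,X2,X1,X0])) (L X2 [X6,X5,X4,X0,X7,X9]))))) (S X9 X4 (S X9 X0 (L X0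
  [X4,X0,X9]) (S X9 X1 (S X9 X2 (L X0 [X2,X1,X9]) (S X9 X6 (L X3 [X8,X9,X7,X5,X6,X3,X2,X1,X0,X4])
  (L X2 [X6,X5,X3,X2,X7,X9]))) (S X9 X6 (S X9 X2 (L X1 [X8,X9,X7,X5,X6,X1,X0,X4,X3,X2]) (L X4
  [X9,X8,X7,X6,X5,X3,X4,X0,X1,X2])) (L X2 [X6,X5,X1,X0,X7,X9])))) (S X9 X1 (L X2
  [X8,X5,X4,X3,X1,X9]) (S X9 X6 (S X9 X0 (S X9 X2 (L X5 [X0,X2,X1,X4,X3,X6,X5,X8,X7,X9]) (L X6
  [X2,X0,X1,X3,X4,X5,X6,X9,X7,X8])) (S X9 X2 (L X6 [X0,X2,X1,X4,X3,X5,X6,X9,X7,X8]) (L X7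
  [X6,X8,X5,X9,X7,X4,X3,X2,X1,X0]))) (L X2 [X6,X5,X4,X3,X7,X9]))))))"
  by code_simp

hide_const (open) L S F C B U Q Y N

section \<open>Critical \<open>(2K2, K4)\<close>-free graphs do not exist\<close>

locale critical_2K2_K4_free = critical_graph +
  assumes absent_K4 [simp]: "absent K4" and absent_M2 [simp]: "absent M2"
begin

text \<open>The exclusions accumulate as simplification rules: each of them discharges its entry in
  the lists \<open>D\<close> of the later certificates.\<close>

lemma absent_P0 [simp]: "absent P0"
  by (rule absent_domination[OF cert_P0]) simp

lemma absent_P1 [simp]: "absent P1"
  by (rule absent_domination[OF cert_P1]) simp

lemma absent_P2 [simp]: "absent P2"
  by (rule absent_domination[OF cert_P2]) simp

lemma absent_P3 [simp]: "absent P3"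
  by (rule absent_domination[OF cert_P3]) simp

lemma absent_P4 [simp]: "absent P4"
  by (rule absent_domination[OF cert_P4]) simp

lemma absent_P5 [simp]: "absent P5"
  by (rule absent_domination[OF cert_P5]) simp

lemma absent_P6 [simp]: "absent P6"
  by (rule absent_domination[OF cert_P6]) simp

lemma absent_P7 [simp]: "absent P7"
  by (rule absent_domination[OF cert_P7]) simp

lemma absent_P8 [simp]: "absent P8"
  by (rule absent_domination[OF cert_P8]) simp

lemma absent_P9 [simp]: "absent P9"
  by (rule absent_domination[OF cert_P9]) simp

lemma absent_P10 [simp]: "absent P10"
  by (rule absent_domination[OF cert_P10]) simp

lemma absent_P11 [simp]: "absent P11"
  by (rule absent_domination[OF cert_P11]) simp

lemma absent_P12 [simp]: "absent P12"
  by (rule absent_domination[OF cert_P12]) simp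

lemma absent_P13 [simp]: "absent P13"
  by (rule absent_coloring[OF cert_P13]) (simp_all add: P13_def)

lemma absent_P14 [simp]: "absent P14"
  by (rule absent_coloring[OF cert_P14]) (simp_all add: P14_def)

lemma absent_P15 [simp]: "absent P15"
  by (rule absent_domination[OF cert_P15]) simp

lemma absent_P16 [simp]: "absent P16"
  by (rule absent_domination[OF cert_P16]) simp

lemma absent_P17 [simp]: "absent P17"
  by (rule absent_domination[OF cert_P17]) simp

lemma absent_P18 [simp]: "absent P18"
  by (rule absent_domination[OF cert_P18]) simp

lemma absent_P19 [simp]: "absent P19"
  by (rule absent_domination[OF cert_P19]) simp

lemma absent_P20 [simp]: "absent P20"
  by (rule absent_domination[OF cert_P20]) simp

lemma absent_P21 [simp]: "absent P21"
  by (rule absent_domination[OF cert_P21]) simp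

lemma absent_P22 [simp]: "absent P22"
  by (rule absent_domination[OF cert_P22]) simp

lemma absent_P23 [simp]: "absent P23"
  by (rule absent_domination[OF cert_P23]) simp

lemma absent_P24 [simp]: "absent P24"
  by (rule absent_domination[OF cert_P24]) simp

lemma absent_P25 [simp]: "absent P25"
  by (rule absent_coloring[OF cert_P25]) (simp_all add: P25_def)

lemma absent_P26 [simp]: "absent P26"
  by (rule absent_coloring[OF cert_P26]) (simp_all add: P26_def)

lemma absent_P27 [simp]: "absent P27"
  by (rule absent_coloring[OF cert_P27]) (simp_all add: P27_def)

lemma absent_P28 [simp]: "absent P28"
  by (rule absent_coloring[OF cert_P28]) (simp_all add: P28_def)

lemma absent_P29 [simp]: "absent P29"
  by (rule absent_coloring[OF cert_P29]) (simp_all add: P29_def)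

lemma absent_P30 [simp]: "absent P30"
  by (rule absent_coloring[OF cert_P30]) (simp_all add: P30_def)

lemma absent_P31 [simp]: "absent P31"
  by (rule absent_coloring[OF cert_P31]) (simp_all add: P31_def)

lemma absent_P32 [simp]: "absent P32"
  by (rule absent_coloring[OF cert_P32]) (simp_all add: P32_def)

lemma absent_P33 [simp]: "absent P33"
  by (rule absent_domination[OF cert_P33]) simp

lemma absent_P34 [simp]: "absent P34"
  by (rule absent_coloring[OF cert_P34]) (simp_all add: P34_def)

lemma absent_P35 [simp]: "absent P35"
  by (rule absent_coloring[OF cert_P35]) (simp_all add: P35_def)

lemma absent_P36 [simp]: "absent P36"
  by (rule absent_coloring[OF cert_P36]) (simp_all add: P36_def)

lemma absent_P37 [simp]: "absent P37"
  by (rule absent_coloring[OF cert_P37]) (simp_all add: P37_def)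

lemma absent_P38 [simp]: "absent P38"
  by (rule absent_coloring[OF cert_P38]) (simp_all add: P38_def)

lemma absent_P39 [simp]: "absent P39"
  by (rule absent_coloring[OF cert_P39]) (simp_all add: P39_def)

text \<open>
  \<open>P37\<close> is the 5-wheel, \<open>P38\<close> and \<open>P39\<close> are \<open>K\<^sub>3\<close> and \<open>C\<^sub>5\<close> with an additional isolated vertex. Hence both
  the neighbours and the non-neighbours of a vertex induce bipartite graphs.
\<close>

lemma contradiction: False
proof -
  \<comment> \<open>The two equivalences make \<open>v\<close> complete or anticomplete to
    \<open>a\<close>, \<open>b\<close>, \<open>c\<close>. Thus one fact serves both sides of
    \<open>v\<close>: a triangle among the neighbours is a \<open>K4\<close>, one among the
    non-neighbours is \<open>P38\<close>.\<close>
  have tri: "\<not> E a c" if "a \<in> V" "b \<in> V" "c \<in> V" "E a b" "E b c"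
    and v: "v \<in> V" "E v a \<longleftrightarrow> E v b" "E v b \<longleftrightarrow> E v c" for a b c v
  proof
    assume ac: "E a c"
    show False
    proof (cases "E v a")
      case True
      show False
        using absentD[OF absent_K4, of "[v, c, b, a]"] that ac True by (auto simp: K4_def adj_commute)
    next
      case False
      show False
        using absentD[OF absent_P38, of "[v, c, b, a]"] that ac False irrefl
        by (auto simp: P38_def adj_commute)
    qed
  qed
  have far: "\<not> E x y" if "W \<subseteq> V" "a \<in> W" "b \<in> W" "E a b" "x \<in> far E W a b" "y \<in> far E W a b" for W a b x y
  proof -
    have "x \<noteq> a" "x \<noteq> b" "y \<noteq> a" "y \<noteq> b"
      using that adj_commute[of a b] by (auto simp: far_def)
    then show ?thesis
      using absentD[OF absent_M2, of "[x, y, a, b]"] that by (auto simp: M2_def far_def adj_commute)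
  qed
  obtain v where v: "v \<in> V"
    using not_colorable colorable_independent[of V E] colorable_mono[of E V 1 4] by fastforce
  have "colorable E {w \<in> V. E v w} 2"
  proof (rule ccontr)
    let ?W = "{w \<in> V. E v w}"
    assume not2: "\<not> ?thesis"
    have triW: "\<not> E a c" if "a \<in> ?W" "b \<in> ?W" "c \<in> ?W" "E a b" "E b c" for a b c
      by (rule tri[of a b c v]) (use that v in auto)
    have farW: "\<not> E x y"
      if "a \<in> ?W" "b \<in> ?W" "E a b" "x \<in> far E ?W a b" "y \<in> far E ?W a b" for a b x y
      by (rule far[of ?W a b x y]) (use that in auto)
    obtain a b c d e where "{a, b, c, d, e} \<subseteq> ?W" "E a b" "E b c" "E c d" "E d e" "E e a"
      "\<not> E a c" "\<not> E a d" "\<not> E b d" "\<not> E b e" "\<not> E c e"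
      by (rule bipartite_or_C5[OF triW farW not2])
    then show False
      using absentD[OF absent_P37, of "[v, e, d, c, b, a]"] v by (auto simp: P37_def adj_commute)
  qed
  moreover have "colorable E {w \<in> V. \<not> E v w} 2"
  proof (rule ccontr)
    \<comment> \<open>This set contains \<open>v\<close> itself, but \<open>v\<close> has no
      neighbour in it and so cannot lie on the 5-cycle.\<close>
    let ?W = "{w \<in> V. \<not> E v w}"
    assume not2: "\<not> ?thesis"
    have triW: "\<not> E a c" if "a \<in> ?W" "b \<in> ?W" "c \<in> ?W" "E a b" "E b c" for a b c
      by (rule tri[of a b c v]) (use that v in auto)
    have farW: "\<not> E x y"
      if "a \<in> ?W" "b \<in> ?W" "E a b" "x \<in> far E ?W a b" "y \<in> far E ?W a b" for a b x y
      by (rule far[of ?W a b x y]) (use that in auto)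
    obtain a b c d e where "{a, b, c, d, e} \<subseteq> ?W" "E a b" "E b c" "E c d" "E d e" "E e a"
      "\<not> E a c" "\<not> E a d" "\<not> E b d" "\<not> E b e" "\<not> E c e"
      by (rule bipartite_or_C5[OF triW farW not2])
    then show False
      using absentD[OF absent_P39, of "[v, e, d, c, b, a]"] v by (auto simp: P39_def adj_commute)
  qed
  ultimately have "colorable E ({w \<in> V. E v w} \<union> {w \<in> V. \<not> E v w}) (2 + 2)"
    by (rule colorable_Un)
  moreover have "{w \<in> V. E v w} \<union> {w \<in> V. \<not> E v w} = V"
    by auto
  ultimately show False
    using not_colorable by simp
qed

end

lemma (in simple_graph) colorable_2K2_K4_free:
  assumes "finite W" "\<not> has_matching E 2 W"
    and K4: "\<And>a b c d. {a, b, c, d} \<subseteq> W \<Longrightarrow> E a b \<Longrightarrow> E a c \<Longrightarrow> E a d \<Longrightarrow> E b c \<Longrightarrow> E b d \<Longrightarrow> \<not> E c d"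
  shows "colorable E W 4"
proof (rule ccontr)
  assume "\<not> ?thesis"
  then obtain A where A: "A \<subseteq> W" "critical_graph A E"
    by (rule exists_critical_subgraph[OF assms(1)])
  interpret A: critical_graph A E
    by (rule A(2))
  have "A.absent K4"
    unfolding A.absent_def
  proof (intro allI impI notI)
    fix vs assume vs: "set vs \<subseteq> A" "A.realizes K4 vs"
    then have "length vs = Suc (Suc (Suc (Suc 0)))"
      by (auto simp: K4_def dest: A.realizes_length)
    then obtain a b c d where "vs = [a, b, c, d]"
      by (auto simp: length_Suc_conv)
    then show False
      using vs K4[of a b c d] A(1) by (auto simp: K4_def)
  qed
  moreover have "A.absent M2"
    unfolding A.absent_def
  proof (intro allI impI notI)
    fix vs assume vs: "set vs \<subseteq> A" "A.realizes M2 vs"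
    then have "length vs = Suc (Suc (Suc (Suc 0)))"
      by (auto simp: M2_def dest: A.realizes_length)
    then obtain a b c d where abcd: "vs = [a, b, c, d]"
      by (auto simp: length_Suc_conv)
    then have "c \<in> far E W a b" "d \<in> far E W a b" "E a b" "E c d" "a \<in> W" "b \<in> W"
      using vs A(1) by (auto simp: M2_def far_def)
    then have "has_matching E 2 W"
      unfolding numeral_2_eq_2 by (blast intro: has_matching_SucI[of a W b] has_matching_1I[of c _ d])
    then show False
      using assms(2) by simp
  qed
  ultimately interpret A: critical_2K2_K4_free A E
    by unfold_locales
  show False
    by (rule A.contradiction)
qed

section \<open>Critical \<open>(3K2, K3)\<close>-free graphs do not exist\<close>

locale critical_3K2_K3_free = critical_graph +
  assumes absent_K3 [simp]: "absent K3" and absent_M3 [simp]: "absent M3"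
begin

lemma absent_R0 [simp]: "absent R0"
  by (rule absent_coloring[OF cert_R0]) (simp_all add: R0_def)

lemma absent_R1 [simp]: "absent R1"
  by (rule absent_coloring[OF cert_R1]) (simp_all add: R1_def)

lemma absent_R2 [simp]: "absent R2"
  by (rule absent_coloring[OF cert_R2]) (simp_all add: R2_def)

lemma absent_R3 [simp]: "absent R3"
  by (rule absent_coloring[OF cert_R3]) (simp_all add: R3_def)

lemma absent_R4 [simp]: "absent R4"
  by (rule absent_coloring[OF cert_R4]) (simp_all add: R4_def)

lemma absent_R5 [simp]: "absent R5"
  by (rule absent_coloring[OF cert_R5]) (simp_all add: R5_def)

lemma absent_R6 [simp]: "absent R6"
  by (rule absent_coloring[OF cert_R6]) (simp_all add: R6_def)

lemma absent_R7 [simp]: "absent R7"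
  by (rule absent_domination[OF cert_R7]) simp

lemma absent_R8 [simp]: "absent R8"
  by (rule absent_domination[OF cert_R8]) simp

lemma triangle_free: "a \<in> V \<Longrightarrow> b \<in> V \<Longrightarrow> c \<in> V \<Longrightarrow> E a b \<Longrightarrow> E b c \<Longrightarrow> \<not> E a c"
  using absentD[OF absent_K3, of "[a, b, c]"] by (auto simp: K3_def)

lemma matching_free:
  assumes "{a, b, c, d, e, f} \<subseteq> V" "E a b" "E c d" "E e f" "\<not> E a c" "\<not> E a d" "\<not> E a e" "\<not> E a f"
    "\<not> E b c" "\<not> E b d" "\<not> E b e" "\<not> E b f" "\<not> E c e" "\<not> E c f" "\<not> E d e" "\<not> E d f"
  shows False
proof -
  have "a \<noteq> c" "a \<noteq> d" "a \<noteq> e" "a \<noteq> f" "b \<noteq> c" "b \<noteq> d" "b \<noteq> e" "b \<noteq> f"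
    "c \<noteq> e" "c \<noteq> f" "d \<noteq> e" "d \<noteq> f"
    using assms adj_commute[of c d] adj_commute[of e f] by auto
  then show False
    using absentD[OF absent_M3, of "[a, b, c, d, e, f]"] assms by (auto simp: M3_def)
qed

text \<open>
  Every edge \<open>uv\<close> is anticomplete to a 5-cycle, since otherwise the vertices far from \<open>uv\<close> induce a
  bipartite graph. These vertices then form a blow-up of the 5-cycle with classes \<open>A0, \<dots>, A4\<close> and
  isolated vertices \<open>Z\<close>. Moving the neighbours of \<open>u\<close> that see \<open>A4\<close> out of their colour class makes
  room for \<open>A4\<close>; the only obstruction is the excluded pattern \<open>R8\<close>.
\<close>

lemma contradiction: False
proof -
  have "\<exists>u\<in>V. \<exists>v\<in>V. E u v"
    using not_colorable colorable_independent[of V E] colorable_mono[of E V 1 4] by auto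
  then obtain u v where uv: "u \<in> V" "v \<in> V" "E u v"
    by blast
  define R where "R = far E V u v"
  have R: "x \<in> V" "\<not> E u x" "\<not> E v x" "\<not> E x u" "\<not> E x v" if "x \<in> R" for x
    using that adj_commute[of x] by (auto simp: R_def far_def)
  define Nu where "Nu = {x \<in> V. E u x}"
  define Nv where "Nv = {x \<in> V. E v x}"
  have Nu: "\<not> E x y" if "x \<in> Nu" "y \<in> Nu" for x y
    using triangle_free[of u x y] that uv by (auto simp: Nu_def)
  have Nv: "\<not> E x y" if "x \<in> Nv" "y \<in> Nv" for x y
    using triangle_free[of v x y] that uv by (auto simp: Nv_def)
  have V: "V = Nu \<union> Nv \<union> R"
    by (auto simp: Nu_def Nv_def R_def far_def)
  have tri: "\<not> E a c" if "a \<in> R" "b \<in> R" "c \<in> R" "E a b" "E b c" for a b c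
    using triangle_free[of a b c] that R by auto
  have match: False
    if "{a, b, c, d} \<subseteq> R" "E a b" "E c d" "\<not> E a c" "\<not> E a d" "\<not> E b c" "\<not> E b d" for a b c d
    using matching_free[of u v a b c d] that uv R by auto
  have far: "\<not> E x y" if "a \<in> R" "b \<in> R" "E a b" "x \<in> far E R a b" "y \<in> far E R a b" for a b x y
    using match[of a b x y] that by (auto simp: far_def)
  \<comment> \<open>The neighbours of \<open>u\<close> and those of \<open>v\<close> are independent
    sets, so two colours on \<open>R\<close> would make four in all.\<close>
  have not2: "\<not> colorable E R 2"
  proof
    assume R2: "colorable E R 2"
    have "colorable E (Nu \<union> Nv \<union> R) (1 + 1 + 2)"
      by (intro colorable_Un colorable_independent R2) (simp_all add: Nu Nv)
    then have "colorable E V 4"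
      unfolding V by (rule colorable_mono) simp
    then show False
      using not_colorable by simp
  qed
  obtain c0 c1 c2 c3 c4 where C: "{c0, c1, c2, c3, c4} \<subseteq> R"
    and C_adj: "E c0 c1" "E c1 c2" "E c2 c3" "E c3 c4" "E c4 c0"
    and C_non: "\<not> E c0 c2" "\<not> E c0 c3" "\<not> E c1 c3" "\<not> E c1 c4" "\<not> E c2 c4"
    by (rule bipartite_or_C5[OF tri far not2])
  have C_in: "c0 \<in> R" "c1 \<in> R" "c2 \<in> R" "c3 \<in> R" "c4 \<in> R"
    using C by auto
  note C_adj' = C_adj C_adj[THEN sym]
  have "\<not> E c2 c0" "\<not> E c3 c0" "\<not> E c3 c1" "\<not> E c4 c1" "\<not> E c4 c2"
    using C_non sym by blast+
  note C_non' = C_non this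
  have common: "\<not> E a b" if "a \<in> R" "b \<in> R" "z \<in> R" "E a z" "E b z" for a b z
    using tri[of a z b] sym[of b z] that by auto
  define A0 where "A0 = {a \<in> R. E a c4 \<and> E a c1}"
  define A1 where "A1 = {a \<in> R. E a c0 \<and> E a c2}"
  define A2 where "A2 = {a \<in> R. E a c1 \<and> E a c3}"
  define A3 where "A3 = {a \<in> R. E a c2 \<and> E a c4}"
  define A4 where "A4 = {a \<in> R. E a c3 \<and> E a c0}"
  note A_defs = A0_def A1_def A2_def A3_def A4_def
  define Z where "Z = R - (A0 \<union> A1 \<union> A2 \<union> A3 \<union> A4)"
  \<comment> \<open>Together with \<open>uv\<close>, the edges \<open>ax\<close> and
    \<open>by\<close> would form an induced \<open>3K2\<close>; the edge \<open>ab\<close> is the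
    only adjacency left that can prevent this.\<close>
  have complete: "E a b"
    if "{a, b, x, y} \<subseteq> R" "E a x" "E b y" "\<not> E a y" "\<not> E b x" "\<not> E x y" for a b x y
    using match[of a x b y] that adj_commute[of b x] by auto
  \<comment> \<open>Private cycle neighbours witness completeness: \<open>c3\<close> sees
    \<open>A4\<close> and misses \<open>A0\<close>, while \<open>c1\<close> sees \<open>A0\<close>
    and misses \<open>A4\<close>. The next two facts use the same scheme.\<close>
  have A40: "E a b" if "a \<in> A4" "b \<in> A0" for a b
    using complete[of a b c3 c1] common[of a c1 c0] common[of b c3 c4] that C_in C_adj' C_non'
    by (auto simp: A_defs)
  have A34: "E a b" if "a \<in> A3" "b \<in> A4" for a b
    using complete[of a b c2 c0] common[of a c0 c4] common[of b c2 c3] that C_in C_adj' C_non'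
    by (auto simp: A_defs)
  have A12: "E a b" if "a \<in> A1" "b \<in> A2" for a b
    using complete[of a b c0 c3] common[of a c3 c2] common[of b c0 c1] that C_in C_adj' C_non'
    by (auto simp: A_defs)
  \<comment> \<open>Outside the classes, a vertex never sees two cycle vertices at distance 2. If it
    sees some cycle vertex, this edge is therefore anticomplete to the opposite cycle edge, which
    with \<open>uv\<close> is a \<open>3K2\<close>.\<close>
  have Z_C: "\<not> E z c0 \<and> \<not> E z c1 \<and> \<not> E z c2 \<and> \<not> E z c3 \<and> \<not> E z c4" if "z \<in> Z" for z
  proof -
    have z: "z \<in> R" "\<not> (E z c4 \<and> E z c1)" "\<not> (E z c0 \<and> E z c2)" "\<not> (E z c1 \<and> E z c3)"
      "\<not> (E z c2 \<and> E z c4)" "\<not> (E z c3 \<and> E z c0)"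
      using that by (auto simp: Z_def A_defs)
    have "\<not> E z c0"
      using match[of z c0 c2 c3] z C_in C_adj' C_non' by auto
    moreover have "\<not> E z c1"
      using match[of z c1 c3 c4] z C_in C_adj' C_non' by auto
    moreover have "\<not> E z c2"
      using match[of z c2 c4 c0] z C_in C_adj' C_non' by auto
    moreover have "\<not> E z c3"
      using match[of z c3 c0 c1] z C_in C_adj' C_non' by auto
    moreover have "\<not> E z c4"
      using match[of z c4 c1 c2] z C_in C_adj' C_non' by auto
    ultimately show ?thesis
      by simp
  qed
  have Z_R: "z \<in> R" if "z \<in> Z" for z
    using that by (simp add: Z_def)
  \<comment> \<open>With an edge \<open>zy\<close>, the vertex \<open>y\<close> has to meet each
    cycle edge (else \<open>3K2\<close>) in exactly one end (else a triangle). Its neighbours and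
    non-neighbours would then 2-colour an odd cycle.\<close>
  have Z_isolated: "\<not> E z y" if z: "z \<in> Z" and y: "y \<in> R" for y z
  proof
    assume "E z y"
    then have cover: "E y c \<or> E y d" if "c \<in> R" "d \<in> R" "E c d" "\<not> E z c" "\<not> E z d" for c d
      using match[of z y c d] Z_R[OF z] y that by auto
    have indep: "\<not> (E y c \<and> E y d)" if "c \<in> R" "d \<in> R" "E c d" for c d
      using common[of y d c] sym[of c d] that y by auto
    show False
      using cover[of c0 c1] cover[of c1 c2] cover[of c2 c3] cover[of c3 c4] cover[of c4 c0]
        indep[of c0 c1] indep[of c1 c2] indep[of c2 c3] indep[of c3 c4] indep[of c4 c0]
        Z_C[OF z] C_in C_adj by blast
  qed
  \<comment> \<open>The vertices \<open>c0\<close>, \<open>c1\<close>, \<open>a2\<close>,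
    \<open>c3\<close>, \<open>a4\<close> form another 5-cycle. It is met by \<open>x\<close> in
    \<open>a2\<close> and \<open>a4\<close> only, and with \<open>u\<close>, \<open>v\<close>,
    \<open>z\<close> this is exactly \<open>R8\<close>.\<close>
  have key: "\<not> E x z"
    if x: "x \<in> Nu" and a4: "a4 \<in> A4" "E x a4" and a2: "a2 \<in> A2" "E x a2" and z: "z \<in> Z" for x a4 a2 z
  proof
    assume xz: "E x z"
    have in_R: "a4 \<in> R" "a2 \<in> R" "z \<in> R"
      using a4 a2 z by (auto simp: A_defs Z_def)
    have a_adj: "E a4 c3" "E a4 c0" "E a2 c1" "E a2 c3"
      using a4 a2 by (auto simp: A_defs)
    have a_non: "\<not> E a2 a4" "\<not> E a4 c1" "\<not> E a2 c0"
      using common[of a2 a4 c3] common[of a4 c1 c0] common[of a2 c0 c1] in_R a_adj C_in C_adj' by auto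
    have xV: "x \<in> V" "E x u"
      using x sym by (auto simp: Nu_def)
    have x_non: "\<not> E x v" "\<not> E x c0" "\<not> E x c1" "\<not> E x c3"
      using triangle_free[of x u v] triangle_free[of x a4 c0] triangle_free[of x a2 c1]
        triangle_free[of x a2 c3] xV uv R in_R C_in a2 a4 a_adj by auto
    have z_non: "\<not> E z a2" "\<not> E z a4" "\<not> E z c0" "\<not> E z c1" "\<not> E z c3" "\<not> E z u" "\<not> E z v"
      using Z_isolated[OF z] in_R C_in R by auto
    have neq: "x \<noteq> v" "x \<noteq> c0" "x \<noteq> c1" "x \<noteq> c3" "z \<noteq> u" "z \<noteq> v" "z \<noteq> c0" "z \<noteq> c1" "z \<noteq> c3" "z \<noteq> a2" "z \<noteq> a4"
      "v \<noteq> c0" "v \<noteq> c1" "v \<noteq> a2" "v \<noteq> c3" "v \<noteq> a4" "u \<noteq> c0" "u \<noteq> c1" "u \<noteq> a2" "u \<noteq> c3" "u \<noteq> a4"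
      "c0 \<noteq> a2" "c0 \<noteq> c3" "c1 \<noteq> c3" "c1 \<noteq> a4" "a2 \<noteq> a4"
      using xV xz z_non uv sym[OF uv(3)] sym[OF xz] R in_R C_in a_adj a_non C_adj' C_non' x_non by auto
    show False
      using absentD[OF absent_R8, of "[x, z, v, u, c0, c1, a2, c3, a4]"] neq z_non x_non a_non xV xz
        uv in_R C_in a_adj a2 a4 C_adj C_non R by (auto simp: R8_def adj_commute)
  qed
  \<comment> \<open>The four colour classes are \<open>I1\<close>, \<open>Nv\<close>,
    \<open>I3\<close>, \<open>I4\<close>. A neighbour of \<open>u\<close> that sees
    \<open>A4\<close> misses \<open>A0\<close> and \<open>A3\<close>, since these are complete to
    \<open>A4\<close>; hence it fits into \<open>I3\<close> if it also misses \<open>A2\<close>.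
    Otherwise it sees \<open>A2\<close>, hence misses \<open>A1\<close>, and by \<open>key\<close>
    also \<open>Z\<close>, so it fits into \<open>I4\<close>.\<close>
  define I1 where "I1 = A4 \<union> {x \<in> Nu. \<forall>a\<in>A4. \<not> E x a}"
  define I3 where "I3 = A0 \<union> A2 \<union> {x \<in> Nu. (\<exists>a\<in>A4. E x a) \<and> (\<forall>a\<in>A2. \<not> E x a)}"
  define I4 where "I4 = A1 \<union> A3 \<union> Z \<union> {x \<in> Nu. (\<exists>a\<in>A4. E x a) \<and> (\<exists>a\<in>A2. E x a)}"
  have A_R: "A0 \<subseteq> R" "A1 \<subseteq> R" "A2 \<subseteq> R" "A3 \<subseteq> R" "A4 \<subseteq> R"
    by (auto simp: A_defs)
  have NuV: "Nu \<subseteq> V"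
    by (auto simp: Nu_def)
  have "colorable E I1 1"
  proof (rule colorable_independent)
    have "\<not> E x y" if "x \<in> A4" "y \<in> A4" for x y
      using common[of x y c3] that C_in by (auto simp: A_defs)
    then show "\<not> E x y" if "x \<in> I1" "y \<in> I1" for x y
      using that Nu[of x y] adj_commute[of x y] by (auto simp: I1_def)
  qed
  moreover have "colorable E Nv 1"
    by (rule colorable_independent) (rule Nv)
  moreover have "colorable E I3 1"
  proof (rule colorable_independent)
    have 1: "\<not> E x y" if "x \<in> A0 \<union> A2" "y \<in> A0 \<union> A2" for x y
      using common[of x y c1] that C_in by (auto simp: A_defs)
    have 2: "\<not> E x y" if h: "x \<in> Nu" "\<exists>a\<in>A4. E x a" "\<forall>a\<in>A2. \<not> E x a" "y \<in> A0 \<union> A2" for x y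
    proof
      assume xy: "E x y"
      obtain a where a: "a \<in> A4" "E x a"
        using h by blast
      then have "y \<in> A0"
        using h xy by auto
      then show False
        using triangle_free[of x a y] A40[of a y] a xy h(1) NuV A_R R by blast
    qed
    show "\<not> E x y" if "x \<in> I3" "y \<in> I3" for x y
      using that 1[of x y] 2[of x y] 2[of y x] Nu[of x y] adj_commute[of x y] unfolding I3_def by blast
  qed
  moreover have "colorable E I4 1"
  proof (rule colorable_independent)
    have 1: "\<not> E x y" if "x \<in> A1 \<union> A3" "y \<in> A1 \<union> A3" for x y
      using common[of x y c2] that C_in by (auto simp: A_defs)
    have 2: "\<not> E x y" if "x \<in> Z" "y \<in> A1 \<union> A3 \<union> Z" for x y
      using Z_isolated[of x y] that A_R Z_R by blast
    have 3: "\<not> E x y" if h: "x \<in> Nu" "\<exists>a\<in>A4. E x a" "\<exists>a\<in>A2. E x a" "y \<in> A1 \<union> A3 \<union> Z" for x y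
    proof
      assume xy: "E x y"
      obtain a4 a2 where a: "a4 \<in> A4" "E x a4" "a2 \<in> A2" "E x a2"
        using h by blast
      have "y \<notin> Z"
        using key[OF h(1) a] xy by blast
      then consider "y \<in> A1" | "y \<in> A3"
        using h by blast
      then show False
      proof cases
        case 1
        then show False
          using triangle_free[of x y a2] A12[of y a2] a xy h(1) NuV A_R R by blast
      next
        case 2
        then show False
          using triangle_free[of x y a4] A34[of y a4] a xy h(1) NuV A_R R by blast
      qed
    qed
    show "\<not> E x y" if "x \<in> I4" "y \<in> I4" for x y
      using that 1[of x y] 2[of x y] 2[of y x] 3[of x y] 3[of y x] Nu[of x y] adj_commute[of x y]
      unfolding I4_def by blast
  qed
  ultimately have "colorable E (I1 \<union> Nv \<union> I3 \<union> I4) (1 + 1 + 1 + 1)"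
    by (intro colorable_Un)
  then have "colorable E V (1 + 1 + 1 + 1)"
    by (rule colorable_subset) (auto simp: V I1_def I3_def I4_def Z_def)
  then have "colorable E V 4"
    by (rule colorable_mono) simp
  then show False
    using not_colorable by simp
qed

end

lemma (in simple_graph) colorable_3K2_K3_free:
  assumes "finite W" "\<not> has_matching E 3 W"
    and K3: "\<And>a b c. {a, b, c} \<subseteq> W \<Longrightarrow> E a b \<Longrightarrow> E a c \<Longrightarrow> \<not> E b c"
  shows "colorable E W 4"
proof (rule ccontr)
  assume "\<not> ?thesis"
  then obtain A where A: "A \<subseteq> W" "critical_graph A E"
    by (rule exists_critical_subgraph[OF assms(1)])
  interpret A: critical_graph A E
    by (rule A(2))
  have "A.absent K3"
    unfolding A.absent_def
  proof (intro allI impI notI)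
    fix vs assume vs: "set vs \<subseteq> A" "A.realizes K3 vs"
    then have "length vs = Suc (Suc (Suc 0))"
      by (auto simp: K3_def dest: A.realizes_length)
    then obtain a b c where "vs = [a, b, c]"
      by (auto simp: length_Suc_conv)
    then show False
      using vs K3[of a b c] A(1) by (auto simp: K3_def)
  qed
  moreover have "A.absent M3"
    unfolding A.absent_def
  proof (intro allI impI notI)
    fix vs assume vs: "set vs \<subseteq> A" "A.realizes M3 vs"
    then have "length vs = Suc (Suc (Suc (Suc (Suc (Suc 0)))))"
      by (auto simp: M3_def dest: A.realizes_length)
    then obtain a b c d e f where "vs = [a, b, c, d, e, f]"
      by (auto simp: length_Suc_conv)
    then have "a \<in> W" "b \<in> W" "E a b" "c \<in> far E W a b" "d \<in> far E W a b" "E c d"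
      "e \<in> far E (far E W a b) c d" "f \<in> far E (far E W a b) c d" "E e f"
      using vs A(1) by (auto simp: M3_def far_def)
    then have "has_matching E 3 W"
      unfolding numeral_3_eq_3
      by (intro has_matching_SucI[of a W b] has_matching_SucI[of c _ d] has_matching_1I[of e _ f])
    then show False
      using assms(2) by simp
  qed
  ultimately interpret A: critical_3K2_K3_free A E
    by unfold_locales
  show False
    by (rule A.contradiction)
qed

section \<open>Bounds by clique number\<close>

definition clique_in :: "('a \<Rightarrow> 'a \<Rightarrow> bool) \<Rightarrow> 'a set \<Rightarrow> 'a set \<Rightarrow> bool" where
  "clique_in E W K \<longleftrightarrow> K \<subseteq> W \<and> (\<forall>u\<in>K. \<forall>v\<in>K. u \<noteq> v \<longrightarrow> E u v)"

text \<open>An upper bound on the clique number instead of its value, because this is inherited by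
  all subsets.\<close>

definition clique_bound :: "('a \<Rightarrow> 'a \<Rightarrow> bool) \<Rightarrow> 'a set \<Rightarrow> nat \<Rightarrow> bool" where
  "clique_bound E W m \<longleftrightarrow> (\<forall>K. clique_in E W K \<longrightarrow> card K \<le> m)"

text \<open>Distinctness is implied by the adjacencies, up to \<open>x = c\<close> and
  \<open>x = d\<close>; in these cases the conclusion holds anyway because \<open>c\<close> and
  \<open>d\<close> are adjacent.\<close>

definition HVN_free :: "('a \<Rightarrow> 'a \<Rightarrow> bool) \<Rightarrow> 'a set \<Rightarrow> bool" where
  "HVN_free E W \<longleftrightarrow> (\<forall>a b c d x. {a, b, c, d, x} \<subseteq> W \<longrightarrow> E a b \<longrightarrow> E a c \<longrightarrow> E a d \<longrightarrow> E b c \<longrightarrow>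
     E b d \<longrightarrow> E c d \<longrightarrow> E x a \<longrightarrow> E x b \<longrightarrow> E x c \<or> E x d)"

lemma HVN_freeD:
  assumes "HVN_free E W" "{a, b, c, d, x} \<subseteq> W" "E a b" "E a c" "E a d" "E b c" "E b d" "E c d"
    "E x a" "E x b"
  shows "E x c \<or> E x d"
  using assms(1)[unfolded HVN_free_def, rule_format, OF assms(2-)] .

lemma HVN_free_subset:
  assumes "HVN_free E W" "A \<subseteq> W"
  shows "HVN_free E A"
  unfolding HVN_free_def
proof (intro allI impI)
  fix a b c d x
  assume "{a, b, c, d, x} \<subseteq> A" "E a b" "E a c" "E a d" "E b c" "E b d" "E c d" "E x a" "E x b"
  then show "E x c \<or> E x d"
    using HVN_freeD[OF assms(1), of a b c d x] assms(2) by auto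
qed

lemma clique_bound_subset: "clique_bound E W m \<Longrightarrow> A \<subseteq> W \<Longrightarrow> clique_bound E A m"
  by (auto simp: clique_bound_def clique_in_def)

text \<open>This is where clique number at least 4 enters: beside any two vertices of the clique
  there are two more, which take the roles of \<open>c\<close> and \<open>d\<close> in HVN.\<close>

lemma obtain_two_more:
  assumes "finite K" "card K \<ge> 4"
  obtains c d where "c \<in> K" "d \<in> K" "c \<noteq> d" "c \<noteq> j" "c \<noteq> k" "d \<noteq> j" "d \<noteq> k"
proof -
  have "card K - card {j, k} \<le> card (K - {j, k})"
    by (rule diff_card_le_card_Diff) simp
  moreover have "card {j, k} \<le> 2"
    by (simp add: card_insert_if)
  ultimately have "2 \<le> card (K - {j, k})"
    using assms(2) by linarith
  then obtain T where "T \<subseteq> K - {j, k}" "card T = 2"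
    by (rule obtain_subset_with_card_n)
  then show thesis
    using that by (auto simp: card_2_iff)
qed

context simple_graph
begin

text \<open>A clique inside the neighbourhood of \<open>v\<close> can be enlarged by
  \<open>v\<close>.\<close>

lemma clique_bound_common_nbr:
  assumes "clique_bound E W (Suc m)" "finite W" "A \<subseteq> W" "v \<in> W" "\<And>x. x \<in> A \<Longrightarrow> E v x"
  shows "clique_bound E A m"
  unfolding clique_bound_def
proof (intro allI impI)
  fix K assume K: "clique_in E A K"
  then have "clique_in E W (insert v K)"
    using assms sym by (auto simp: clique_in_def)
  then have "card (insert v K) \<le> Suc m"
    using assms(1) by (simp add: clique_bound_def)
  moreover have "v \<notin> K"
    using K assms irrefl by (auto simp: clique_in_def)
  moreover have "finite K"
    using K finite_subset[of K W] assms by (auto simp: clique_in_def)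
  ultimately show "card K \<le> m"
    by simp
qed

lemma clique_bound_2:
  assumes "clique_bound E W 2" "{a, b, c} \<subseteq> W" "E a b" "E a c"
  shows "\<not> E b c"
proof
  assume "E b c"
  then have "clique_in E W {a, b, c}" "card {a, b, c} = 3"
    using assms irrefl sym by (auto simp: clique_in_def card_insert_if)
  then show False
    using assms(1) by (auto simp: clique_bound_def)
qed

lemma clique_bound_3:
  assumes "clique_bound E W 3" "{a, b, c, d} \<subseteq> W" "E a b" "E a c" "E a d" "E b c" "E b d"
  shows "\<not> E c d"
proof
  assume "E c d"
  then have "clique_in E W {a, b, c, d}" "card {a, b, c, d} = 4"
    using assms irrefl sym by (auto simp: clique_in_def card_insert_if)
  then show False
    using assms(1) by (auto simp: clique_bound_def)
qed

lemma clique_bound_0: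
  assumes "clique_bound E W 0"
  shows "W = {}"
proof -
  have False if "v \<in> W" for v
    using assms that by (auto simp: clique_bound_def clique_in_def dest!: spec[of _ "{v}"])
  then show ?thesis
    by blast
qed

lemma clique_bound_1:
  assumes "clique_bound E W 1" "u \<in> W" "v \<in> W"
  shows "\<not> E u v"
proof
  assume "E u v"
  then have "clique_in E W {u, v}" "card {u, v} = 2"
    using assms irrefl sym by (auto simp: clique_in_def card_insert_if)
  then show False
    using assms(1) by (auto simp: clique_bound_def)
qed

lemma clique_bound_pred:
  assumes "clique_bound E W (Suc m)" "\<not> (\<exists>K. clique_in E W K \<and> card K = Suc m)"
  shows "clique_bound E W m"
  using assms unfolding clique_bound_def by (metis le_SucE)

end

section \<open>Structure around a maximum clique of size at least 4\<close>

locale maximum_clique = simple_graph +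
  fixes m K
  assumes finite_V: "finite V" and HVN_free: "HVN_free E V" and bound: "clique_bound E V m"
    and K: "clique_in E V K" and card_K: "card K = m" and m: "m \<ge> 4"
begin

text \<open>The vertex \<open>k\<close> itself belongs to \<open>part k\<close>, so the parts
  contain \<open>K\<close>.\<close>

definition part :: "'a \<Rightarrow> 'a set" where
  "part k = {x \<in> V. \<forall>j\<in>K. E x j \<longleftrightarrow> j \<noteq> k}"

definition rest :: "'a set" where
  "rest = {x \<in> V. \<forall>j\<in>K. \<forall>k\<in>K. E x j \<longrightarrow> E x k \<longrightarrow> j = k}"

lemma K_V: "k \<in> K \<Longrightarrow> k \<in> V"
  using K by (auto simp: clique_in_def)

lemma K_adj: "j \<in> K \<Longrightarrow> k \<in> K \<Longrightarrow> j \<noteq> k \<Longrightarrow> E j k"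
  using K by (auto simp: clique_in_def)

lemma finite_K: "finite K"
  using finite_V K by (auto simp: clique_in_def intro: finite_subset)

lemma two_more:
  obtains c d where "c \<in> K" "d \<in> K" "c \<noteq> d" "c \<noteq> j" "c \<noteq> k" "d \<noteq> j" "d \<noteq> k"
  using obtain_two_more[OF finite_K, of j k] card_K m by metis

lemma HVN:
  assumes "{a, b, c, d, x} \<subseteq> V" "E a b" "E a c" "E a d" "E b c" "E b d" "E c d" "E x a" "E x b"
  shows "E x c \<or> E x d"
  using HVN_freeD[OF HVN_free assms] .

lemma part_V: "part k \<subseteq> V"
  by (auto simp: part_def)

lemma rest_V: "rest \<subseteq> V"
  by (auto simp: rest_def)

lemma part_adj: "x \<in> part k \<Longrightarrow> j \<in> K \<Longrightarrow> j \<noteq> k \<Longrightarrow> E x j"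
  by (simp add: part_def)

text \<open>Two neighbours and two non-neighbours of \<open>x\<close> in \<open>K\<close> would give
  an HVN, so a vertex with two neighbours in \<open>K\<close> misses at most one vertex of
  \<open>K\<close>. It misses at least one because \<open>K\<close> is maximum.\<close>

lemma V_eq: "V = rest \<union> (\<Union>k\<in>K. part k)"
proof -
  have "x \<in> (\<Union>k\<in>K. part k)" if x: "x \<in> V" "x \<notin> rest" for x
  proof -
    obtain j k where jk: "j \<in> K" "k \<in> K" "E x j" "E x k" "j \<noteq> k"
      using x by (auto simp: rest_def)
    have "\<exists>c\<in>K. \<not> E x c"
    proof (rule ccontr)
      assume "\<not> ?thesis"
      then have "x \<notin> K" "clique_in E V (insert x K)"
        using K x irrefl sym by (auto simp: clique_in_def)
      then have "card (insert x K) \<le> m" "card (insert x K) = Suc m"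
        using bound card_K finite_K by (auto simp: clique_bound_def)
      then show False
        by simp
    qed
    then obtain c where c: "c \<in> K" "\<not> E x c"
      by blast
    have "E x d" if "d \<in> K" "d \<noteq> c" for d
    proof (rule ccontr)
      assume d: "\<not> E x d"
      then have "j \<noteq> c" "j \<noteq> d" "k \<noteq> c" "k \<noteq> d"
        using jk c by auto
      then show False
        using HVN[of j k c d x] jk c d that K_V x K_adj by auto
    qed
    then show ?thesis
      using c x by (auto simp: part_def)
  qed
  then show ?thesis
    using part_V rest_V by blast
qed

text \<open>Replacing \<open>k\<close> by two adjacent vertices of its part would enlarge the
  maximum clique.\<close>

lemma part_independent:
  assumes "k \<in> K" "x \<in> part k" "y \<in> part k"
  shows "\<not> E x y"
proof
  assume xy: "E x y"
  let ?S = "insert x (insert y (K - {k}))"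
  have new: "x \<notin> K - {k}" "y \<notin> K - {k}" "x \<noteq> y"
    using assms xy irrefl part_adj by auto
  have adj: "E z j" "E j z" if "z \<in> {x, y}" "j \<in> K - {k}" for z j
    using that assms part_adj[of z k j] sym[of z j] by auto
  have "?S \<subseteq> V"
    using assms part_V K_V by auto
  moreover have "E a b" if "a \<in> ?S" "b \<in> ?S" "a \<noteq> b" for a b
    using that adj[of a b] adj[of b a] K_adj[of a b] xy sym[OF xy] by auto
  ultimately have "clique_in E V ?S"
    unfolding clique_in_def by simp
  then have "card ?S \<le> m"
    using bound by (simp add: clique_bound_def)
  moreover have "card ?S = Suc (Suc (card (K - {k})))"
    using new finite_K by simp
  moreover have "Suc (card (K - {k})) = m"
    using card_K card_Suc_Diff1[OF finite_K assms(1)] by simp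
  ultimately show False
    by simp
qed

text \<open>Otherwise \<open>c\<close>, \<open>d\<close>, \<open>k\<close>, \<open>x\<close> is a
  \<open>K4\<close>, of which \<open>y\<close> sees exactly \<open>c\<close> and \<open>d\<close>:
  an HVN.\<close>

lemma part_complete:
  assumes "j \<in> K" "k \<in> K" "j \<noteq> k" "x \<in> part j" "y \<in> part k"
  shows "E x y"
proof (rule ccontr)
  assume xy: "\<not> E x y"
  obtain c d where cd: "c \<in> K" "d \<in> K" "c \<noteq> d" "c \<noteq> j" "c \<noteq> k" "d \<noteq> j" "d \<noteq> k"
    by (rule two_more)
  have "E c d" "E c k" "E d k" "E y c" "E y d" "\<not> E y k" "E c x" "E d x" "E k x" "\<not> E y x"
    using assms cd K_adj part_adj[of y k] part_adj[of x j, THEN sym] xy sym[of y x] by (auto simp: part_def)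
  moreover have "{c, d, k, x, y} \<subseteq> V"
    using assms cd K_V part_V by auto
  ultimately show False
    using HVN[of c d k x y] by simp
qed

text \<open>Otherwise \<open>j\<close>, \<open>x\<close>, \<open>c\<close>, \<open>d\<close> is a
  \<open>K4\<close>, of which \<open>a\<close> sees exactly \<open>j\<close> and \<open>x\<close>,
  having no second neighbour in \<open>K\<close>.\<close>

lemma rest_part_anticomplete:
  assumes "j \<in> K" "k \<in> K" "j \<noteq> k" "a \<in> rest" "E a j" "x \<in> part k"
  shows "\<not> E a x"
proof
  assume ax: "E a x"
  obtain c d where cd: "c \<in> K" "d \<in> K" "c \<noteq> d" "c \<noteq> j" "c \<noteq> k" "d \<noteq> j" "d \<noteq> k"
    by (rule two_more)
  have "\<not> E a c" "\<not> E a d"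
    using assms cd unfolding rest_def by blast+
  moreover have "E j x" "E j c" "E j d" "E x c" "E x d" "E c d"
    using assms cd K_adj part_adj[of x k] sym by blast+
  ultimately show False
    using HVN[of j x c d a] assms cd K_V part_V rest_V ax by blast
qed

text \<open>Otherwise \<open>a\<close> sees exactly \<open>x\<close> and \<open>y\<close> in the
  \<open>K4\<close> on \<open>x\<close>, \<open>y\<close>, \<open>c\<close>, \<open>d\<close>: a
  neighbour \<open>c\<close> or \<open>d\<close> of \<open>a\<close> would separate \<open>a\<close>
  from the part of \<open>x\<close> by \<open>rest_part_anticomplete\<close>.\<close>

lemma rest_one_part:
  assumes "j \<in> K" "k \<in> K" "j \<noteq> k" "a \<in> rest" "x \<in> part j" "y \<in> part k" "E a x"
  shows "\<not> E a y"
proof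
  assume ay: "E a y"
  obtain c d where cd: "c \<in> K" "d \<in> K" "c \<noteq> d" "c \<noteq> j" "c \<noteq> k" "d \<noteq> j" "d \<noteq> k"
    by (rule two_more)
  have "\<not> E a c" "\<not> E a d"
    using rest_part_anticomplete[of c j a x] rest_part_anticomplete[of d j a x] assms cd by auto
  moreover have "E x y" "E x c" "E x d" "E y c" "E y d" "E c d"
    using assms cd K_adj part_adj[of x j] part_adj[of y k] part_complete[of j k x y] by blast+
  ultimately show False
    using HVN[of x y c d a] assms cd K_V part_V rest_V ay by blast
qed

lemma parts_colorable:
  assumes "J \<subseteq> K"
  shows "colorable E (\<Union>k\<in>J. part k) (card J)"
proof -
  have "finite J"
    using assms finite_K finite_subset by blast
  then show ?thesis
    using assms
  proof (induction J rule: finite_induct)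
    case empty
    then show ?case
      by (auto intro: colorableI)
  next
    case (insert k J)
    have "colorable E (part k) 1"
      by (rule colorable_independent) (use part_independent insert.prems in auto)
    then have "colorable E (part k \<union> (\<Union>k\<in>J. part k)) (1 + card J)"
      using insert by (intro colorable_Un) auto
    then show ?case
      using insert by simp
  qed
qed

text \<open>The set \<open>rest\<close> is independent, and each of its vertices misses some part
  entirely. It can take the colour of that part, so one colour per part suffices.\<close>

lemma colorable_2K2_free:
  assumes "\<not> has_matching E 2 V"
  shows "colorable E V m"
proof -
  have indep: "\<not> E a b" if ab: "a \<in> rest" "b \<in> rest" for a b
  proof
    assume E: "E a b"
    \<comment> \<open>If \<open>a\<close> has no neighbour in \<open>K\<close>, any vertex serves as
      \<open>j\<close>. Two vertices of \<open>K\<close> other than \<open>j\<close> and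
      \<open>k\<close> form an edge far from \<open>ab\<close>.\<close>
    obtain j where j: "\<And>i. i \<in> K \<Longrightarrow> E a i \<Longrightarrow> i = j"
      using ab unfolding rest_def by blast
    obtain k where k: "\<And>i. i \<in> K \<Longrightarrow> E b i \<Longrightarrow> i = k"
      using ab unfolding rest_def by blast
    obtain x y where xy: "x \<in> K" "y \<in> K" "x \<noteq> y" "x \<noteq> j" "x \<noteq> k" "y \<noteq> j" "y \<noteq> k"
      by (rule two_more)
    then have "x \<in> far E V a b" "y \<in> far E V a b" "E x y"
      using j k K_V K_adj by (auto simp: far_def)
    then have "has_matching E 2 V"
      unfolding numeral_2_eq_2 using ab rest_V E
      by (intro has_matching_SucI[of a V b] has_matching_1I[of x _ y]) auto
    then show False
      using assms by simp
  qed
  \<comment> \<open>Two parts are enough to choose from: by \<open>rest_one_part\<close> a vertex of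
    \<open>rest\<close> that sees one of them misses the other.\<close>
  have "\<exists>k\<in>K. if v \<in> rest then \<forall>x\<in>part k. \<not> E v x else v \<in> part k" if v: "v \<in> V" for v
  proof (cases "v \<in> rest")
    case True
    obtain j k where jk: "j \<in> K" "k \<in> K" "j \<noteq> k"
      by (rule two_more)
    show ?thesis
    proof (cases "\<exists>x\<in>part j. E v x")
      case True
      then have "\<not> E v y" if "y \<in> part k" for y
        using rest_one_part[OF jk \<open>v \<in> rest\<close> _ that] by auto
      then show ?thesis
        using jk(2) \<open>v \<in> rest\<close> by auto
    next
      case False
      then show ?thesis
        using jk(1) \<open>v \<in> rest\<close> by auto
    qed
  next
    case False
    then show ?thesis
      using v V_eq by auto
  qed
  then obtain \<psi> where \<psi>: "\<And>v. v \<in> V \<Longrightarrow> \<psi> v \<in> K"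
    and part: "\<And>v. v \<in> V \<Longrightarrow> v \<notin> rest \<Longrightarrow> v \<in> part (\<psi> v)"
    and free: "\<And>v x. v \<in> V \<Longrightarrow> v \<in> rest \<Longrightarrow> x \<in> part (\<psi> v) \<Longrightarrow> \<not> E v x"
    by metis
  obtain i where i: "bij_betw i K {0..<m}"
    using ex_bij_betw_finite_nat[OF finite_K] card_K by auto
  have proper: "\<psi> u \<noteq> \<psi> v" if uv: "u \<in> V" "v \<in> V" "E u v" for u v
  proof
    assume eq: "\<psi> u = \<psi> v"
    show False
    proof (cases "u \<in> rest"; cases "v \<in> rest")
      assume "u \<notin> rest" "v \<notin> rest"
      then show False
        using part_independent[OF \<psi>[OF uv(1)] part[OF uv(1)]] part[OF uv(2)] eq uv by auto
    qed (use uv eq indep[of u v] free[of u v] free[of v u] part[of u] part[of v] sym[OF uv(3)] in auto)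
  qed
  show ?thesis
  proof (rule colorableI[where c = "\<lambda>v. i (\<psi> v)"])
    show "i (\<psi> v) < m" if "v \<in> V" for v
      using bij_betwE[OF i] \<psi>[OF that] by auto
    show "i (\<psi> u) \<noteq> i (\<psi> v)" if "u \<in> V" "v \<in> V" "E u v" for u v
      using proper[OF that] \<psi> that bij_betw_imp_inj_on[OF i] by (auto dest: inj_onD)
  qed
qed

text \<open>The function \<open>g\<close> stands for the bound for \<open>p - 1\<close>, which the
  induction provides on every set far from an edge. The condition on \<open>g\<close> ensures that a
  block of \<open>g (m - 1)\<close> colours has room for \<open>m - 1\<close> parts.\<close>

lemma colorable_step:
  assumes far: "\<And>u v A n. u \<in> V \<Longrightarrow> v \<in> V \<Longrightarrow> E u v \<Longrightarrow> A \<subseteq> far E V u v \<Longrightarrow> clique_bound E A n \<Longrightarrow>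
      colorable E A (g n)"
    and g: "m - 1 \<le> g (m - 1)"
  shows "colorable E V (g m + 2 * g (m - 1))"
proof -
  obtain k1 k2 where k: "k1 \<in> K" "k2 \<in> K" "k1 \<noteq> k2"
    by (rule two_more)
  obtain k3 where k3: "k3 \<in> K" "k3 \<noteq> k1" "k3 \<noteq> k2"
    by (rule two_more[of k1 k2])
  \<comment> \<open>Since \<open>j\<close> is the only neighbour of \<open>a\<close> in
    \<open>K\<close>, the set is far from the edge formed by \<open>i\<close> and \<open>k3\<close>;
    hence the third clique vertex.\<close>
  have rest_far: "colorable E {a \<in> rest. E a j} (g (m - 1))" if j: "j \<in> K" "i \<in> K" "j \<noteq> i" "k3 \<noteq> j" "k3 \<noteq> i" for i j
  proof (rule far[of i k3])
    have "\<not> E i a" "\<not> E k3 a" if "a \<in> rest" "E a j" for a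
      using that j k3 sym[of i a] sym[of k3 a] unfolding rest_def by blast+
    then show "{a \<in> rest. E a j} \<subseteq> far E V i k3"
      using rest_V by (auto simp: far_def)
    have "clique_bound E V (Suc (m - 1))"
      using bound m by simp
    then show "clique_bound E {a \<in> rest. E a j} (m - 1)"
      by (rule clique_bound_common_nbr[of V "m - 1" _ j]) (use j finite_V rest_V K_V sym in auto)
  qed (use j k3 K_V K_adj in auto)
  have block: "colorable E ({a \<in> rest. E a j} \<union> (\<Union>i\<in>J. part i)) (g (m - 1))"
    if j: "j \<in> K" "i \<in> K" "j \<noteq> i" "k3 \<noteq> j" "k3 \<noteq> i" and J: "J \<subseteq> K - {j}" for i j J
  proof (rule colorable_Un_anticomplete)
    show "colorable E {a \<in> rest. E a j} (g (m - 1))"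
      by (rule rest_far[OF j])
    have "card J \<le> card (K - {j})"
      using J finite_K by (intro card_mono) auto
    also have "\<dots> = m - 1"
      using j card_K finite_K by simp
    finally have "card J \<le> g (m - 1)"
      using g by simp
    then show "colorable E (\<Union>i\<in>J. part i) (g (m - 1))"
      using J by (intro colorable_mono[OF parts_colorable]) auto
    show "\<not> E u v \<and> \<not> E v u" if uv: "u \<in> {a \<in> rest. E a j}" "v \<in> (\<Union>i\<in>J. part i)" for u v
    proof -
      obtain i where i: "i \<in> J" "v \<in> part i"
        using uv by blast
      then have "i \<in> K" "j \<noteq> i"
        using J by auto
      then have "\<not> E u v"
        using rest_part_anticomplete[OF j(1) _ _ _ _ i(2)] uv by simp
      then show ?thesis
        using sym[of v u] by blast
    qed
  qed
  have "colorable E {a \<in> rest. \<not> E a k1 \<and> \<not> E a k2} (g m)"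
    by (rule far[of k1 k2])
      (use k K_V K_adj rest_V sym in \<open>auto simp: far_def intro: clique_bound_subset[OF bound]\<close>)
  moreover have "colorable E ({a \<in> rest. E a k1} \<union> (\<Union>i\<in>K - {k1}. part i)) (g (m - 1))"
    by (rule block[of k1 k2]) (use k k3 in auto)
  moreover have "colorable E ({a \<in> rest. E a k2} \<union> (\<Union>i\<in>{k1}. part i)) (g (m - 1))"
    by (rule block[of k2 k1]) (use k k3 in auto)
  ultimately have "colorable E ({a \<in> rest. \<not> E a k1 \<and> \<not> E a k2} \<union>
      ({a \<in> rest. E a k1} \<union> (\<Union>i\<in>K - {k1}. part i)) \<union>
      ({a \<in> rest. E a k2} \<union> (\<Union>i\<in>{k1}. part i))) (g m + g (m - 1) + g (m - 1))"
    by (intro colorable_Un)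
  then have "colorable E V (g m + g (m - 1) + g (m - 1))"
    by (rule colorable_subset) (subst V_eq, auto)
  then show ?thesis
    by (simp add: mult_2 add.assoc)
qed

end

text \<open>
  \<open>f_bound 3\<close> is not monotone: it takes the values \<open>13\<close> and \<open>12\<close> at \<open>3\<close> and \<open>4\<close>. The induction
  needs a monotone bound, so the value at clique number \<open>3\<close> is lowered by one.
\<close>

fun sharp :: "nat \<Rightarrow> nat \<Rightarrow> nat" where
  "sharp p m =
     (if m = 0 then 0 else if m = 1 then 1
      else if p \<le> 2 then (if m = 2 then 3 else if m = 3 then 4 else m)
      else if m = 2 then 2 * p - 2
      else if m = 3 then p * (2 * p - 3) + 3
      else sharp (p - 1) m + 2 * sharp (p - 1) (m - 1))"

declare sharp.simps [simp del]

lemma sharp_1: "sharp p (Suc 0) = 1"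
  and sharp_2_2: "sharp 2 2 = 3"
  and sharp_2_3: "sharp 2 3 = 4"
  and sharp_2: "m \<ge> 4 \<Longrightarrow> sharp 2 m = m"
  and sharp_eq_2: "p \<ge> 3 \<Longrightarrow> sharp p 2 = 2 * p - 2"
  and sharp_eq_3: "p \<ge> 3 \<Longrightarrow> sharp p 3 = p * (2 * p - 3) + 3"
  and sharp_rec: "p \<ge> 3 \<Longrightarrow> m \<ge> 4 \<Longrightarrow> sharp p m = sharp (p - 1) m + 2 * sharp (p - 1) (m - 1)"
  by (simp_all add: sharp.simps)

text \<open>Both functions obey the same recurrence, so the gain at clique number 3 is passed
  on.\<close>

lemma sharp_le_f_bound:
  assumes "p \<ge> 2"
  shows "sharp p m \<le> f_bound p m"
  using assms
proof (induction p m rule: sharp.induct)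
  case (1 p m)
  show ?case
  proof (cases "p = 2 \<or> m \<le> 3")
    case True
    have "2 * p ^ 2 - 3 * p = p * (2 * p - 3)"
      by (simp add: power2_eq_square diff_mult_distrib2)
    then show ?thesis
      using True \<open>p \<ge> 2\<close> by (auto simp: sharp.simps[of p m] f_bound.simps[of p m])
  next
    case False
    then have "sharp (p - 1) m \<le> f_bound (p - 1) m" "sharp (p - 1) (m - 1) \<le> f_bound (p - 1) (m - 1)"
      using 1 by auto
    then show ?thesis
      using False \<open>p \<ge> 2\<close> by (simp add: sharp.simps[of p m] f_bound.simps[of p m])
  qed
qed

text \<open>Needed when the assumed bound on the clique number is not attained and the bound for a
  smaller clique number has to suffice.\<close>

lemma sharp_mono_Suc: "p \<ge> 2 \<Longrightarrow> sharp p m \<le> sharp p (Suc m)"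
proof (induction p arbitrary: m rule: nat_induct_at_least)
  case base
  show ?case
    by (simp add: sharp.simps)
next
  case (Suc p)
  consider "m \<le> 1" | "m = 2" | "m = 3" | "m \<ge> 4"
    by linarith
  then show ?case
  proof cases
    case 1
    then show ?thesis
      using Suc.hyps by (cases m) (auto simp: sharp.simps)
  next
    case 2
    obtain n where "p = Suc (Suc n)"
      using Suc.hyps by (metis add_2_eq_Suc le_Suc_ex)
    then show ?thesis
      using 2 by (simp add: sharp_eq_2 sharp_eq_3 algebra_simps flip: numeral_3_eq_3)
  next
    case 3
    have "sharp p 3 \<le> sharp p 4"
      using Suc.IH[of 3] by simp
    \<comment> \<open>The tight spot: for \<open>p = 2\<close> both sides are 12.\<close>
    moreover have "Suc p * (2 * Suc p - 3) + 3 \<le> 3 * sharp p 3"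
    proof (cases "p = 2")
      case True
      then show ?thesis
        by (simp add: sharp_2_3)
    next
      case False
      then obtain n where "p = Suc (Suc (Suc n))"
        using Suc.hyps by (metis Suc_le_D le_antisym not_less_eq_eq numeral_2_eq_2)
      then show ?thesis
        by (simp add: sharp_eq_3 algebra_simps)
    qed
    ultimately show ?thesis
      using 3 Suc.hyps sharp_eq_3[of "Suc p"] sharp_rec[of "Suc p" 4] by simp
  next
    case 4
    then show ?thesis
      using Suc.hyps Suc.IH[of m] Suc.IH[of "m - 1"] sharp_rec[of "Suc p" m] sharp_rec[of "Suc p" "Suc m"]
      by simp
  qed
qed

text \<open>Supplies the condition on \<open>g\<close> in \<open>colorable_step\<close>.\<close>

lemma sharp_ge: "p \<ge> 2 \<Longrightarrow> m \<le> sharp p m"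
proof (induction p arbitrary: m rule: nat_induct_at_least)
  case base
  show ?case
    by (simp add: sharp.simps)
next
  case (Suc p)
  then show ?case
    using Suc.IH[of m] sharp_rec[of "Suc p" m]
    by (cases "m \<ge> 4") (auto simp: sharp.simps[of "Suc p" m] intro: trans_le_add1)
qed

section \<open>Colour bounds by induction on the size of the excluded matching\<close>

context simple_graph
begin

text \<open>Common neighbours of \<open>u\<close> and \<open>v\<close> are charged to
  \<open>u\<close> alone; the K4-free case gains from this.\<close>

lemma colorable_nbrs_far:
  assumes "colorable E {x \<in> W. E u x} k" "colorable E {x \<in> W. E v x \<and> \<not> E u x} l"
    and "colorable E (far E W u v) n"
  shows "colorable E W (k + l + n)"
proof -
  have "colorable E ({x \<in> W. E u x} \<union> {x \<in> W. E v x \<and> \<not> E u x} \<union> far E W u v) (k + l + n)"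
    using assms by (intro colorable_Un)
  then show ?thesis
    by (rule colorable_subset) (auto simp: far_def)
qed

lemma not_has_matching_far:
  "\<not> has_matching E (Suc p) W \<Longrightarrow> u \<in> W \<Longrightarrow> v \<in> W \<Longrightarrow> E u v \<Longrightarrow> A \<subseteq> far E W u v \<Longrightarrow> \<not> has_matching E p A"
  using has_matching_SucI[of u W v E p] has_matching_mono[of E p A] by blast

lemma colorable_triangle_free:
  assumes "p \<ge> 2" "finite W" "\<not> has_matching E p W" "clique_bound E W 2"
  shows "colorable E W (sharp p 2)"
  using assms
proof (induction p arbitrary: W rule: nat_induct_at_least)
  case base
  show ?case
  proof (cases "\<exists>u\<in>W. \<exists>v\<in>W. E u v")
    case True
    then obtain u v where uv: "u \<in> W" "v \<in> W" "E u v"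
      by blast
    have tri: "\<not> E b c" if "{a, b, c} \<subseteq> W" "E a b" "E a c" for a b c
      using clique_bound_2[OF base(3) that] .
    have nbr: "colorable E A 1" if "A \<subseteq> {x \<in> W. E a x}" "a \<in> W" for A a
    proof (rule colorable_independent)
      fix x y assume "x \<in> A" "y \<in> A"
      then show "\<not> E x y"
        using tri[of a x y] that by auto
    qed
    have far: "\<not> E x y" if "x \<in> far E W u v" "y \<in> far E W u v" for x y
      using base(2) has_matching_SucI[OF uv has_matching_1I[OF that]] by (auto simp: numeral_2_eq_2)
    have "colorable E W (1 + 1 + 1)"
      using uv far by (intro colorable_nbrs_far[of W u 1 v 1 1] nbr[of _ u] nbr[of _ v] colorable_independent) auto
    then show ?thesis
      by (rule colorable_mono) (simp add: sharp_2_2)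
  next
    case False
    then have "colorable E W 1"
      by (intro colorable_independent) auto
    then show ?thesis
      by (rule colorable_mono) (simp add: sharp_2_2)
  qed
next
  case (Suc p)
  have tri: "\<not> E b c" if "{a, b, c} \<subseteq> W" "E a b" "E a c" for a b c
    using clique_bound_2[OF Suc.prems(3) that] .
  have nbr: "colorable E A 1" if "A \<subseteq> {x \<in> W. E a x}" "a \<in> W" for A a
  proof (rule colorable_independent)
    fix x y assume "x \<in> A" "y \<in> A"
    then show "\<not> E x y"
      using tri[of a x y] that by auto
  qed
  show ?case
  \<comment> \<open>Here the excluded matching has three edges. Brandt's theorem gives 4 colours,
    which is \<open>2 * 3 - 2\<close>; from there on each further edge adds 2.\<close>
  proof (cases "p = 2")
    case True
    then have "colorable E W 4"
      using Suc.prems tri by (intro colorable_3K2_K3_free) (auto simp: numeral_3_eq_3 numeral_2_eq_2)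
    then show ?thesis
      using True by (simp add: sharp_eq_2)
  next
    case False
    show ?thesis
    proof (cases "\<exists>u\<in>W. \<exists>v\<in>W. E u v")
      case True
      then obtain u v where uv: "u \<in> W" "v \<in> W" "E u v"
        by blast
      have "colorable E (far E W u v) (sharp p 2)"
      proof (rule Suc.IH)
        have "far E W u v \<subseteq> W"
          by (auto simp: far_def)
        then show "finite (far E W u v)" "clique_bound E (far E W u v) 2"
          using Suc.prems finite_subset[of "far E W u v" W] clique_bound_subset[of E W 2 "far E W u v"] by auto
        show "\<not> has_matching E p (far E W u v)"
          using not_has_matching_far[OF Suc.prems(2) uv] by simp
      qed
      then have "colorable E W (1 + 1 + sharp p 2)"
        using uv by (intro colorable_nbrs_far[of W u 1 v 1] nbr[of _ u] nbr[of _ v]) auto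
      moreover have "1 + 1 + sharp p 2 = sharp (Suc p) 2"
      proof -
        have "p \<ge> 3"
          using False Suc.hyps by simp
        then show ?thesis
          using sharp_eq_2[of p] sharp_eq_2[of "Suc p"] by simp
      qed
      ultimately show ?thesis
        by simp
    next
      case no_edge: False
      then have "colorable E W 1"
        by (intro colorable_independent) auto
      moreover have "1 \<le> sharp (Suc p) 2"
        using sharp_ge[of "Suc p" 2] Suc.hyps by linarith
      ultimately show ?thesis
        by (rule colorable_mono)
    qed
  qed
qed

text \<open>For a triangle \<open>u\<close>, \<open>v\<close>, \<open>w\<close>, the common
  neighbours of two of its vertices are independent, and the neighbours of \<open>u\<close> that
  miss \<open>v\<close> and \<open>w\<close> are triangle-free and far from \<open>vw\<close>. One
  step thus adds \<open>3 + 2 * sharp p 2\<close>, that is \<open>4 * p - 1\<close> for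
  \<open>p \<ge> 3\<close>, which sums to a quadratic bound.\<close>

lemma colorable_K4_free:
  assumes "p \<ge> 2" "finite W" "\<not> has_matching E p W" "clique_bound E W 3"
  shows "colorable E W (sharp p 3)"
  using assms
proof (induction p arbitrary: W rule: nat_induct_at_least)
  case base
  have "colorable E W 4"
    by (rule colorable_2K2_K4_free[OF base(1,2)]) (rule clique_bound_3[OF base(3)])
  then show ?case
    by (simp add: sharp_2_3)
next
  case (Suc p)
  show ?case
  proof (cases "\<exists>K. clique_in E W K \<and> card K = 3")
    case False
    then have "clique_bound E W 2"
      using clique_bound_pred[of W 2] Suc.prems(3) by (simp add: numeral_3_eq_3 numeral_2_eq_2)
    then have "colorable E W (sharp (Suc p) 2)"
      using Suc by (intro colorable_triangle_free) auto
    then show ?thesis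
      using sharp_mono_Suc[of "Suc p" 2] Suc.hyps colorable_mono by (auto simp: numeral_3_eq_3)
  next
    case True
    then obtain u v w where "clique_in E W {u, v, w}" "u \<noteq> v" "u \<noteq> w" "v \<noteq> w"
      by (auto simp: card_3_iff)
    then have uvw: "u \<in> W" "v \<in> W" "w \<in> W" "E u v" "E u w" "E v w" "E v u"
      by (auto simp: clique_in_def)
    have K4: "\<not> E c d" if "{a, b, c, d} \<subseteq> W" "E a b" "E a c" "E a d" "E b c" "E b d" for a b c d
      using clique_bound_3[OF Suc.prems(3) that] .
    have nbr: "clique_bound E A 2" if "A \<subseteq> {x \<in> W. E a x}" "a \<in> W" for A a
      using clique_bound_common_nbr[of W 2 A a] Suc.prems that by (auto simp: numeral_3_eq_3 numeral_2_eq_2)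
    have far: "colorable E (far E W u v) (sharp p 3)"
    proof (rule Suc.IH)
      have "far E W u v \<subseteq> W"
        by (auto simp: far_def)
      then show "finite (far E W u v)" "clique_bound E (far E W u v) 3"
        using Suc.prems finite_subset[of "far E W u v" W] clique_bound_subset[of E W 3 "far E W u v"] by auto
      show "\<not> has_matching E p (far E W u v)"
        using not_has_matching_far[OF Suc.prems(2) uvw(1,2,4)] by simp
    qed
    have common: "colorable E {x \<in> W. E a x \<and> E b x} 1" if "a \<in> W" "b \<in> W" "E a b" for a b
    proof (rule colorable_independent)
      fix x y assume "x \<in> {x \<in> W. E a x \<and> E b x}" "y \<in> {x \<in> W. E a x \<and> E b x}"
      then show "\<not> E x y"
        using K4[of a b x y] that by auto
    qed
    show ?thesis
    \<comment> \<open>The general step would give \<open>1 + 4 + 4 + 4 = 13\<close>, the value of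
      \<open>f_bound 3 3\<close>. Since each neighbourhood is 4-colourable as a triangle-free
      \<open>3K2\<close>-free graph, \<open>4 + 4 + 4 = 12\<close> colours suffice, as monotonicity
      requires.\<close>
    proof (cases "p = 2")
      case True
      have four: "colorable E A 4" if "A \<subseteq> {x \<in> W. E a x}" "a \<in> W" for A a
      proof -
        have "\<not> has_matching E 3 A"
          using Suc.prems(2) True that has_matching_mono[of E 3 A W] by auto
        then have "colorable E A (sharp 3 2)"
          using Suc.prems(1) nbr[OF that] that finite_subset[of A W] by (intro colorable_triangle_free) auto
        then show ?thesis
          by (simp add: sharp_eq_2)
      qed
      have "colorable E W (4 + 4 + sharp p 3)"
        using uvw by (intro colorable_nbrs_far[OF _ _ far] four[of _ u] four[of _ v]) auto
      then show ?thesis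
        using True by (simp add: sharp_eq_3 sharp_2_3)
    next
      case False
      \<comment> \<open>The part of this set that sees \<open>w\<close> is independent; the part
        that misses \<open>w\<close> is far from the edge \<open>bw\<close>.\<close>
      have side: "colorable E {x \<in> W. E a x \<and> \<not> E b x} (1 + sharp p 2)"
        if ab: "a \<in> W" "b \<in> W" "E a w" "E b w" "E a b" for a b
      proof -
        have "colorable E {x \<in> W. E a x \<and> \<not> E b x \<and> \<not> E w x} (sharp p 2)"
        proof (rule colorable_triangle_free)
          show "\<not> has_matching E p {x \<in> W. E a x \<and> \<not> E b x \<and> \<not> E w x}"
            by (rule not_has_matching_far[OF Suc.prems(2) ab(2) uvw(3) ab(4)]) (auto simp: far_def)
          show "clique_bound E {x \<in> W. E a x \<and> \<not> E b x \<and> \<not> E w x} 2"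
            by (rule nbr[of _ a]) (use ab in auto)
        qed (use Suc in auto)
        then have "colorable E ({x \<in> W. E a x \<and> E w x} \<union> {x \<in> W. E a x \<and> \<not> E b x \<and> \<not> E w x}) (1 + sharp p 2)"
          using common[of a w] ab uvw by (intro colorable_Un) auto
        then show ?thesis
          by (rule colorable_subset) auto
      qed
      have "colorable E ({x \<in> W. E u x \<and> E v x} \<union> {x \<in> W. E u x \<and> \<not> E v x}) (1 + (1 + sharp p 2))"
        using common[of u v] side[of u v] uvw by (intro colorable_Un) auto
      then have "colorable E {x \<in> W. E u x} (1 + (1 + sharp p 2))"
        by (rule colorable_subset) auto
      then have "colorable E W (1 + (1 + sharp p 2) + (1 + sharp p 2) + sharp p 3)"
        using side[of v u] far uvw by (intro colorable_nbrs_far) auto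
      moreover obtain n where "p = Suc (Suc (Suc n))"
        using False Suc.hyps by (metis Suc_le_D le_antisym not_less_eq_eq numeral_2_eq_2)
      ultimately show ?thesis
        by (simp add: sharp_eq_2 sharp_eq_3 algebra_simps)
    qed
  qed
qed

lemma colorable_sharp_small:
  assumes "p \<ge> 2" "finite W" "\<not> has_matching E p W" "clique_bound E W m" "m \<le> 3"
  shows "colorable E W (sharp p m)"
proof -
  consider "m = 0" | "m = 1" | "m = 2" | "m = 3"
    using assms(5) by linarith
  then show ?thesis
  proof cases
    case 1
    then have "W = {}"
      using assms(4) clique_bound_0 by blast
    then show ?thesis
      by (auto intro: colorableI)
  next
    case 2
    then show ?thesis
      using assms(4) clique_bound_1[of W] colorable_independent[of W E] by (auto simp: sharp_1)
  next
    case 3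
    then show ?thesis
      using assms colorable_triangle_free by blast
  next
    case 4
    then show ?thesis
      using assms colorable_K4_free by blast
  qed
qed

text \<open>Inside the induction on \<open>p\<close> runs one on \<open>m\<close>. If no clique has
  size \<open>m\<close>, the bound for \<open>m - 1\<close> applies by monotonicity; otherwise such
  a clique is maximum and its structure can be used.\<close>

theorem colorable_sharp:
  assumes "p \<ge> 2" "finite W" "\<not> has_matching E p W" "HVN_free E W" "clique_bound E W m"
  shows "colorable E W (sharp p m)"
  using assms
proof (induction p arbitrary: W m rule: nat_induct_at_least)
  case base
  show ?case
    using base.prems
  proof (induction m)
    case 0
    then show ?case
      by (intro colorable_sharp_small) auto
  next
    case (Suc m)
    consider "Suc m \<le> 3" | "Suc m \<ge> 4" "\<not> (\<exists>K. clique_in E W K \<and> card K = Suc m)"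
      | K where "Suc m \<ge> 4" "clique_in E W K" "card K = Suc m"
      by fastforce
    then show ?case
    proof cases
      case 1
      then show ?thesis
        using Suc.prems by (intro colorable_sharp_small) auto
    next
      case 2
      then have "colorable E W (sharp 2 m)"
        using Suc.IH[OF Suc.prems(1-3) clique_bound_pred[OF Suc.prems(4)]] by simp
      then show ?thesis
        using sharp_mono_Suc[of 2 m] colorable_mono by blast
    next
      case 3
      then interpret max: maximum_clique W E "Suc m" K
        using Suc.prems by unfold_locales auto
      show ?thesis
        using max.colorable_2K2_free Suc.prems 3 by (simp add: sharp_2)
    qed
  qed
next
  case (Suc p)
  note IHp = Suc.IH and p = Suc.hyps
  show ?case
    using Suc.prems
  proof (induction m)
    case 0
    then show ?case
      using p by (intro colorable_sharp_small) auto
  next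
    case (Suc m)
    consider "Suc m \<le> 3" | "Suc m \<ge> 4" "\<not> (\<exists>K. clique_in E W K \<and> card K = Suc m)"
      | K where "Suc m \<ge> 4" "clique_in E W K" "card K = Suc m"
      by fastforce
    then show ?case
    proof cases
      case 1
      then show ?thesis
        using Suc.prems p by (intro colorable_sharp_small) auto
    next
      case 2
      then have "colorable E W (sharp (Suc p) m)"
        using Suc.IH[OF Suc.prems(1-3) clique_bound_pred[OF Suc.prems(4)]] by simp
      then show ?thesis
        using sharp_mono_Suc[of "Suc p" m] p colorable_mono by fastforce
    next
      case 3
      then interpret max: maximum_clique W E "Suc m" K
        using Suc.prems by unfold_locales auto
      have "colorable E W (sharp p (Suc m) + 2 * sharp p (Suc m - 1))"
      proof (rule max.colorable_step)
        fix u v A n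
        assume uv: "u \<in> W" "v \<in> W" "E u v" and A: "A \<subseteq> far E W u v" and n: "clique_bound E A n"
        then have "A \<subseteq> W"
          by (auto simp: far_def)
        then show "colorable E A (sharp p n)"
          using IHp[of A n] not_has_matching_far[OF Suc.prems(2) uv A] n Suc.prems(1,3)
            finite_subset[of A W] HVN_free_subset[of E W A] by blast
      qed (use sharp_ge[of p m] p in simp)
      then show ?thesis
        using p 3 by (simp add: sharp_rec)
    qed
  qed
qed

end

section \<open>Induced subgraphs of pair graphs\<close>

text \<open>Unfolds the recursion into an explicit numbering in which \<open>i div 2\<close> is the
  number of the edge that contains the vertex \<open>i\<close>, matching the numbering in
  \<open>matching_graph\<close>.\<close>

lemma has_matching_embedding:
  assumes "simple_graph E" "has_matching E p W"
  obtains f :: "nat \<Rightarrow> 'a" where "\<And>i. i < 2 * p \<Longrightarrow> f i \<in> W" "inj_on f {..<2 * p}"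
    "\<And>i j. i < 2 * p \<Longrightarrow> j < 2 * p \<Longrightarrow> E (f i) (f j) \<longleftrightarrow> i \<noteq> j \<and> i div 2 = j div 2"
proof -
  interpret simple_graph W E
    by (rule assms(1))
  have "\<exists>f. (\<forall>i<2 * p. f i \<in> W) \<and> inj_on f {..<2 * p} \<and>
      (\<forall>i<2 * p. \<forall>j<2 * p. E (f i) (f j) \<longleftrightarrow> i \<noteq> j \<and> i div 2 = j div 2)"
    using assms(2)
  proof (induction p arbitrary: W)
    case (Suc p)
    then obtain u v where uv: "u \<in> W" "v \<in> W" "E u v" "has_matching E p (far E W u v)"
      by (auto simp: has_matching.simps)
    obtain f where f: "\<And>i. i < 2 * p \<Longrightarrow> f i \<in> far E W u v" "inj_on f {..<2 * p}"
      "\<And>i j. i < 2 * p \<Longrightarrow> j < 2 * p \<Longrightarrow> E (f i) (f j) \<longleftrightarrow> i \<noteq> j \<and> i div 2 = j div 2"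
      using Suc.IH[OF uv(4)] by auto
    \<comment> \<open>The edge peeled off by the recursion receives the two largest numbers.\<close>
    let ?f = "f(2 * p := u, Suc (2 * p) := v)"
    have old: "f i \<in> W" "\<not> E u (f i)" "\<not> E v (f i)" "\<not> E (f i) u" "\<not> E (f i) v" "f i \<noteq> u" "f i \<noteq> v"
      if "i < 2 * p" for i
      using f(1)[OF that] uv sym[of "f i"] sym[OF uv(3)] by (auto simp: far_def)
    have less: "i < 2 * Suc p \<longleftrightarrow> i < 2 * p \<or> i = 2 * p \<or> i = Suc (2 * p)" for i
      by auto
    have "u \<noteq> v"
      using uv irrefl by auto
    have "?f i \<in> W" if "i < 2 * Suc p" for i
      using that old uv unfolding less by auto
    moreover have "inj_on ?f {..<2 * Suc p}"
    proof (rule inj_onI)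
      fix i j assume "i \<in> {..<2 * Suc p}" "j \<in> {..<2 * Suc p}" "?f i = ?f j"
      then show "i = j"
        using old(6,7)[of i] old(6,7)[of j] \<open>u \<noteq> v\<close> inj_onD[OF f(2), of i j]
        unfolding lessThan_iff less by (auto split: if_splits)
    qed
    moreover have "E (?f i) (?f j) \<longleftrightarrow> i \<noteq> j \<and> i div 2 = j div 2" if "i < 2 * Suc p" "j < 2 * Suc p" for i j
      using that old[of i] old[of j] f(3)[of i j] uv(3) sym[OF uv(3)] irrefl
      unfolding less by auto
    ultimately show ?case
      by blast
  qed simp
  then show thesis
    using that by blast
qed

text \<open>Reduces freeness to embeddings: the image of a map that preserves and reflects arcs
  induces a subgraph isomorphic to \<open>H\<close>. The isomorphism runs from the subgraph to
  \<open>H\<close>, so it is built from the inverse \<open>h\<close> of \<open>f\<close>.\<close>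

lemma free_ofD:
  assumes "free_of F G" "pair_graph G" "H \<in> F" "pair_graph H"
    and f: "inj_on f (pverts H)" "f ` pverts H \<subseteq> pverts G"
    and arcs: "\<And>u v. u \<in> pverts H \<Longrightarrow> v \<in> pverts H \<Longrightarrow> (f u, f v) \<in> parcs G \<longleftrightarrow> (u, v) \<in> parcs H"
  shows False
proof -
  interpret G: pair_graph G
    by (rule assms(2))
  interpret H: pair_graph H
    by (rule assms(4))
  define S where "S = \<lparr> pverts = f ` pverts H,
      parcs = {(u, v) \<in> parcs G. u \<in> f ` pverts H \<and> v \<in> f ` pverts H} \<rparr>"
  define h where "h = the_inv_into (pverts H) f"
  have h: "h (f u) = u" if "u \<in> pverts H" for u
    using that f by (simp add: h_def the_inv_into_f_f)
  have S_wf: "wf_digraph (with_proj S)"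
    by unfold_locales (auto simp: S_def)
  have "induced_subgraph (with_proj S) (with_proj G)"
    using S_wf G.wf_digraph_axioms f
    by (auto simp: induced_subgraph_def subgraph_def compatible_def S_def)
  moreover have "digraph_iso (with_proj S) (with_proj H)"
  proof -
    let ?hom = "\<lparr> iso_verts = h, iso_arcs = map_prod h h, iso_head = snd, iso_tail = fst \<rparr>"
    have inj: "inj_on h (f ` pverts H)"
      by (rule inj_onI) (auto simp: h)
    have "inj_on (map_prod h h) (parcs S)"
      by (rule inj_on_subset[OF map_prod_inj_on[OF inj inj]]) (auto simp: S_def)
    then have "pre_digraph.digraph_isomorphism (with_proj S) ?hom"
      using S_wf inj by (auto simp: pre_digraph.digraph_isomorphism_def S_def)
    moreover have "map_prod h h ` parcs S = parcs H"
    proof (intro equalityI subsetI)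
      fix e assume "e \<in> parcs H"
      then obtain u v where e: "e = (u, v)" "(u, v) \<in> parcs H"
        by (cases e) auto
      then have uv: "u \<in> pverts H" "v \<in> pverts H"
        using H.in_arcsD1 H.in_arcsD2 by auto
      then have "(f u, f v) \<in> parcs S"
        using e arcs by (auto simp: S_def)
      then show "e \<in> map_prod h h ` parcs S"
        using e uv h by (auto intro!: image_eqI[of _ _ "(f u, f v)"])
    qed (auto simp: S_def h arcs)
    moreover have "h ` f ` pverts H = pverts H"
      using h by (force simp: image_iff)
    ultimately show ?thesis
      unfolding digraph_iso_def
      by (intro exI[of _ ?hom]) (simp add: app_iso_def with_proj_def S_def)
  qed
  ultimately show False
    using assms(1,3) unfolding free_of_def by blast
qed

theorem theorem3p6:
  fixes G :: "'a pair_pre_digraph" and p :: nat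
  assumes "p \<ge> 2"
    and "pair_graph G"
    and "free_of {matching_graph p, HVN} G"
  shows "chromatic_number G \<le> f_bound p (clique_number G)"
proof -
  interpret pair_graph G
    by (rule assms(2))
  define E where "E u v \<longleftrightarrow> (u, v) \<in> parcs G" for u v
  have sg: "simple_graph E"
    using sym_arcs no_loops' by unfold_locales (auto simp: E_def symmetric_def dest: symD)
  interpret simple_graph "pverts G" E
    by (rule sg)
  have "\<not> has_matching E p (pverts G)"
  proof
    assume "has_matching E p (pverts G)"
    then obtain f :: "nat \<Rightarrow> 'a" where f: "\<And>i. i < 2 * p \<Longrightarrow> f i \<in> pverts G" "inj_on f {..<2 * p}"
      "\<And>i j. i < 2 * p \<Longrightarrow> j < 2 * p \<Longrightarrow> E (f i) (f j) \<longleftrightarrow> i \<noteq> j \<and> i div 2 = j div 2"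
      using has_matching_embedding[OF sg] by metis
    have arcs: "(i, j) \<in> parcs (matching_graph p) \<longleftrightarrow> i \<noteq> j \<and> i div 2 = j div 2"
      if "i < 2 * p" "j < 2 * p" for i j
    proof
      assume "i \<noteq> j \<and> i div 2 = j div 2"
      then have "i = 2 * (i div 2) \<and> j = 2 * (i div 2) + 1 \<or> i = 2 * (i div 2) + 1 \<and> j = 2 * (i div 2)"
        "i div 2 < p"
        using that by linarith+
      then show "(i, j) \<in> parcs (matching_graph p)"
        unfolding matching_graph_def by auto
    qed (auto simp: matching_graph_def)
    show False
      by (rule free_ofD[OF assms(3,2) _ pair_graph_matching_graph, of p f])
        (use f arcs in \<open>auto simp: E_def matching_graph_def\<close>)
  qed
  moreover have "HVN_free E (pverts G)"
    unfolding HVN_free_def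
  proof (intro allI impI, rule ccontr)
    fix a b c d x
    assume V: "{a, b, c, d, x} \<subseteq> pverts G" and adj: "E a b" "E a c" "E a d" "E b c" "E b d" "E c d"
      and x: "E x a" "E x b" "\<not> (E x c \<or> E x d)"
    let ?f = "\<lambda>i. [a, b, c, d, x] ! i"
    have five: "{..<5} = {0, 1, 2, 3, 4 :: nat}"
      by auto
    \<comment> \<open>\<open>x\<close> differs from \<open>c\<close> and \<open>d\<close> because
      these are adjacent to each other, whereas \<open>x\<close> is adjacent to neither.\<close>
    have "a \<noteq> b" "a \<noteq> c" "a \<noteq> d" "b \<noteq> c" "b \<noteq> d" "c \<noteq> d" "x \<noteq> a" "x \<noteq> b" "x \<noteq> c" "x \<noteq> d"
      using adj x irrefl sym[OF adj(6)] by auto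
    then have "inj_on ?f (pverts HVN)"
      by (simp add: HVN_def five)
    moreover have "?f ` pverts HVN \<subseteq> pverts G"
      using V by (simp add: HVN_def five)
    moreover have "(?f i, ?f j) \<in> parcs G \<longleftrightarrow> (i, j) \<in> parcs HVN" if "i \<in> pverts HVN" "j \<in> pverts HVN" for i j
    proof -
      have "\<not> E c x" "\<not> E d x" "\<not> E x c" "\<not> E x d"
        using x sym by blast+
      moreover have "i \<in> {0, 1, 2, 3, 4}" "j \<in> {0, 1, 2, 3, 4}"
        using that by (simp_all only: HVN_def five pair_pre_digraph.simps)
      ultimately have "E (?f i) (?f j) \<longleftrightarrow> (i, j) \<in> parcs HVN"
        using adj adj[THEN sym] x(1,2) x(1,2)[THEN sym]
        by (elim insertE emptyE) (simp_all add: HVN_def irrefl)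
      then show ?thesis
        by (simp add: E_def)
    qed
    ultimately show False
      using free_ofD[OF assms(3,2) _ pair_graph_HVN, of ?f] by simp
  qed
  moreover have "clique_bound E (pverts G) (clique_number G)"
    unfolding clique_bound_def
  proof (intro allI impI)
    fix K assume "clique_in E (pverts G) K"
    then have "is_clique G K"
      by (simp add: clique_in_def is_clique_def E_def)
    moreover have "finite {K. is_clique G K}"
      by (rule finite_subset[of _ "Pow (pverts G)"]) (auto simp: is_clique_def)
    ultimately show "card K \<le> clique_number G"
      unfolding clique_number_def by (intro Max_ge) auto
  qed
  ultimately have "colorable E (pverts G) (sharp p (clique_number G))"
    using assms(1) by (intro colorable_sharp) auto
  then have "colorable E (pverts G) (f_bound p (clique_number G))"
    using sharp_le_f_bound[OF assms(1)] by (rule colorable_mono)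
  then obtain c where c: "\<And>v. v \<in> pverts G \<Longrightarrow> c v < f_bound p (clique_number G)"
    "\<And>u v. u \<in> pverts G \<Longrightarrow> v \<in> pverts G \<Longrightarrow> E u v \<Longrightarrow> c u \<noteq> c v"
    using colorableE by metis
  have "proper_coloring G (f_bound p (clique_number G)) c"
    unfolding proper_coloring_def
  proof (intro conjI ballI)
    fix e assume "e \<in> parcs G"
    then show "case e of (u, v) \<Rightarrow> c u \<noteq> c v"
      using c(2)[of "fst e" "snd e"] in_arcsD1 in_arcsD2 by (cases e) (auto simp: E_def)
  qed (use c in auto)
  then show ?thesis
    unfolding chromatic_number_def by (intro Least_le) auto
qed

end
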